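(* For every $k\ge1$ and every partition $\lambda$ we have $$D_k\,s_\lambda=\sum_{\substack{\mu\supset\lambda\,:\,|\mu|-|\lambda|=k\\ cc(\mu/\lambda)\le2}}d_{\lambda\mu}\,s_\mu,\qquad D_k^\perp\,s_\lambda=\sum_{\substack{\mu\subset\lambda\,:\,|\lambda|-|\mu|=k\\ cc(\lambda/\mu)\le2}}d_{\mu\lambda}\,s_\mu;$$ if $\mu/\lambda$ is a border strip, then $$d_{\lambda\mu}=(-1)^{\operatorname{ht}(\mu/\lambda)}\left(\sum_{b\in\operatorname{SC}(\mu/\lambda)}c(b)-\sum_{b\in\operatorname{DC}(\mu/\lambda)}c(b)\right),$$ and if $\mu/\lambda$ has two connected components, then $d_{\lambda\mu}=(-1)^{\operatorname{ht}(\mu/\lambda)}$.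
   Context: $D_k:=\sum_{i\ge1}x_i^{k+1}\,\partial/\partial x_i$ acting on symmetric functions in $x_1,x_2,\ldots$; $D_k^\perp$ is its adjoint with respect to the standard scalar product on symmetric functions (for which monomial and complete homogeneous functions are dual, i.e. Schur functions $s_\lambda$ are orthonormal). Partitions are identified with their Young diagrams (English convention: row $i$ has $\lambda_i$ boxes, rows numbered downwards). The content of a box $b$ in row $i(b)$ and column $j(b)$ is $c(b)=j(b)-i(b)$ (for boxes of $\mu/\lambda$, computed in the position they have in $\mu$). A skew shape is a border strip if it is connected (through edges of boxes) and contains no $2\times2$ block of boxes; it is a broken border strip if it contains no $2\times2$ block of boxes, so that its connected components are border strips. The height $\operatorname{ht}$ of a broken border strip is one less than the number of rows it occupies. A sharp corner of a broken border strip is a box of it having no box (of the strip) above it or to its left. A dull corner is a box that has a box to its left and a box above it, but no box directly northwest of it (all within the strip). $\operatorname{SC}$ and $\operatorname{DC}$ are the sets of sharp and dull corners. $cc(\mu/\lambda)$ is the number of connected components of $\mu/\lambda$ if it is a broken border strip, and $\infty$ otherwise. *)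

theory Defs
  imports "HOL-Library.Poly_Mapping" "HOL-Library.FuncSet" "HOL-Library.Extended_Nat"
begin

abbreviation lookup :: "('a \<Rightarrow>\<^sub>0 'b::zero) \<Rightarrow> 'a \<Rightarrow> 'b" where
  "lookup \<equiv> Poly_Mapping.lookup"

abbreviation keys :: "('a \<Rightarrow>\<^sub>0 'b::zero) \<Rightarrow> 'a set" where
  "keys \<equiv> Poly_Mapping.keys"


section \<open>Formal power series in countably many variables\<close>

text \<open>
  A finitely supported \<open>\<alpha> :: nat \<Rightarrow>\<^sub>0 nat\<close> stands for the monomial whose exponent of the
  \<open>i\<close>-th variable is \<open>lookup \<alpha> i\<close>. Variables are numbered from \<open>0\<close>, so variable \<open>i\<close>
  is the usual \<open>x\<^sub>i\<^sub>+\<^sub>1\<close>.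
\<close>

typedef 'a power_series = "UNIV :: ((nat \<Rightarrow>\<^sub>0 nat) \<Rightarrow> 'a) set"
  morphisms coeff Series by simp

lemma coeff_Series [simp]: "coeff (Series f) = f"
  by (simp add: Series_inverse)

lemma series_eqI: "(\<And>\<alpha>. coeff f \<alpha> = coeff g \<alpha>) \<Longrightarrow> f = g"
  by (metis coeff_inject ext)

lemma finite_divisors: "finite {p :: (nat \<Rightarrow>\<^sub>0 nat) \<times> (nat \<Rightarrow>\<^sub>0 nat). fst p + snd p = \<alpha>}"
proof -
  have fin: "finite {\<beta> :: nat \<Rightarrow>\<^sub>0 nat. \<exists>\<gamma>. \<beta> + \<gamma> = \<alpha>}" (is "finite ?B")
  proof (rule finite_imageD)
    let ?F = "{h. \<forall>i. (i \<in> keys \<alpha> \<longrightarrow> h i \<in> {..Max (lookup \<alpha> ` keys \<alpha>)}) \<and> (i \<notin> keys \<alpha> \<longrightarrow> h i = 0)}"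
    have lookup_in: "lookup \<beta> \<in> ?F" if "\<beta> + \<gamma> = \<alpha>" for \<beta> \<gamma> :: "nat \<Rightarrow>\<^sub>0 nat"
    proof -
      have le: "lookup \<beta> i \<le> lookup \<alpha> i" for i
        using that by (auto simp: lookup_add)
      have "lookup \<beta> i \<le> Max (lookup \<alpha> ` keys \<alpha>)" if "i \<in> keys \<alpha>" for i
        using that by (intro order_trans[OF le] Max_ge) auto
      moreover have "lookup \<beta> i = 0" if "i \<notin> keys \<alpha>" for i
        using le[of i] that by (simp add: in_keys_iff)
      ultimately show ?thesis by simp
    qed
    have "lookup ` ?B \<subseteq> ?F"
    proof (rule image_subsetI)
      fix \<beta> :: "nat \<Rightarrow>\<^sub>0 nat" assume "\<beta> \<in> ?B"
      then obtain \<gamma> where "\<beta> + \<gamma> = \<alpha>" by (elim CollectE exE)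
      then show "lookup \<beta> \<in> ?F" by (rule lookup_in)
    qed
    moreover have "finite ?F" by (rule finite_set_of_finite_funs) auto
    ultimately show "finite (lookup ` ?B)" by (rule finite_subset)
    show "inj_on lookup ?B" by (simp add: inj_on_def poly_mapping_eqI)
  qed
  have "{p. fst p + snd p = \<alpha>} \<subseteq> ?B \<times> ?B"
  proof
    fix p :: "(nat \<Rightarrow>\<^sub>0 nat) \<times> (nat \<Rightarrow>\<^sub>0 nat)"
    assume "p \<in> {p. fst p + snd p = \<alpha>}"
    then have "fst p + snd p = \<alpha>" "snd p + fst p = \<alpha>" by (auto simp: add.commute)
    then show "p \<in> ?B \<times> ?B" by (cases p) auto
  qed
  then show ?thesis using fin by (meson finite_SigmaI finite_subset)
qed

instantiation power_series :: (comm_ring_1) comm_ring_1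
begin

definition "0 = Series (\<lambda>_. 0)"
definition "1 = Series (\<lambda>\<alpha>. if \<alpha> = 0 then 1 else 0)"
definition "f + g = Series (\<lambda>\<alpha>. coeff f \<alpha> + coeff g \<alpha>)"
definition "- f = Series (\<lambda>\<alpha>. - coeff f \<alpha>)"
definition "f - g = Series (\<lambda>\<alpha>. coeff f \<alpha> - coeff g \<alpha>)"
definition "f * g = Series (\<lambda>\<alpha>. \<Sum>p | fst p + snd p = \<alpha>. coeff f (fst p) * coeff g (snd p))"

lemma mult_assoc_series: "(f * g) * h = f * (g * h)" for f g h :: "'a power_series"
proof (rule series_eqI)
  fix \<alpha>
  let ?D = "\<lambda>\<alpha>. {p :: (nat \<Rightarrow>\<^sub>0 nat) \<times> (nat \<Rightarrow>\<^sub>0 nat). fst p + snd p = \<alpha>}"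
  have "coeff ((f * g) * h) \<alpha> =
      (\<Sum>p\<in>?D \<alpha>. \<Sum>q\<in>?D (fst p). coeff f (fst q) * coeff g (snd q) * coeff h (snd p))"
    by (simp add: times_power_series_def sum_distrib_right)
  also have "\<dots> = (\<Sum>(p, q)\<in>(SIGMA p:?D \<alpha>. ?D (fst p)).
      coeff f (fst q) * coeff g (snd q) * coeff h (snd p))"
    by (rule sum.Sigma) (simp_all add: finite_divisors)
  also have "\<dots> = (\<Sum>(p, q)\<in>(SIGMA p:?D \<alpha>. ?D (snd p)).
      coeff f (fst p) * (coeff g (fst q) * coeff h (snd q)))"
    by (rule sum.reindex_bij_witness[where
          i = "\<lambda>(p, q). ((fst p + fst q, snd q), (fst p, fst q))" and
          j = "\<lambda>(p, q). ((fst q, snd q + snd p), (snd q, snd p))"])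
       (auto simp: algebra_simps)
  also have "\<dots> = (\<Sum>p\<in>?D \<alpha>. \<Sum>q\<in>?D (snd p).
      coeff f (fst p) * (coeff g (fst q) * coeff h (snd q)))"
    by (rule sum.Sigma[symmetric]) (simp_all add: finite_divisors)
  also have "\<dots> = coeff (f * (g * h)) \<alpha>"
    by (simp add: times_power_series_def sum_distrib_left)
  finally show "coeff ((f * g) * h) \<alpha> = coeff (f * (g * h)) \<alpha>" .
qed

lemma mult_commute_series: "f * g = g * f" for f g :: "'a power_series"
proof (rule series_eqI)
  fix \<alpha>
  show "coeff (f * g) \<alpha> = coeff (g * f) \<alpha>"
    unfolding times_power_series_def coeff_Series
    by (rule sum.reindex_bij_witness[where i = prod.swap and j = prod.swap])
       (auto simp: algebra_simps)
qed

lemma mult_1_series: "1 * f = f" for f :: "'a power_series"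
proof (rule series_eqI)
  fix \<alpha>
  have "coeff (1 * f) \<alpha> =
      (\<Sum>p | fst p + snd p = \<alpha>. if p = (0, \<alpha>) then coeff f \<alpha> else 0)"
    unfolding times_power_series_def one_power_series_def coeff_Series
    by (rule sum.cong) auto
  also have "\<dots> = coeff f \<alpha>"
    using finite_divisors[of \<alpha>] by (simp add: sum.delta)
  finally show "coeff (1 * f) \<alpha> = coeff f \<alpha>" .
qed

instance
proof
  fix f g h :: "'a power_series"
  show "f + g + h = f + (g + h)" "f + g = g + f" "0 + f = f" "- f + f = 0" "f - g = f + - g"
    by (simp_all add: plus_power_series_def zero_power_series_def uminus_power_series_def
        minus_power_series_def ac_simps coeff_inverse)
  show "(f + g) * h = f * h + g * h"
    by (simp add: times_power_series_def plus_power_series_def sum.distrib algebra_simps)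
  show "f * g * h = f * (g * h)" by (rule mult_assoc_series)
  show "f * g = g * f" by (rule mult_commute_series)
  show "1 * f = f" by (rule mult_1_series)
  have "coeff (0 :: 'a power_series) 0 \<noteq> coeff 1 0"
    by (simp add: zero_power_series_def one_power_series_def)
  then show "(0 :: 'a power_series) \<noteq> 1" by (rule contrapos_nn) simp
qed

end

definition scale :: "'a::comm_ring_1 \<Rightarrow> 'a power_series \<Rightarrow> 'a power_series" where
  "scale c f = Series (\<lambda>\<alpha>. c * coeff f \<alpha>)"

definition var :: "nat \<Rightarrow> 'a::comm_ring_1 power_series" where
  "var i = Series (\<lambda>\<alpha>. if \<alpha> = Poly_Mapping.single i 1 then 1 else 0)"

definition partial_deriv :: "nat \<Rightarrow> 'a::comm_ring_1 power_series \<Rightarrow> 'a power_series" where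
  "partial_deriv i f =
     Series (\<lambda>\<alpha>. of_nat (lookup \<alpha> i + 1) * coeff f (\<alpha> + Poly_Mapping.single i 1))"

text \<open>
  The sum over all variables is formed coefficientwise. It is a finite sum in each coefficient,
  because \<open>var i ^ (k + 1) * g\<close> only contains monomials divisible by variable \<open>i\<close>.
\<close>

definition D :: "nat \<Rightarrow> 'a::comm_ring_1 power_series \<Rightarrow> 'a power_series" where
  "D k f = Series (\<lambda>\<alpha>. Sum_any (\<lambda>i. coeff (var i ^ (k + 1) * partial_deriv i f) \<alpha>))"


section \<open>Symmetric functions\<close>

definition weight :: "(nat \<Rightarrow>\<^sub>0 nat) \<Rightarrow> nat" where
  "weight \<alpha> = (\<Sum>i\<in>keys \<alpha>. lookup \<alpha> i)"

definition rearrangement :: "(nat \<Rightarrow>\<^sub>0 nat) \<Rightarrow> (nat \<Rightarrow>\<^sub>0 nat) \<Rightarrow> bool" where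
  "rearrangement \<alpha> \<beta> \<longleftrightarrow> (\<exists>\<pi>. bij \<pi> \<and> lookup \<beta> = lookup \<alpha> \<circ> \<pi>)"

definition symmetric_functions :: "'a::comm_ring_1 power_series set" where
  "symmetric_functions = {f.
     (\<exists>d. \<forall>\<alpha>. coeff f \<alpha> \<noteq> 0 \<longrightarrow> weight \<alpha> \<le> d) \<and>
     (\<forall>\<alpha> \<beta>. rearrangement \<alpha> \<beta> \<longrightarrow> coeff f \<alpha> = coeff f \<beta>)}"

text \<open>
  A partition \<open>\<lambda>\<^sub>1 \<ge> \<lambda>\<^sub>2 \<ge> \<dots>\<close> with finitely many nonzero parts is represented by the
  finitely supported function \<open>i \<mapsto> \<lambda>\<^sub>i\<^sub>+\<^sub>1\<close>, and \<open>weight\<close> is the sum of its parts.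
\<close>

definition is_partition :: "(nat \<Rightarrow>\<^sub>0 nat) \<Rightarrow> bool" where
  "is_partition lam \<longleftrightarrow> antimono (lookup lam)"

definition monomial_sym :: "(nat \<Rightarrow>\<^sub>0 nat) \<Rightarrow> 'a::comm_ring_1 power_series" where
  "monomial_sym lam = Series (\<lambda>\<alpha>. if rearrangement lam \<alpha> then 1 else 0)"

definition complete_hom :: "nat \<Rightarrow> 'a::comm_ring_1 power_series" where
  "complete_hom n = Series (\<lambda>\<alpha>. if weight \<alpha> = n then 1 else 0)"

definition complete_sym :: "(nat \<Rightarrow>\<^sub>0 nat) \<Rightarrow> 'a::comm_ring_1 power_series" where
  "complete_sym lam = (\<Prod>i\<in>keys lam. complete_hom (lookup lam i))"

text \<open>Boxes are pairs (row, column), both numbered from \<open>0\<close>; this does not affect contents.\<close>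

definition diagram :: "(nat \<Rightarrow>\<^sub>0 nat) \<Rightarrow> (nat \<times> nat) set" where
  "diagram lam = {(i, j). j < lookup lam i}"

definition semistandard_tableaux :: "(nat \<Rightarrow>\<^sub>0 nat) \<Rightarrow> (nat \<times> nat \<Rightarrow> nat) set" where
  "semistandard_tableaux lam = {T \<in> extensional (diagram lam).
     (\<forall>i j j'. (i, j) \<in> diagram lam \<and> (i, j') \<in> diagram lam \<and> j < j' \<longrightarrow> T (i, j) \<le> T (i, j')) \<and>
     (\<forall>i i' j. (i, j) \<in> diagram lam \<and> (i', j) \<in> diagram lam \<and> i < i' \<longrightarrow> T (i, j) < T (i', j))}"

text \<open>
  The Schur function is the generating function of semistandard tableaux: the coefficient of
  \<open>\<alpha>\<close> counts the tableaux with exactly \<open>lookup \<alpha> i\<close> entries equal to \<open>i\<close>.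
\<close>

definition schur :: "(nat \<Rightarrow>\<^sub>0 nat) \<Rightarrow> 'a::comm_ring_1 power_series" where
  "schur lam = Series (\<lambda>\<alpha>. of_nat (card {T \<in> semistandard_tableaux lam.
     \<forall>i. card {b \<in> diagram lam. T b = i} = lookup \<alpha> i}))"

text \<open>
  The standard scalar product is the bilinear form on symmetric functions for which the monomial
  and the complete homogeneous functions are dual bases. Hence its value at \<open>f\<close>, \<open>g\<close> is read off
  from the expansion of \<open>f\<close> in the former and of \<open>g\<close> in the latter.
\<close>

definition scalar_product :: "'a::comm_ring_1 power_series \<Rightarrow> 'a power_series \<Rightarrow> 'a" where
  "scalar_product f g = (THE c. \<exists>a b :: (nat \<Rightarrow>\<^sub>0 nat) \<Rightarrow>\<^sub>0 'a.
     keys a \<subseteq> Collect is_partition \<and> keys b \<subseteq> Collect is_partition \<and>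
     f = (\<Sum>lam\<in>keys a. scale (lookup a lam) (monomial_sym lam)) \<and>
     g = (\<Sum>mu\<in>keys b. scale (lookup b mu) (complete_sym mu)) \<and>
     c = (\<Sum>lam\<in>keys a. \<Sum>mu\<in>keys b.
            lookup a lam * lookup b mu * (if lam = mu then 1 else 0)))"

definition D_perp :: "nat \<Rightarrow> 'a::comm_ring_1 power_series \<Rightarrow> 'a power_series" where
  "D_perp k f = (THE g. g \<in> symmetric_functions \<and>
     (\<forall>h\<in>symmetric_functions. scalar_product g h = scalar_product f (D k h)))"


section \<open>Skew shapes\<close>

type_synonym shape = "(nat \<times> nat) set"

text \<open>The skew shape \<open>\<mu>/\<lambda>\<close>; only meaningful if the diagram of \<open>\<mu>\<close> contains that of \<open>\<lambda>\<close>.\<close>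

definition skew :: "(nat \<Rightarrow>\<^sub>0 nat) \<Rightarrow> (nat \<Rightarrow>\<^sub>0 nat) \<Rightarrow> shape" where
  "skew mu lam = diagram mu - diagram lam"

definition content :: "nat \<times> nat \<Rightarrow> int" where
  "content b = int (snd b) - int (fst b)"

definition adjacent :: "nat \<times> nat \<Rightarrow> nat \<times> nat \<Rightarrow> bool" where
  "adjacent b c \<longleftrightarrow>
     fst b = fst c \<and> (snd c = Suc (snd b) \<or> snd b = Suc (snd c)) \<or>
     snd b = snd c \<and> (fst c = Suc (fst b) \<or> fst b = Suc (fst c))"

definition connection :: "shape \<Rightarrow> ((nat \<times> nat) \<times> (nat \<times> nat)) set" where
  "connection S = {(b, c). b \<in> S \<and> c \<in> S \<and> adjacent b c}\<^sup>*"

definition shape_components :: "shape \<Rightarrow> shape set" where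
  "shape_components S = S // connection S"

definition connected_shape :: "shape \<Rightarrow> bool" where
  "connected_shape S \<longleftrightarrow> S \<noteq> {} \<and> (\<forall>b\<in>S. \<forall>c\<in>S. (b, c) \<in> connection S)"

definition broken_border_strip :: "shape \<Rightarrow> bool" where
  "broken_border_strip S \<longleftrightarrow>
     \<not> (\<exists>i j. {(i, j), (i, Suc j), (Suc i, j), (Suc i, Suc j)} \<subseteq> S)"

definition border_strip :: "shape \<Rightarrow> bool" where
  "border_strip S \<longleftrightarrow> connected_shape S \<and> broken_border_strip S"

definition cc :: "shape \<Rightarrow> enat" where
  "cc S = (if broken_border_strip S then enat (card (shape_components S)) else \<infinity>)"

definition ht :: "shape \<Rightarrow> nat" where
  "ht S = card (fst ` S) - 1"

definition sharp_corners :: "shape \<Rightarrow> shape" where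
  "sharp_corners S = {(i, j) \<in> S.
     \<not> (\<exists>i'. i = Suc i' \<and> (i', j) \<in> S) \<and> \<not> (\<exists>j'. j = Suc j' \<and> (i, j') \<in> S)}"

definition dull_corners :: "shape \<Rightarrow> shape" where
  "dull_corners S = {(Suc i, Suc j) | i j.
     (Suc i, Suc j) \<in> S \<and> (Suc i, j) \<in> S \<and> (i, Suc j) \<in> S \<and> (i, j) \<notin> S}"

text \<open>
  The coefficient \<open>d\<^sub>\<lambda>\<^sub>\<mu>\<close>. Only shapes with at most two components matter; the value \<open>0\<close> in
  the remaining cases is a dummy.
\<close>

definition d_coeff :: "(nat \<Rightarrow>\<^sub>0 nat) \<Rightarrow> (nat \<Rightarrow>\<^sub>0 nat) \<Rightarrow> int" where
  "d_coeff lam mu =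
     (if border_strip (skew mu lam) then
        (-1) ^ ht (skew mu lam) *
          ((\<Sum>b\<in>sharp_corners (skew mu lam). content b) -
           (\<Sum>b\<in>dull_corners (skew mu lam). content b))
      else if cc (skew mu lam) = 2 then (-1) ^ ht (skew mu lam)
      else 0)"

end

theory Submission
  imports "Jordan_Normal_Form.Determinant" Defs
begin

text \<open>
  In \<open>n\<close> variables, \<open>s\<^sub>\<lambda>\<close> times the Vandermonde product \<open>V\<close> is the alternant \<open>a\<^sub>l\<close> with exponents
  (beads) \<open>l\<^sub>i = \<lambda>\<^sub>i + n - 1 - i\<close>. The derivation \<open>D\<^sub>k\<close> maps \<open>a\<^sub>l\<close> to \<open>\<Sum>\<^sub>i l\<^sub>i a\<^bsub>l + k e\<^sub>i\<^esub>\<close> and multiplies \<open>V\<close> by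
  \<open>\<Sum>\<^bsub>i < j\<^esub> \<Sum>\<^bsub>a + b = k\<^esub> x\<^sub>i\<^sup>a x\<^sub>j\<^sup>b\<close>. In the product of the latter with \<open>a\<^sub>l\<close>, terms in which the two
  moved beads can be exchanged cancel. What remains of \<open>V D\<^sub>k s\<^sub>\<lambda>\<close> are moves of one bead \<open>s\<close> by \<open>k\<close>,
  which add a border strip with top row \<open>r\<close> and have coefficient \<open>\<lambda>\<^sub>s - r\<close>, and moves of two beads
  that do not interfere, which add two components and have coefficient \<open>-1\<close>. Passing \<open>h\<close> beads
  costs the sign \<open>(-1)\<^sup>h\<close>, and \<open>\<lambda>\<^sub>s - r\<close> is the alternating sum of the contents of the corners.

  For the adjoint, Pieri's rule gives \<open>h\<^sub>\<mu> = \<Sum>\<^sub>\<lambda> K\<^sub>\<lambda>\<^sub>\<mu> s\<^sub>\<lambda>\<close> with the same unitriangular Kostka numbers as in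
  \<open>s\<^sub>\<lambda> = \<Sum>\<^sub>\<mu> K\<^sub>\<lambda>\<^sub>\<mu> m\<^sub>\<mu>\<close>. Hence Schur functions are symmetric and orthonormal, and the matrix of the
  adjoint is the transpose of that of \<open>D\<^sub>k\<close>.
\<close>

text \<open>\<open>restr n\<close> sets all but the first n variables to zero without changing the
  type, so an identity of series can be checked for all large n. Then \<lambda> has at most n parts,
  and Schur functions of partitions with more than n parts vanish. The Vandermonde product can be
  cancelled because differences of variables are no zero divisors. The two cancellation arguments,
  for Pieri's rule and for pairs of beads, show that a sum is its own negative, and this is where
  characteristic zero enters. Schur functions are defined by counting tableaux, so their relation to
  alternants has to be derived. Removing the largest entry of a tableau gives a recursion on the
  number of variables, and expanding an alternant along its last variable gives the same one. The
  symmetry is not visible on tableaux either: it comes from the fact that a product of complete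
  homogeneous functions does not depend on the order of its factors. The scalar product and
  \<open>D_perp\<close> are definite descriptions, so existence and uniqueness of the described
  values are part of the work.\<close>

section \<open>Coefficientwise arithmetic of power series\<close>

lemma coeff_0 [simp]: "coeff 0 \<alpha> = 0"
  by (simp add: zero_power_series_def)

lemma coeff_1: "coeff 1 \<alpha> = (if \<alpha> = 0 then 1 else 0)"
  by (simp add: one_power_series_def)

lemma coeff_add [simp]: "coeff (f + g) \<alpha> = coeff f \<alpha> + coeff g \<alpha>"
  by (simp add: plus_power_series_def)

lemma coeff_uminus [simp]: "coeff (- f) \<alpha> = - coeff f \<alpha>"
  by (simp add: uminus_power_series_def)

lemma coeff_diff [simp]: "coeff (f - g) \<alpha> = coeff f \<alpha> - coeff g \<alpha>"
  by (simp add: minus_power_series_def)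

lemma coeff_scale [simp]: "coeff (scale c f) \<alpha> = c * coeff f \<alpha>"
  by (simp add: scale_def)

lemma coeff_sum [simp]: "coeff (sum f A) \<alpha> = (\<Sum>x\<in>A. coeff (f x) \<alpha>)"
  by (induction A rule: infinite_finite_induct) auto

lemma coeff_mult: "coeff (f * g) \<alpha> = (\<Sum>p | fst p + snd p = \<alpha>. coeff f (fst p) * coeff g (snd p))"
  by (simp add: times_power_series_def)

lemma scale_mult_left: "scale c f * g = scale c (f * g)"
  by (rule series_eqI) (simp add: coeff_mult sum_distrib_left mult.assoc)

lemma scale_mult_right: "f * scale c g = scale c (f * g)"
  using scale_mult_left[of c g f] by (simp add: mult.commute)

lemma scale_sum: "scale c (sum f A) = (\<Sum>x\<in>A. scale c (f x))"
  by (rule series_eqI) (simp add: sum_distrib_left)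

lemma scale_sum_left: "scale (sum c A) f = (\<Sum>x\<in>A. scale (c x) f)"
  by (rule series_eqI) (simp add: sum_distrib_right)

lemma scale_scale: "scale c (scale d f) = scale (c * d) f"
  by (rule series_eqI) (simp add: algebra_simps)

lemma scale_0 [simp]: "scale 0 f = 0"
  by (rule series_eqI) simp

lemma scale_1 [simp]: "scale 1 f = f"
  by (rule series_eqI) simp

lemma of_nat_mult_series: "of_nat n * f = scale (of_nat n) f"
proof (induction n)
  case (Suc n)
  have "of_nat (Suc n) * f = f + scale (of_nat n) f"
    using Suc by (simp add: algebra_simps)
  then show ?case by (intro series_eqI) (simp add: algebra_simps)
qed simp

lemma of_int_mult_series: "of_int z * f = scale (of_int z) f"
proof (cases z)
  case (nonneg n)
  then show ?thesis by (simp add: of_nat_mult_series)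
next
  case (neg n)
  have "of_int z * f = - (of_nat (Suc n) * f)" by (simp add: neg algebra_simps)
  also have "\<dots> = - scale (of_nat (Suc n)) f" by (simp only: of_nat_mult_series)
  also have "\<dots> = scale (of_int z) f" by (intro series_eqI) (simp add: neg algebra_simps)
  finally show ?thesis .
qed

text \<open>The coefficient ring has characteristic zero and no zero divisors, so twice f vanishes
  only if f does. Every cancellation by a sign-reversing involution ends here.\<close>

lemma series_add_self_eq_0:
  fixes f :: "'a :: {idom, ring_char_0} power_series"
  assumes "f + f = 0" shows "f = 0"
proof (rule series_eqI)
  fix \<alpha>
  have "coeff f \<alpha> + coeff f \<alpha> = 0" using arg_cong[OF assms, of "\<lambda>f. coeff f \<alpha>"] unfolding coeff_add coeff_0 .
  then have "2 * coeff f \<alpha> = 0" unfolding mult_2 .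
  then have "coeff f \<alpha> = 0" by (subst (asm) mult_eq_0_iff) auto
  then show "coeff f \<alpha> = coeff 0 \<alpha>" by simp
qed

section \<open>Monomials and divisibility\<close>

definition mon :: "(nat \<Rightarrow>\<^sub>0 nat) \<Rightarrow> 'a::comm_ring_1 power_series" where
  "mon \<alpha> = Series (\<lambda>\<beta>. if \<beta> = \<alpha> then 1 else 0)"

lemma coeff_mon: "coeff (mon \<alpha>) \<beta> = (if \<beta> = \<alpha> then 1 else 0)"
  by (simp add: mon_def)

lemma poly_mapping_add_diff:
  fixes \<alpha> \<beta> :: "'b \<Rightarrow>\<^sub>0 nat"
  assumes "\<And>i. lookup \<alpha> i \<le> lookup \<beta> i"
  shows "\<alpha> + (\<beta> - \<alpha>) = \<beta>"
  by (rule poly_mapping_eqI) (simp add: lookup_add lookup_minus assms)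

lemma poly_mapping_add_diff_left:
  fixes \<alpha> \<gamma> :: "'b \<Rightarrow>\<^sub>0 nat"
  shows "\<alpha> + \<gamma> - \<alpha> = \<gamma>"
  by (rule poly_mapping_eqI) (simp add: lookup_add lookup_minus)

text \<open>Subtraction of exponents is truncated, so the pointwise comparison decides divisibility;
  when it holds, \<open>(\<alpha>, \<beta> - \<alpha>)\<close> is the only factorisation that
  contributes.\<close>

lemma coeff_mon_mult:
  "coeff (mon \<alpha> * f) \<beta> =
     (if \<forall>i. lookup \<alpha> i \<le> lookup \<beta> i then coeff f (\<beta> - \<alpha>) else 0)"
proof -
  have "coeff (mon \<alpha> * f) \<beta> = (\<Sum>p | fst p + snd p = \<beta>. coeff (mon \<alpha>) (fst p) * coeff f (snd p))"
    by (simp add: coeff_mult)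
  also have "\<dots> = (\<Sum>p | fst p + snd p = \<beta> \<and> fst p = \<alpha>. coeff f (snd p))"
    by (rule sum.mono_neutral_cong_right) (auto simp: finite_divisors coeff_mon)
  also have "{p. fst p + snd p = \<beta> \<and> fst p = \<alpha>} =
      (if \<forall>i. lookup \<alpha> i \<le> lookup \<beta> i then {(\<alpha>, \<beta> - \<alpha>)} else {})"
    by (auto simp: poly_mapping_add_diff poly_mapping_add_diff_left lookup_add)
  finally show ?thesis by auto
qed

lemma mon_0: "mon 0 = 1"
  by (rule series_eqI) (simp add: coeff_mon coeff_1)

lemma mon_mult: "mon \<alpha> * mon \<beta> = mon (\<alpha> + \<beta>)"
  by (rule series_eqI)
     (auto simp: coeff_mon_mult coeff_mon poly_mapping_add_diff poly_mapping_add_diff_left lookup_add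
       dest!: poly_mapping_add_diff)

lemma var_eq_mon: "var i = mon (Poly_Mapping.single i 1)"
  by (simp add: var_def mon_def)

lemma var_power_eq_mon: "var i ^ k = mon (Poly_Mapping.single i k)"
  by (induction k) (simp_all add: mon_0 var_eq_mon mon_mult flip: single_add)

lemma prod_mon: "(\<Prod>i\<in>A. mon (f i)) = mon (sum f A)"
  by (induction A rule: infinite_finite_induct) (simp_all add: mon_0 mon_mult)

lemma prod_var_power: "(\<Prod>i\<in>A. var (f i) ^ l i) = mon (\<Sum>i\<in>A. Poly_Mapping.single (f i) (l i))"
  by (simp add: var_power_eq_mon prod_mon)

lemma coeff_var_power_mult:
  "coeff (var i ^ k * f) \<beta> =
     (if k \<le> lookup \<beta> i then coeff f (\<beta> - Poly_Mapping.single i k) else 0)"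
proof -
  have "(\<forall>j. lookup (Poly_Mapping.single i k) j \<le> lookup \<beta> j) \<longleftrightarrow> k \<le> lookup \<beta> i"
    by (auto simp: lookup_single when_def)
  then show ?thesis by (simp add: var_power_eq_mon coeff_mon_mult)
qed

text \<open>Comparing coefficients of x_i f = x_j f at \<open>?s i + \<beta>\<close> expresses the
  coefficient at \<beta> by one with a smaller exponent of variable j. If that exponent is 0, the
  right-hand side has no such term. This works over any commutative ring and makes
  \<open>vand\<close> cancellable.\<close>

lemma var_diff_mult_eq_0:
  assumes "i \<noteq> j" and "(var i - var j) * f = 0"
  shows "f = 0"
proof (rule series_eqI)
  fix \<beta>
  let ?s = "\<lambda>i. Poly_Mapping.single i (1 :: nat)"
  have eq: "coeff (var i * f) \<alpha> = coeff (var j * f) \<alpha>" for \<alpha>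
    using arg_cong[OF assms(2), of "\<lambda>f. coeff f \<alpha>"] by (simp add: algebra_simps)
  show "coeff f \<beta> = coeff 0 \<beta>"
  proof (induction "lookup \<beta> j" arbitrary: \<beta>)
    case 0
    have "coeff f \<beta> = coeff (var i * f) (?s i + \<beta>)"
      using coeff_var_power_mult[of i 1 f "?s i + \<beta>"]
      by (simp add: lookup_add poly_mapping_add_diff_left)
    also have "\<dots> = coeff (var j * f) (?s i + \<beta>)" by (rule eq)
    also have "\<dots> = 0"
      using coeff_var_power_mult[of j 1 f "?s i + \<beta>"] assms(1) 0
      by (simp add: lookup_add lookup_single)
    finally show ?case by simp
  next
    case (Suc m)
    have "coeff f \<beta> = coeff (var i * f) (?s i + \<beta>)"
      using coeff_var_power_mult[of i 1 f "?s i + \<beta>"]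
      by (simp add: lookup_add poly_mapping_add_diff_left)
    also have "\<dots> = coeff (var j * f) (?s i + \<beta>)" by (rule eq)
    also have "\<dots> = coeff f (?s i + \<beta> - ?s j)"
      using coeff_var_power_mult[of j 1 f "?s i + \<beta>"] Suc(2)
      by (simp add: lookup_add lookup_single)
    also have "\<dots> = 0"
      using Suc(1)[of "?s i + \<beta> - ?s j"] Suc(2) assms(1)
      by (simp add: lookup_add lookup_minus lookup_single)
    finally show ?case by simp
  qed
qed

section \<open>Restriction to finitely many variables\<close>

definition restr :: "nat \<Rightarrow> 'a::comm_ring_1 power_series \<Rightarrow> 'a power_series" where
  "restr n f = Series (\<lambda>\<alpha>. if keys \<alpha> \<subseteq> {..<n} then coeff f \<alpha> else 0)"

lemma coeff_restr: "coeff (restr n f) \<alpha> = (if keys \<alpha> \<subseteq> {..<n} then coeff f \<alpha> else 0)"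
  by (simp add: restr_def)

lemma keys_add_nat: "keys (\<alpha> + \<beta>) = keys \<alpha> \<union> keys (\<beta> :: 'b \<Rightarrow>\<^sub>0 nat)"
  by (auto simp: in_keys_iff lookup_add)

lemma restr_scale: "restr n (scale c f) = scale c (restr n f)"
  by (rule series_eqI) (simp add: coeff_restr)

lemma restr_sum: "restr n (sum f A) = (\<Sum>x\<in>A. restr n (f x))"
  by (rule series_eqI) (simp add: coeff_restr)

lemma restr_1 [simp]: "restr n 1 = 1"
  by (rule series_eqI) (simp add: coeff_restr coeff_1)

text \<open>Exponents are natural numbers, so a product of monomials involves exactly the variables
  of its two factors: it survives the restriction iff both factors do.\<close>

lemma restr_mult: "restr n (f * g) = restr n f * restr n g"
proof (rule series_eqI)
  fix \<alpha>
  show "coeff (restr n (f * g)) \<alpha> = coeff (restr n f * restr n g) \<alpha>"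
  proof (cases "keys \<alpha> \<subseteq> {..<n}")
    case True
    then show ?thesis
      unfolding coeff_restr coeff_mult by (auto intro!: sum.cong simp: keys_add_nat coeff_restr)
  next
    case False
    have "coeff (restr n f * restr n g) \<alpha> = 0"
      unfolding coeff_mult
      by (rule sum.neutral) (use False in \<open>auto simp: keys_add_nat coeff_restr\<close>)
    then show ?thesis using False by (simp add: coeff_restr)
  qed
qed

lemma keys_bounded: "\<exists>n. keys (\<alpha> :: nat \<Rightarrow>\<^sub>0 'b::zero) \<subseteq> {..<n}"
  using finite_keys[of \<alpha>] finite_nat_iff_bounded by blast

text \<open>Each monomial involves finitely many variables and is seen by \<open>restr n\<close> for
  all large n. The bound \<open>n0\<close> leaves room to assume that a given partition has at most
  n parts.\<close>

lemma restr_eqI: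
  assumes "\<And>n. n \<ge> n0 \<Longrightarrow> restr n f = restr n g"
  shows "f = g"
proof (rule series_eqI)
  fix \<alpha> :: "nat \<Rightarrow>\<^sub>0 nat"
  obtain m where m: "keys \<alpha> \<subseteq> {..<m}"
    using keys_bounded by blast
  have "restr (max n0 m) f = restr (max n0 m) g" by (rule assms) simp
  from arg_cong[OF this, of "\<lambda>f. coeff f \<alpha>"] m show "coeff f \<alpha> = coeff g \<alpha>"
    by (auto simp: coeff_restr split: if_splits)
qed

text \<open>\<open>x\<^sub>i\<^sup>k\<^sup>+\<^sup>1 \<partial>/\<partial>x\<^sub>i\<close> is \<open>x\<^sub>i\<^sup>k\<close> times the Euler derivation \<open>x\<^sub>i \<partial>/\<partial>x\<^sub>i\<close>, which acts diagonally on monomials.\<close>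

definition euler :: "nat \<Rightarrow> 'a::comm_ring_1 power_series \<Rightarrow> 'a power_series" where
  "euler i f = Series (\<lambda>\<alpha>. of_nat (lookup \<alpha> i) * coeff f \<alpha>)"

lemma coeff_euler [simp]: "coeff (euler i f) \<alpha> = of_nat (lookup \<alpha> i) * coeff f \<alpha>"
  by (simp add: euler_def)

lemma euler_mult: "euler i (f * g) = euler i f * g + f * euler i g"
proof (rule series_eqI)
  fix \<alpha>
  show "coeff (euler i (f * g)) \<alpha> = coeff (euler i f * g + f * euler i g) \<alpha>"
    unfolding coeff_euler coeff_add coeff_mult sum_distrib_left sum.distrib[symmetric]
    by (rule sum.cong[OF refl]) (auto simp: lookup_add algebra_simps)
qed

lemma euler_var_power: "euler i (var j ^ m) = (if i = j then of_nat m * var j ^ m else 0)"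
  by (rule series_eqI)
     (auto simp: var_power_eq_mon coeff_mon of_nat_mult_series lookup_single)

text \<open>The counterpart of \<open>D\<close> in n variables is a finite sum of derivations. The
  Leibniz rule is used for this operator and its consequences reach \<open>D\<close> through
  \<open>restr_D\<close>.\<close>

definition Dn :: "nat \<Rightarrow> nat \<Rightarrow> 'a::comm_ring_1 power_series \<Rightarrow> 'a power_series" where
  "Dn n k f = (\<Sum>i<n. var i ^ k * euler i f)"

lemma Dn_mult: "Dn n k (f * g) = Dn n k f * g + f * Dn n k g"
  by (simp add: Dn_def euler_mult algebra_simps sum.distrib sum_distrib_left sum_distrib_right)

lemma Dn_add: "Dn n k (f + g) = Dn n k f + Dn n k g"
  by (simp add: Dn_def algebra_simps sum.distrib series_eqI[of "euler _ (f+g)" "euler _ f + euler _ g"])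

lemma Dn_diff: "Dn n k (f - g) = Dn n k f - Dn n k g"
  by (simp add: Dn_def algebra_simps sum_subtractf series_eqI[of "euler _ (f-g)" "euler _ f - euler _ g"])

lemma Dn_1: "Dn n k 1 = 0"
  using Dn_mult[of n k 1 1] by simp

lemma Dn_sum: "Dn n k (sum f A :: 'b::comm_ring_1 power_series) = (\<Sum>x\<in>A. Dn n k (f x))"
proof -
  have "Dn n k 0 = (0 :: 'b power_series)" using Dn_diff[of n k 0 0] by simp
  then show ?thesis by (induction A rule: infinite_finite_induct) (simp_all add: Dn_add)
qed

lemma Dn_of_int_mult: "Dn n k (of_int c * f) = of_int c * Dn n k f"
  unfolding Dn_def of_int_mult_series sum_distrib_left
  by (rule sum.cong[OF refl], rule series_eqI) (simp add: var_power_eq_mon coeff_mon_mult)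

lemma Dn_var_power:
  assumes "j < n"
  shows "Dn n k (var j ^ m) = of_nat m * var j ^ (m + k)"
  using assms by (simp add: Dn_def euler_var_power if_distrib power_add mult_ac sum.delta cong: if_cong)

lemma Dn_prod:
  assumes "finite A" "\<And>i. i \<in> A \<Longrightarrow> Dn n k (f i) = g i * f i"
  shows "Dn n k (\<Prod>i\<in>A. f i) = (\<Sum>i\<in>A. g i) * (\<Prod>i\<in>A. f i)"
  using assms by (induction A) (simp_all add: Dn_mult Dn_1 algebra_simps)

lemma coeff_var_partial:
  "coeff (var i ^ (k + 1) * partial_deriv i f) \<beta> = coeff (var i ^ k * euler i f) \<beta>"
proof (cases "k + 1 \<le> lookup \<beta> i")
  case True
  then have "\<beta> - Poly_Mapping.single i (k + 1) + Poly_Mapping.single i 1 = \<beta> - Poly_Mapping.single i k"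
    by (intro poly_mapping_eqI) (auto simp: lookup_add lookup_minus lookup_single when_def)
  with True show ?thesis
    unfolding coeff_var_power_mult partial_deriv_def
    by (simp add: lookup_minus Suc_diff_Suc)
next
  case False
  then show ?thesis
    unfolding coeff_var_power_mult by (auto simp: lookup_minus)
qed

text \<open>If variable i does not occur in \<beta>, the i-th summand has no \<beta>-term: for
  positive k because it is divisible by x_i^k, for k = 0 because \<open>euler\<close> multiplies by
  the exponent 0.\<close>

lemma coeff_D: "coeff (D k f) \<beta> = (\<Sum>i\<in>keys \<beta>. coeff (var i ^ k * euler i f) \<beta>)"
proof -
  have *: "lookup \<beta> i \<noteq> 0" if "coeff (var i ^ k * euler i f) \<beta> \<noteq> 0" for i
    using that by (cases "lookup \<beta> i = 0"; cases "k = 0") (auto simp: coeff_var_power_mult lookup_minus simp del: of_nat_diff power_Suc split: if_splits)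
  have "coeff (D k f) \<beta> = Sum_any (\<lambda>i. coeff (var i ^ k * euler i f) \<beta>)"
    unfolding D_def coeff_Series coeff_var_partial ..
  also have "\<dots> = (\<Sum>i\<in>keys \<beta>. coeff (var i ^ k * euler i f) \<beta>)"
    by (rule Sum_any.expand_superset) (use * in \<open>auto simp: in_keys_iff\<close>)
  finally show ?thesis .
qed

lemma D_sum: "D k (sum f A) = (\<Sum>x\<in>A. D k (f x))"
proof (rule series_eqI)
  fix \<beta>
  have "coeff (var i ^ k * euler i (sum f A)) \<beta> = (\<Sum>x\<in>A. coeff (var i ^ k * euler i (f x)) \<beta>)" for i
    by (simp add: coeff_var_power_mult sum_distrib_left)
  then show "coeff (D k (sum f A)) \<beta> = coeff (\<Sum>x\<in>A. D k (f x)) \<beta>"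
    unfolding coeff_D coeff_sum by (subst sum.swap) simp
qed

lemma D_scale: "D k (scale c f) = scale c (D k f)"
  by (rule series_eqI) (auto simp: coeff_D coeff_var_power_mult sum_distrib_left mult.left_commute intro!: sum.cong)

text \<open>For i < n the i-th summand changes only the exponent of x_i and so commutes with the
  restriction; for other i it yields only monomials that the restriction removes.\<close>

lemma restr_D: "restr n (D k f) = Dn n k (restr n f)"
proof (rule series_eqI)
  fix \<beta>
  have sub: "keys (\<beta> - Poly_Mapping.single i k) \<subseteq> {..<n} \<longleftrightarrow> keys \<beta> \<subseteq> {..<n}" if "i < n" for i
  proof -
    have "keys \<beta> - {i} = keys (\<beta> - Poly_Mapping.single i k) - {i}"
      by (auto simp: in_keys_iff lookup_minus lookup_single when_def)
    then show ?thesis using that by blast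
  qed
  show "coeff (restr n (D k f)) \<beta> = coeff (Dn n k (restr n f)) \<beta>"
  proof (cases "keys \<beta> \<subseteq> {..<n}")
    case True
    have "coeff (Dn n k (restr n f)) \<beta> = (\<Sum>i<n. coeff (var i ^ k * euler i f) \<beta>)"
      unfolding Dn_def coeff_sum
      by (rule sum.cong[OF refl]) (use True sub in \<open>simp add: coeff_var_power_mult coeff_restr\<close>)
    also have "\<dots> = (\<Sum>i\<in>keys \<beta>. coeff (var i ^ k * euler i f) \<beta>)"
      by (rule sum.mono_neutral_right)
         (use True in \<open>auto simp: coeff_var_power_mult in_keys_iff lookup_minus simp del: of_nat_diff\<close>)
    finally show ?thesis using True by (simp add: coeff_restr coeff_D)
  next
    case False
    then have "coeff (Dn n k (restr n f)) \<beta> = 0"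
      unfolding Dn_def coeff_sum
      by (intro sum.neutral ballI) (use False sub in \<open>simp add: coeff_var_power_mult coeff_restr\<close>)
    then show ?thesis using False by (simp add: coeff_restr)
  qed
qed

section \<open>Tableaux and Kostka numbers\<close>

lemma diagram_Sigma: "diagram lam = Sigma (keys lam) (\<lambda>i. {..<lookup lam i})"
  by (auto simp: diagram_def in_keys_iff)

lemma mem_diagram [simp]: "(i, j) \<in> diagram lam \<longleftrightarrow> j < lookup lam i"
  by (simp add: diagram_def)

lemma finite_diagram [simp]: "finite (diagram lam)"
  by (simp add: diagram_Sigma)

lemma card_diagram: "card (diagram lam) = weight lam"
  by (simp add: diagram_Sigma weight_def)

lemma diagram_subset_iff: "diagram mu \<subseteq> diagram lam \<longleftrightarrow> (\<forall>i. lookup mu i \<le> lookup lam i)"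
  by (auto simp: subset_iff) (meson leI less_irrefl, meson order_less_le_trans)

lemma diagram_inject: "diagram mu = diagram lam \<longleftrightarrow> mu = lam"
  by (metis diagram_subset_iff dual_order.antisym poly_mapping_eqI order_refl)

lemma finite_subdiagrams: "finite {mu. diagram mu \<subseteq> diagram lam}"
proof (rule finite_imageD)
  show "finite (diagram ` {mu. diagram mu \<subseteq> diagram lam})"
    by (rule finite_subset[of _ "Pow (diagram lam)"]) auto
  show "inj_on diagram {mu. diagram mu \<subseteq> diagram lam}"
    by (simp add: inj_on_def diagram_inject)
qed

lemma weight_mono: "diagram mu \<subseteq> diagram lam \<Longrightarrow> weight mu \<le> weight lam"
  by (metis card_diagram card_mono finite_diagram)

lemma weight_add: "weight (\<alpha> + \<beta>) = weight \<alpha> + weight \<beta>"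
proof -
  have *: "weight \<gamma> = (\<Sum>i\<in>keys \<alpha> \<union> keys \<beta>. lookup \<gamma> i)" if "keys \<gamma> \<subseteq> keys \<alpha> \<union> keys \<beta>" for \<gamma>
    unfolding weight_def by (rule sum.mono_neutral_left) (use that in \<open>auto simp: in_keys_iff\<close>)
  show ?thesis
    by (simp add: * keys_add_nat lookup_add sum.distrib)
qed

lemma weight_single [simp]: "weight (Poly_Mapping.single i k) = k"
  by (cases "k = 0") (simp_all add: weight_def)

lemma weight_0 [simp]: "weight 0 = 0"
  by (simp add: weight_def)

lemma weight_eq_sum: "keys \<alpha> \<subseteq> A \<Longrightarrow> finite A \<Longrightarrow> weight \<alpha> = (\<Sum>i\<in>A. lookup \<alpha> i)"
  unfolding weight_def by (rule sum.mono_neutral_left) (auto simp: in_keys_iff)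

lemma partition_antimono: "is_partition lam \<Longrightarrow> i \<le> j \<Longrightarrow> lookup lam j \<le> lookup lam i"
  by (auto simp: is_partition_def antimono_def)

lemma is_partition_SucI: "(\<And>i. lookup lam (Suc i) \<le> lookup lam i) \<Longrightarrow> is_partition lam"
  unfolding is_partition_def antimono_iff_le_Suc by blast

definition tableaux :: "(nat \<Rightarrow>\<^sub>0 nat) \<Rightarrow> (nat \<Rightarrow>\<^sub>0 nat) \<Rightarrow> (nat \<times> nat \<Rightarrow> nat) set" where
  "tableaux lam \<alpha> = {T \<in> semistandard_tableaux lam.
     \<forall>i. card {b \<in> diagram lam. T b = i} = lookup \<alpha> i}"

text \<open>The content \<alpha> may be any exponent, not only a partition. The recursion on the
  last variable needs this generality, and comparing rearranged contents later gives the symmetry of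
  Schur functions.\<close>

definition kostka :: "(nat \<Rightarrow>\<^sub>0 nat) \<Rightarrow> (nat \<Rightarrow>\<^sub>0 nat) \<Rightarrow> nat" where
  "kostka lam \<alpha> = card (tableaux lam \<alpha>)"

lemma coeff_schur: "coeff (schur lam) \<alpha> = of_nat (kostka lam \<alpha>)"
  by (simp add: schur_def kostka_def tableaux_def)

lemma tableaux_row:
  "T \<in> tableaux lam \<alpha> \<Longrightarrow> j' < lookup lam i \<Longrightarrow> j \<le> j' \<Longrightarrow> T (i, j) \<le> T (i, j')"
  unfolding tableaux_def semistandard_tableaux_def
  by (cases "j = j'") auto

lemma tableaux_column:
  "T \<in> tableaux lam \<alpha> \<Longrightarrow> is_partition lam \<Longrightarrow> j < lookup lam i' \<Longrightarrow> i < i' \<Longrightarrow> T (i, j) < T (i', j)"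
  using partition_antimono[of lam i i'] unfolding tableaux_def semistandard_tableaux_def by auto

lemma tableaux_content:
  "T \<in> tableaux lam \<alpha> \<Longrightarrow> card {b \<in> diagram lam. T b = i} = lookup \<alpha> i"
  by (simp add: tableaux_def)

lemma tableaux_entry_in_keys:
  assumes "T \<in> tableaux lam \<alpha>" "b \<in> diagram lam"
  shows "T b \<in> keys \<alpha>"
proof -
  have "{b' \<in> diagram lam. T b' = T b} \<noteq> {}" using assms(2) by blast
  then have "card {b' \<in> diagram lam. T b' = T b} \<noteq> 0" by (simp only: card_eq_0_iff) simp
  then show ?thesis using tableaux_content[OF assms(1), of "T b"] by (simp add: in_keys_iff)
qed

lemma finite_tableaux [simp]: "finite (tableaux lam \<alpha>)"
proof (rule finite_subset)
  show "tableaux lam \<alpha> \<subseteq> PiE (diagram lam) (\<lambda>_. keys \<alpha>)"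
  proof
    fix T assume T: "T \<in> tableaux lam \<alpha>"
    then have "T \<in> extensional (diagram lam)" by (simp add: tableaux_def semistandard_tableaux_def)
    with tableaux_entry_in_keys[OF T] show "T \<in> PiE (diagram lam) (\<lambda>_. keys \<alpha>)"
      unfolding PiE_def Pi_def by blast
  qed
qed (auto intro: finite_PiE)

text \<open>Boxes are grouped by entry. A constant g compares the sizes of shape and content; the
  identity turns bounds on entries into a comparison of \<open>row_sum\<close>.\<close>

lemma tableaux_sum:
  assumes "T \<in> tableaux lam \<alpha>"
  shows "(\<Sum>b\<in>diagram lam. g (T b)) = (\<Sum>i\<in>keys \<alpha>. lookup \<alpha> i * g i)"
proof -
  have "(\<Sum>b\<in>diagram lam. g (T b)) = (\<Sum>i\<in>keys \<alpha>. \<Sum>b\<in>{b\<in>diagram lam. T b = i}. g (T b))"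
    by (rule sum.group[symmetric]) (use tableaux_entry_in_keys[OF assms] in auto)
  also have "\<dots> = (\<Sum>i\<in>keys \<alpha>. lookup \<alpha> i * g i)"
    by (rule sum.cong) (simp_all add: tableaux_content[OF assms])
  finally show ?thesis .
qed

lemma kostka_weight: "kostka lam \<alpha> \<noteq> 0 \<Longrightarrow> weight \<alpha> = weight lam"
proof -
  assume "kostka lam \<alpha> \<noteq> 0"
  then obtain T where "T \<in> tableaux lam \<alpha>" by (force simp: kostka_def)
  from tableaux_sum[OF this, of "\<lambda>_. 1"] show ?thesis by (simp add: card_diagram weight_def)
qed

lemma tableaux_entry_ge:
  assumes "T \<in> tableaux lam \<alpha>" "is_partition lam" "j < lookup lam i"
  shows "i \<le> T (i, j)"
  using assms(3)
proof (induction i)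
  case (Suc i)
  have "j < lookup lam i" using Suc.prems partition_antimono[OF assms(2), of i "Suc i"] by simp
  then have "i \<le> T (i, j)" by (rule Suc.IH)
  also have "\<dots> < T (Suc i, j)" by (rule tableaux_column[OF assms(1,2) Suc.prems]) simp
  finally show ?case by simp
qed simp

text \<open>
  The entries of a tableau of partition shape are bounded below by their row indices, so the
  statistic \<open>\<Sum> i * \<lambda>\<^sub>i\<close> orders partitions in a way that makes the Kostka numbers unitriangular.
\<close>

definition row_sum :: "(nat \<Rightarrow>\<^sub>0 nat) \<Rightarrow> nat" where
  "row_sum \<alpha> = (\<Sum>i\<in>keys \<alpha>. lookup \<alpha> i * i)"

lemma sum_fst_diagram: "(\<Sum>b\<in>diagram lam. fst b) = row_sum lam"
proof -
  have "(\<Sum>b\<in>diagram lam. fst b) = (\<Sum>i\<in>keys lam. \<Sum>j<lookup lam i. i)"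
    unfolding diagram_Sigma by (subst sum.Sigma) (simp_all add: case_prod_beta)
  then show ?thesis by (simp add: row_sum_def)
qed

text \<open>The bound \<open>fst b \<le> T b\<close> is summed over the diagram; equal totals leave
  no room for strict inequality in any box.\<close>

lemma row_sum_le:
  assumes "T \<in> tableaux lam \<alpha>" "is_partition lam"
  shows "row_sum lam \<le> row_sum \<alpha>"
    and "row_sum \<alpha> = row_sum lam \<Longrightarrow> b \<in> diagram lam \<Longrightarrow> T b = fst b"
proof -
  have ge: "fst b \<le> T b" if "b \<in> diagram lam" for b
    using that tableaux_entry_ge[OF assms] by (cases b) auto
  have T: "(\<Sum>b\<in>diagram lam. T b) = row_sum \<alpha>"
    using tableaux_sum[OF assms(1), of "\<lambda>i. i"] by (simp add: row_sum_def)
  show "row_sum lam \<le> row_sum \<alpha>"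
    unfolding T[symmetric] by (subst sum_fst_diagram[symmetric], rule sum_mono) (rule ge)
  show "T b = fst b" if "row_sum \<alpha> = row_sum lam" "b \<in> diagram lam"
  proof (rule ccontr)
    assume "T b \<noteq> fst b"
    then have "fst b < T b" using ge[OF that(2)] by simp
    then have "(\<Sum>b\<in>diagram lam. fst b) < (\<Sum>b\<in>diagram lam. T b)"
      by (intro sum_strict_mono_ex1) (use ge that(2) in auto)
    then show False using T that(1) by (simp add: sum_fst_diagram)
  qed
qed

lemma card_diagram_row: "card {b \<in> diagram lam. fst b = i} = lookup lam i"
proof -
  have "{b \<in> diagram lam. fst b = i} = {i} \<times> {..<lookup lam i}" by auto
  then show ?thesis by simp
qed

lemma kostka_row_sum:
  assumes "kostka lam \<alpha> \<noteq> 0" "is_partition lam" "\<alpha> \<noteq> lam"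
  shows "row_sum lam < row_sum \<alpha>"
proof -
  obtain T where T: "T \<in> tableaux lam \<alpha>" using assms(1) by (force simp: kostka_def)
  have "row_sum lam \<noteq> row_sum \<alpha>"
  proof
    assume eq: "row_sum lam = row_sum \<alpha>"
    have "lookup \<alpha> i = lookup lam i" for i
    proof -
      have "{b \<in> diagram lam. T b = i} = {b \<in> diagram lam. fst b = i}"
        using row_sum_le(2)[OF T assms(2) eq[symmetric]] by auto
      then show ?thesis using tableaux_content[OF T, of i] by (simp add: card_diagram_row)
    qed
    then show False using assms(3) by (auto intro: poly_mapping_eqI)
  qed
  then show ?thesis using row_sum_le(1)[OF T assms(2)] by simp
qed

lemma kostka_self: "is_partition lam \<Longrightarrow> kostka lam lam = 1"
proof -
  assume lam: "is_partition lam"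
  \<comment> \<open>Content equal to the shape means equal row sums, which forces every entry to be
    its row index; hence this is the only candidate.\<close>
  let ?T = "restrict fst (diagram lam)"
  have "?T \<in> tableaux lam lam"
    by (auto simp: tableaux_def semistandard_tableaux_def card_diagram_row
      cong: conj_cong)
  moreover have "T = ?T" if "T \<in> tableaux lam lam" for T
  proof (rule extensionalityI)
    show "T \<in> extensional (diagram lam)" using that by (simp add: tableaux_def semistandard_tableaux_def)
  qed (use row_sum_le(2)[OF that lam] in auto)
  ultimately have "tableaux lam lam = {?T}" by blast
  then show ?thesis by (simp add: kostka_def)
qed

lemma kostka_0: "kostka 0 \<alpha> = (if \<alpha> = 0 then 1 else 0)"
proof (cases "\<alpha> = 0")
  case True
  then show ?thesis using kostka_self[of 0] by (simp add: is_partition_def antimono_def)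
next
  case False
  then obtain i where "lookup \<alpha> i \<noteq> 0" by (metis lookup_zero poly_mapping_eqI)
  then have "tableaux 0 \<alpha> = {}" by (auto simp: tableaux_def diagram_def)
  with False show ?thesis by (simp add: kostka_def)
qed

lemma schur_0: "schur 0 = 1"
  by (rule series_eqI) (simp add: coeff_schur kostka_0 coeff_1)

text \<open>The first box of row n has an entry of at least n, so every tableau involves a variable
  outside the first n.\<close>

lemma restr_schur_eq_0:
  assumes "is_partition lam" "lookup lam n \<noteq> 0"
  shows "restr n (schur lam) = 0"
proof (rule series_eqI)
  fix \<alpha>
  have "tableaux lam \<alpha> = {}" if "keys \<alpha> \<subseteq> {..<n}"
  proof (rule ccontr)
    assume "tableaux lam \<alpha> \<noteq> {}"
    then obtain T where T: "T \<in> tableaux lam \<alpha>" by blast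
    have "n \<le> T (n, 0)" by (rule tableaux_entry_ge[OF T assms(1)]) (use assms(2) in simp)
    moreover have "T (n, 0) \<in> keys \<alpha>" by (rule tableaux_entry_in_keys[OF T]) (use assms(2) in simp)
    ultimately show False using that by auto
  qed
  then show "coeff (restr n (schur lam)) \<alpha> = coeff 0 \<alpha>"
    by (simp add: coeff_restr coeff_schur kostka_def)
qed

section \<open>Horizontal strips and the branching rule\<close>

text \<open>Interlacing form of the condition that lam/mu has no two boxes in one column; it makes
  mu a partition. The inequalities turn into intervals of bead positions.\<close>

definition horizontal_strip :: "(nat \<Rightarrow>\<^sub>0 nat) \<Rightarrow> (nat \<Rightarrow>\<^sub>0 nat) \<Rightarrow> bool" where
  "horizontal_strip lam mu \<longleftrightarrow> (\<forall>i. lookup mu i \<le> lookup lam i \<and> lookup lam (Suc i) \<le> lookup mu i)"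

lemma horizontal_strip_subset: "horizontal_strip lam mu \<Longrightarrow> diagram mu \<subseteq> diagram lam"
  by (simp add: horizontal_strip_def diagram_subset_iff)

lemma horizontal_strip_partition: "horizontal_strip lam mu \<Longrightarrow> is_partition mu"
  by (rule is_partition_SucI) (metis horizontal_strip_def order_trans)

lemma finite_horizontal_strips: "finite {mu. horizontal_strip lam mu \<and> P mu}"
  by (rule finite_subset[OF _ finite_subdiagrams[of lam]]) (auto dest: horizontal_strip_subset)

text \<open>N is the largest possible entry. Rows increase weakly, so the entries below N fill the
  first \<open>m i\<close> boxes of row i. Columns increase strictly, so a box with another box
  below it has an entry below N, which is the interlacing inequality.\<close>

lemma tableaux_shape_below:
  assumes T: "T \<in> tableaux lam (\<alpha> + Poly_Mapping.single N r)" and \<alpha>: "keys \<alpha> \<subseteq> {..<N}"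
    and lam: "is_partition lam"
  shows "\<exists>mu. horizontal_strip lam mu \<and> weight lam = weight mu + r \<and>
           {b \<in> diagram lam. T b < N} = diagram mu"
proof -
  have le: "T b \<le> N" if "b \<in> diagram lam" for b
    using tableaux_entry_in_keys[OF T that] \<alpha> by (fastforce simp: keys_add_nat split: if_splits)
  define m where "m i = (LEAST j. \<not> (j < lookup lam i \<and> T (i, j) < N))" for i
  have m1: "\<not> (m i < lookup lam i \<and> T (i, m i) < N)" for i
    unfolding m_def by (rule LeastI[of _ "lookup lam i"]) simp
  have m2: "j < lookup lam i \<and> T (i, j) < N" if "j < m i" for i j
    using not_less_Least[OF that[unfolded m_def]] by blast
  have m: "j < m i \<longleftrightarrow> j < lookup lam i \<and> T (i, j) < N" for i j
  proof
    assume j: "j < lookup lam i \<and> T (i, j) < N"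
    show "j < m i"
    proof (rule ccontr)
      assume "\<not> j < m i"
      then have "m i \<le> j" by simp
      then have "T (i, m i) \<le> T (i, j)" "m i < lookup lam i"
        using tableaux_row[OF T, of j i "m i"] j by auto
      then show False using m1[of i] j by simp
    qed
  qed (rule m2)
  have fin: "finite {i. m i \<noteq> 0}"
  proof (rule finite_subset)
    show "{i. m i \<noteq> 0} \<subseteq> keys lam"
    proof
      fix i assume "i \<in> {i. m i \<noteq> 0}"
      then have "0 < lookup lam i" using m[of 0 i] by auto
      then show "i \<in> keys lam" by (simp add: in_keys_iff)
    qed
  qed simp
  define mu where "mu = Abs_poly_mapping m"
  have mu: "lookup mu i = m i" for i unfolding mu_def using fin by simp
  have diag: "{b \<in> diagram lam. T b < N} = diagram mu"
    using m by (auto simp: mu)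
  have "m i \<le> lookup lam i" for i using m2[of "lookup lam i" i] by (meson leI less_irrefl)
  moreover have "lookup lam (Suc i) \<le> m i" for i
  proof (rule ccontr)
    assume "\<not> lookup lam (Suc i) \<le> m i"
    then have l: "m i < lookup lam (Suc i)" by simp
    have "T (i, m i) < T (Suc i, m i)" by (rule tableaux_column[OF T lam l]) simp
    also have "\<dots> \<le> N" by (rule le) (simp add: l)
    finally show False using m1[of i] l partition_antimono[OF lam, of i "Suc i"] by simp
  qed
  ultimately have "horizontal_strip lam mu" by (simp add: horizontal_strip_def mu)
  moreover have "weight lam = weight mu + r"
  proof -
    have "diagram lam = diagram mu \<union> {b \<in> diagram lam. T b = N}"
      unfolding diag[symmetric] using le by (auto simp: le_less)
    moreover have "diagram mu \<inter> {b \<in> diagram lam. T b = N} = {}"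
      unfolding diag[symmetric] by auto
    ultimately have "card (diagram lam) = card (diagram mu) + card {b \<in> diagram lam. T b = N}"
      by (metis card_Un_disjoint finite_Un finite_diagram)
    moreover have "N \<notin> keys \<alpha>" using \<alpha> by auto
    ultimately show ?thesis
      by (simp add: card_diagram tableaux_content[OF T] lookup_add in_keys_iff)
  qed
  ultimately show ?thesis using diag by blast
qed

text \<open>The inverse fills lam/mu with N; the content is right because lam/mu has r boxes and
  \<alpha> involves only entries below N.\<close>

lemma bij_betw_remove_largest_entry:
  assumes \<alpha>: "keys \<alpha> \<subseteq> {..<N}" and lam: "is_partition lam"
    and mu: "horizontal_strip lam mu" "weight lam = weight mu + r"
  shows "bij_betw (\<lambda>T. restrict T (diagram mu))
     {T \<in> tableaux lam (\<alpha> + Poly_Mapping.single N r). {b \<in> diagram lam. T b < N} = diagram mu}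
     (tableaux mu \<alpha>)"
proof (rule bij_betw_byWitness)
  let ?A = "{T \<in> tableaux lam (\<alpha> + Poly_Mapping.single N r). {b \<in> diagram lam. T b < N} = diagram mu}"
  let ?g = "\<lambda>T. restrict (\<lambda>b. if b \<in> diagram mu then T b else N) (diagram lam)"
  have sub: "diagram mu \<subseteq> diagram lam" by (rule horizontal_strip_subset[OF mu(1)])
  have mul: "lookup mu i \<le> lookup lam i" and lmu: "lookup lam (Suc i) \<le> lookup mu i" for i
    using mu(1) by (auto simp: horizontal_strip_def)
  have mup: "is_partition mu" by (rule horizontal_strip_partition[OF mu(1)])
  have aN: "lookup \<alpha> i = 0" if "N \<le> i" for i using \<alpha> that by (auto simp: in_keys_iff)
  have le: "T b \<le> N" if "T \<in> tableaux lam (\<alpha> + Poly_Mapping.single N r)" "b \<in> diagram lam" for T b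
    using tableaux_entry_in_keys[OF that] \<alpha> by (fastforce simp: keys_add_nat split: if_splits)
  show "\<forall>T\<in>?A. ?g (restrict T (diagram mu)) = T"
  proof
    fix T assume T: "T \<in> ?A"
    show "?g (restrict T (diagram mu)) = T"
    proof (rule extensionalityI[where A = "diagram lam"])
      show "T \<in> extensional (diagram lam)"
        using T by (simp add: tableaux_def semistandard_tableaux_def)
      fix b assume b: "b \<in> diagram lam"
      have "T b = N" if "b \<notin> diagram mu" using that b T le[of T b] by fastforce
      then show "?g (restrict T (diagram mu)) b = T b" using b by simp
    qed simp
  qed
  show "\<forall>T\<in>tableaux mu \<alpha>. restrict (?g T) (diagram mu) = T"
  proof
    fix T assume T: "T \<in> tableaux mu \<alpha>"
    show "restrict (?g T) (diagram mu) = T"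
      by (rule extensionalityI[where A = "diagram mu"])
         (use T sub in \<open>auto simp: tableaux_def semistandard_tableaux_def\<close>)
  qed
  show "(\<lambda>T. restrict T (diagram mu)) ` ?A \<subseteq> tableaux mu \<alpha>"
  proof (rule image_subsetI)
    fix T assume T: "T \<in> ?A"
    then have T': "T \<in> tableaux lam (\<alpha> + Poly_Mapping.single N r)" and
      D: "{b \<in> diagram lam. T b < N} = diagram mu" by auto
    have c: "card {b \<in> diagram mu. T b = i} = lookup \<alpha> i" for i
    proof (cases "i < N")
      case True
      then have "{b \<in> diagram mu. T b = i} = {b \<in> diagram lam. T b = i}"
        unfolding D[symmetric] by auto
      then show ?thesis using True by (simp add: tableaux_content[OF T'] lookup_add lookup_single)
    next
      case False
      then have "{b \<in> diagram mu. T b = i} = {}" unfolding D[symmetric] by auto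
      then show ?thesis using False by (simp add: aN)
    qed
    have "{b \<in> diagram mu. restrict T (diagram mu) b = i} = {b \<in> diagram mu. T b = i}" for i by auto
    with c have "card {b \<in> diagram mu. restrict T (diagram mu) b = i} = lookup \<alpha> i" for i by simp
    moreover have "restrict T (diagram mu) (i, j) \<le> restrict T (diagram mu) (i, j')"
      if "j' < lookup mu i" "j < j'" for i j j'
      using that tableaux_row[OF T', of j' i j] mul[of i] by simp
    moreover have "restrict T (diagram mu) (i, j) < restrict T (diagram mu) (i', j)"
      if "j < lookup mu i'" "i < i'" for i i' j
      using that tableaux_column[OF T' lam, of j i' i] mul[of i'] partition_antimono[OF mup, of i i'] by simp
    ultimately show "restrict T (diagram mu) \<in> tableaux mu \<alpha>"
      by (simp add: tableaux_def semistandard_tableaux_def del: restrict_apply)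
  qed
  show "?g ` tableaux mu \<alpha> \<subseteq> ?A"
  proof (rule image_subsetI)
    fix T assume T: "T \<in> tableaux mu \<alpha>"
    have lt: "T b < N" if "b \<in> diagram mu" for b
      using tableaux_entry_in_keys[OF T that] \<alpha> by auto
    have D: "{b \<in> diagram lam. ?g T b < N} = diagram mu"
      using lt sub by auto
    have c: "card {b \<in> diagram lam. ?g T b = i} = lookup (\<alpha> + Poly_Mapping.single N r) i" for i
    proof (cases "i = N")
      case True
      have "{b \<in> diagram lam. ?g T b = i} = diagram lam - diagram mu"
        using True lt by force
      then show ?thesis using True mu(2) sub
        by (simp add: lookup_add aN card_Diff_subset finite_subset card_diagram)
    next
      case False
      then have "{b \<in> diagram lam. ?g T b = i} = {b \<in> diagram mu. T b = i}"
        using sub by auto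
      then show ?thesis using False by (simp add: tableaux_content[OF T] lookup_add lookup_single)
    qed
    have row: "?g T (i, j) \<le> ?g T (i, j')" if "j' < lookup lam i" "j < j'" for i j j'
      using that tableaux_row[OF T, of j' i j] lt[of "(i, j)"] by auto
    \<comment> \<open>By interlacing, the upper of two boxes in a column lies in mu and has an entry
      below N, so N never occurs twice in a column.\<close>
    have col: "?g T (i, j) < ?g T (i', j)" if "j < lookup lam i'" "i < i'" for i i' j
    proof -
      have "lookup lam i' \<le> lookup lam (Suc i)" using that(2) by (intro partition_antimono[OF lam]) simp
      then have "j < lookup mu i" using that(1) lmu[of i] by simp
      moreover from this have "j < lookup lam i" using mul[of i] by simp
      ultimately show ?thesis
        using that tableaux_column[OF T mup, of j i' i] lt[of "(i, j)"] by simp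
    qed
    have "?g T \<in> tableaux lam (\<alpha> + Poly_Mapping.single N r)"
      unfolding tableaux_def semistandard_tableaux_def
      using row col c by (simp del: restrict_apply)
    then show "?g T \<in> ?A" using D by blast
  qed
qed

lemma kostka_branching:
  assumes \<alpha>: "keys \<alpha> \<subseteq> {..<N}" and lam: "is_partition lam"
  shows "kostka lam (\<alpha> + Poly_Mapping.single N r) =
    (\<Sum>mu | horizontal_strip lam mu \<and> weight lam = weight mu + r. kostka mu \<alpha>)"
proof -
  let ?H = "{mu. horizontal_strip lam mu \<and> weight lam = weight mu + r}"
  let ?A = "\<lambda>mu. {T \<in> tableaux lam (\<alpha> + Poly_Mapping.single N r). {b \<in> diagram lam. T b < N} = diagram mu}"
  have "tableaux lam (\<alpha> + Poly_Mapping.single N r) = (\<Union>mu\<in>?H. ?A mu)"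
    using tableaux_shape_below[OF _ \<alpha> lam] by fast
  then have "kostka lam (\<alpha> + Poly_Mapping.single N r) = card (\<Union>mu\<in>?H. ?A mu)"
    by (simp add: kostka_def)
  also have "\<dots> = (\<Sum>mu\<in>?H. card (?A mu))"
    by (rule card_UN_disjoint) (auto simp: finite_horizontal_strips diagram_inject)
  also have "\<dots> = (\<Sum>mu\<in>?H. kostka mu \<alpha>)"
    unfolding kostka_def
    by (rule sum.cong[OF refl], rule bij_betw_same_card, rule bij_betw_remove_largest_entry)
       (use \<alpha> lam in auto)
  finally show ?thesis .
qed

text \<open>The exponent of the last variable in \<beta> fixes the size r of the removed strip, so
  in each coefficient only strips of this size survive and \<open>kostka_branching\<close>
  applies.\<close>

lemma restr_Suc_schur:
  assumes lam: "is_partition lam"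
  shows "restr (Suc n) (schur lam :: 'a::comm_ring_1 power_series) =
    (\<Sum>mu | horizontal_strip lam mu. var n ^ (weight lam - weight mu) * restr n (schur mu))"
proof (rule series_eqI)
  fix \<beta> :: "nat \<Rightarrow>\<^sub>0 nat"
  define r where "r = lookup \<beta> n"
  define \<alpha> where "\<alpha> = \<beta> - Poly_Mapping.single n r"
  have \<beta>: "\<beta> = \<alpha> + Poly_Mapping.single n r"
    by (rule poly_mapping_eqI) (simp add: \<alpha>_def r_def lookup_add lookup_minus lookup_single when_def)
  have le: "weight mu \<le> weight lam" if "horizontal_strip lam mu" for mu
    by (rule weight_mono[OF horizontal_strip_subset[OF that]])
  have keys: "keys (\<beta> - Poly_Mapping.single n e) \<subseteq> {..<n} \<longleftrightarrow> keys \<beta> \<subseteq> {..<Suc n} \<and> e = r"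
    if "e \<le> r" for e
  proof -
    have "keys (\<beta> - Poly_Mapping.single n e) = keys \<beta> - {n} \<union> (if e = r then {} else {n})"
      using that by (auto simp: in_keys_iff lookup_minus lookup_single r_def when_def split: if_splits)
    then show ?thesis by (auto simp: less_Suc_eq)
  qed
  have term_eq: "coeff (var n ^ (weight lam - weight mu) * restr n (schur mu)) \<beta> =
     (if keys \<beta> \<subseteq> {..<Suc n} \<and> weight lam = weight mu + r then of_nat (kostka mu \<alpha>) else (0 :: 'a))"
    if "horizontal_strip lam mu" for mu
    using keys[of "weight lam - weight mu"] le[OF that]
    by (auto simp: coeff_var_power_mult coeff_restr coeff_schur \<alpha>_def simp flip: r_def)
  show "coeff (restr (Suc n) (schur lam) :: 'a power_series) \<beta> =
    coeff (\<Sum>mu | horizontal_strip lam mu. var n ^ (weight lam - weight mu) * restr n (schur mu)) \<beta>"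
  proof (cases "keys \<beta> \<subseteq> {..<Suc n}")
    case True
    then have \<alpha>: "keys \<alpha> \<subseteq> {..<n}" using keys[of r] by (simp add: \<alpha>_def)
    have "coeff (restr (Suc n) (schur lam) :: 'a power_series) \<beta> = of_nat (kostka lam (\<alpha> + Poly_Mapping.single n r))"
      using True by (simp add: coeff_restr coeff_schur \<beta>)
    also have "\<dots> = (\<Sum>mu | horizontal_strip lam mu \<and> weight lam = weight mu + r. of_nat (kostka mu \<alpha>))"
      by (simp add: kostka_branching[OF \<alpha> lam])
    also have "\<dots> = (\<Sum>mu | horizontal_strip lam mu.
        coeff (var n ^ (weight lam - weight mu) * restr n (schur mu)) \<beta>)"
    proof (rule sum.mono_neutral_cong_left, goal_cases)
      case (3)
      then show ?case using True term_eq by auto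
    next
      case (4 mu)
      then show ?case by (subst term_eq) (use True in auto)
    qed (use finite_horizontal_strips[of lam "\<lambda>_. True"] in auto)
    finally show ?thesis by (simp only: coeff_sum)
  next
    case False
    then show ?thesis using term_eq by (simp add: coeff_restr)
  qed
qed

section \<open>Alternants\<close>

text \<open>As a determinant it inherits the rules for permuted and equal rows and for matrix
  products; \<open>alt_expand\<close> gives the signed sum on which derivations and multiplications
  act term by term. The exponents need not be sorted, so beads can be moved freely.\<close>

definition alt :: "nat \<Rightarrow> (nat \<Rightarrow> nat) \<Rightarrow> 'a::comm_ring_1 power_series" where
  "alt n l = det (mat n n (\<lambda>(i, j). var j ^ l i))"

lemma alt_expand: "alt n l = (\<Sum>p | p permutes {..<n}. of_int (sign p) * (\<Prod>i<n. var (p i) ^ l i))"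
proof -
  have "alt n l = (\<Sum>p | p permutes {..<n}. of_int (sign p) *
      (\<Prod>i<n. mat n n (\<lambda>(i, j). var j ^ l i :: 'a power_series) $$ (i, p i)))"
    unfolding alt_def by (subst det_def'[of _ n]) (auto simp: lessThan_atLeast0)
  also have "\<dots> = (\<Sum>p | p permutes {..<n}. of_int (sign p) * (\<Prod>i<n. var (p i) ^ l i))"
  proof (rule sum.cong[OF refl])
    fix p assume "p \<in> {p. p permutes {..<n}}"
    then have "p i < n" if "i < n" for i using that permutes_in_image[of p "{..<n}" i] by simp
    then show "of_int (sign p) * (\<Prod>i<n. mat n n (\<lambda>(i, j). var j ^ l i :: 'a power_series) $$ (i, p i)) =
        of_int (sign p) * (\<Prod>i<n. var (p i) ^ l i)"
      by (auto intro!: arg_cong2[of _ _ _ _ "(*)"] prod.cong)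
  qed
  finally show ?thesis .
qed

lemma alt_cong: "(\<And>i. i < n \<Longrightarrow> l i = l' i) \<Longrightarrow> alt n l = alt n l'"
  unfolding alt_expand by simp

lemma alt_permute:
  assumes "p permutes {..<n}"
  shows "alt n (\<lambda>i. l (p i)) = of_int (sign p) * (alt n l :: 'a::comm_ring_1 power_series)"
proof -
  have p: "p i < n" if "i < n" for i using that assms permutes_in_image[of p "{..<n}" i] by simp
  let ?A = "mat n n (\<lambda>(i, j). var j ^ l i :: 'a power_series)"
  have "det (mat n n (\<lambda>(i, j). ?A $$ (p i, j))) = of_int (sign p) * det ?A"
    by (rule det_permute_rows) (use assms in \<open>auto simp: lessThan_atLeast0\<close>)
  moreover have "mat n n (\<lambda>(i, j). ?A $$ (p i, j)) = mat n n (\<lambda>(i, j). var j ^ l (p i))"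
    by (rule eq_matI) (auto simp: p)
  ultimately show ?thesis by (simp add: alt_def)
qed

lemma alt_swap:
  assumes "i < n" "j < n" "i \<noteq> j"
  shows "alt n (\<lambda>m. l (transpose i j m)) = - alt n l"
  by (subst alt_permute) (use assms in \<open>simp_all add: permutes_swap_id sign_swap_id\<close>)

lemma alt_eq_0:
  fixes l :: "nat \<Rightarrow> nat"
  assumes "i < n" "j < n" "i \<noteq> j" "l i = l j"
  shows "alt n l = 0"
  unfolding alt_def
  by (rule det_identical_rows[of _ n i j]) (use assms in \<open>auto intro!: eq_vecI simp: row_def\<close>)

definition of_fun :: "nat \<Rightarrow> (nat \<Rightarrow> nat) \<Rightarrow> (nat \<Rightarrow>\<^sub>0 nat)" where
  "of_fun n f = Abs_poly_mapping (\<lambda>i. if i < n then f i else 0)"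

lemma lookup_of_fun [simp]: "lookup (of_fun n f) i = (if i < n then f i else 0)"
proof -
  have "finite {i. (if i < n then f i else 0) \<noteq> 0}"
    by (rule finite_subset[of _ "{..<n}"]) auto
  then show ?thesis by (simp add: of_fun_def)
qed

lemma keys_of_fun: "keys (of_fun n f) \<subseteq> {..<n}"
  by (auto simp: in_keys_iff split: if_splits)

lemma weight_of_fun: "weight (of_fun n f) = (\<Sum>i<n. f i)"
  using weight_eq_sum[OF keys_of_fun] by simp

lemma partition_keys: "is_partition lam \<Longrightarrow> lookup lam n = 0 \<Longrightarrow> keys lam \<subseteq> {..<n}"
  using partition_antimono[of lam n] by (auto simp: in_keys_iff intro!: leI)

lemma prod_var_permuted:
  assumes "p permutes {..<n}"
  shows "(\<Prod>i<n. var (p i) ^ l i) = mon (of_fun n (\<lambda>j. l (inv_into UNIV p j)))"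
proof -
  have inv: "i < n \<Longrightarrow> inv_into UNIV p i < n" for i
    using permutes_in_image[OF permutes_inv[OF assms], of i] by simp
  have "(\<Sum>i<n. Poly_Mapping.single (p i) (l i)) = of_fun n (\<lambda>j. l (inv_into UNIV p j))"
  proof (rule poly_mapping_eqI)
    fix j
    have eq: "p i = j \<longleftrightarrow> i = inv_into UNIV p j" for i
      using permutes_inverses[OF assms] by auto
    have "inv_into UNIV p j < n \<longleftrightarrow> j < n"
      using permutes_in_image[OF permutes_inv[OF assms], of j] by simp
    then show "lookup (\<Sum>i<n. Poly_Mapping.single (p i) (l i)) j = lookup (of_fun n (\<lambda>j. l (inv_into UNIV p j))) j"
      by (simp add: lookup_sum lookup_single when_def eq)
  qed
  then show ?thesis by (simp add: prod_var_power)
qed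

text \<open>Both sequences decrease strictly, so p preserves the order and
  \<open>i \<le> p i\<close>. The sums of \<open>p i\<close> and of i over i < n agree, so equality
  holds throughout.\<close>

lemma strict_decreasing_permutation:
  fixes l m :: "nat \<Rightarrow> nat"
  assumes p: "p permutes {..<n}"
    and l: "\<And>i j. i < j \<Longrightarrow> j < n \<Longrightarrow> l j < l i"
    and m: "\<And>i j. i < j \<Longrightarrow> j < n \<Longrightarrow> m j < m i"
    and eq: "\<And>i. i < n \<Longrightarrow> m (p i) = l i"
  shows "p = id"
proof -
  have pn: "p i < n" if "i < n" for i using that p permutes_in_image[of p "{..<n}" i] by simp
  have mono: "p i < p j" if "i < j" "j < n" for i j
  proof (rule ccontr)
    assume "\<not> p i < p j"
    then have "m (p i) \<le> m (p j)"
      using m[of "p j" "p i"] pn[of i] that by (cases "p i = p j") auto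
    then show False using l[OF that] eq[of i] eq[of j] that by simp
  qed
  have ge: "i \<le> p i" if "i < n" for i using that
  proof (induction i)
    case (Suc i)
    then show ?case using mono[of i "Suc i"] by fastforce
  qed simp
  have "(\<Sum>i<n. p i) = (\<Sum>i<n. i)" using sum.permute[OF p, of "\<lambda>i. i"] by (simp add: comp_def)
  have "p i = i" for i
  proof (cases "i < n")
    case True
    show ?thesis
    proof (rule ccontr)
      assume "p i \<noteq> i"
      then have "(\<Sum>i<n. i) < (\<Sum>i<n. p i)"
        using ge True by (intro sum_strict_mono_ex1) (auto intro!: bexI[of _ i] simp: order_less_le)
      then show False using \<open>(\<Sum>i<n. p i) = (\<Sum>i<n. i)\<close> by simp
    qed
  next
    case False
    then show ?thesis using p by (simp add: permutes_def)
  qed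
  then show ?thesis by auto
qed

text \<open>By \<open>strict_decreasing_permutation\<close> only the identity produces a monomial
  with decreasing exponents, and its sign is 1. These monomials therefore separate the alternants of
  decreasing sequences, which is what \<open>schur_coeff\<close> relies on.\<close>

lemma coeff_alt_decreasing:
  fixes l m :: "nat \<Rightarrow> nat"
  assumes l: "\<And>i j. i < j \<Longrightarrow> j < n \<Longrightarrow> l j < l i"
    and m: "\<And>i j. i < j \<Longrightarrow> j < n \<Longrightarrow> m j < m i"
  shows "coeff (alt n l) (of_fun n m) = (if \<forall>i<n. l i = m i then 1 else 0)"
proof -
  have mon: "coeff (mon (of_fun n (\<lambda>j. l (inv_into UNIV p j)))) (of_fun n m) =
      (if p = id \<and> (\<forall>i<n. l i = m i) then 1 else (0 :: 'a))" if p: "p permutes {..<n}" for p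
  proof (cases "of_fun n m = of_fun n (\<lambda>j. l (inv_into UNIV p j))")
    case True
    then have "lookup (of_fun n m) i = lookup (of_fun n (\<lambda>j. l (inv_into UNIV p j))) i" for i by simp
    then have eq: "m i = l (inv_into UNIV p i)" if "i < n" for i using that by (metis lookup_of_fun)
    have "m (p i) = l i" if "i < n" for i
      using that eq[of "p i"] permutes_in_image[OF p, of i] permutes_inverses[OF p] by simp
    then have "p = id" by (intro strict_decreasing_permutation[OF p l m])
    then show ?thesis using True eq by (auto simp: coeff_mon)
  next
    case False
    have "\<not> (p = id \<and> (\<forall>i<n. l i = m i))"
    proof
      assume "p = id \<and> (\<forall>i<n. l i = m i)"
      then have "of_fun n m = of_fun n (\<lambda>j. l (inv_into UNIV p j))" by (intro poly_mapping_eqI) auto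
      then show False using False by simp
    qed
    then show ?thesis using False by (simp add: coeff_mon)
  qed
  have "coeff (alt n l) (of_fun n m) = (\<Sum>p | p permutes {..<n}.
      of_int (sign p) * coeff (mon (of_fun n (\<lambda>j. l (inv_into UNIV p j)))) (of_fun n m))"
    unfolding alt_expand coeff_sum
    by (rule sum.cong) (simp_all add: prod_var_permuted of_int_mult_series)
  also have "\<dots> = (\<Sum>p | p permutes {..<n}.
      if p = id then if \<forall>i<n. l i = m i then 1 else 0 else (0 :: 'a))"
    by (rule sum.cong) (simp_all add: mon)
  also have "\<dots> = (if \<forall>i<n. l i = m i then 1 else 0)"
    by (simp add: sum.delta finite_permutations permutes_id)
  finally show ?thesis .
qed

text \<open>Subtracting from each row of the matrix a multiple of the next one clears the last column up
  to its last entry; then \<open>x\<^sub>j - x\<^sub>n\<close> divides column \<open>j\<close> and the quotients are geometric sums.\<close>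

lemma alt_Suc:
  fixes l :: "nat \<Rightarrow> nat"
  assumes l: "\<And>i. i < n \<Longrightarrow> l (Suc i) \<le> l i"
  shows "alt (Suc n) l = (\<Prod>j<n. var j - var n) *
     (\<Sum>m\<in>PiE {..<n} (\<lambda>i. {l (Suc i)..<l i}). var n ^ (l n + (\<Sum>i<n. l i - 1 - m i)) * (alt n m :: 'a::comm_ring_1 power_series))"
proof -
  define x :: "nat \<Rightarrow> 'a power_series" where "x = var"
  define y :: "'a power_series" where "y = var n"
  \<comment> \<open>Unit upper bidiagonal: from row i it subtracts y^(l i - l (i + 1)) times row i +
    1, which cancels the power of y in the last column.\<close>
  define u where "u i k = (if k = i then 1 else if k = Suc i then - (y ^ (l i - l k)) else 0)" for i k
  let ?A = "mat (Suc n) (Suc n) (\<lambda>(i, j). x j ^ l i)"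
  let ?U = "mat (Suc n) (Suc n) (\<lambda>(i, k). u i k)"
  \<comment> \<open>Quotient of the new entry by x_j - y. Its exponents run through the interval
    between consecutive values of l; this is the origin of the interlacing choices.\<close>
  define g where "g i j = (\<Sum>m\<in>{l (Suc i)..<l i}. x j ^ m * y ^ (l i - 1 - m))" for i j
  let ?B1 = "mat n n (\<lambda>(i, j). (x j - y) * g i j)"
  let ?B3 = "mat 1 n (\<lambda>(i, j). x j ^ l n)"
  let ?B4 = "mat 1 1 (\<lambda>_. y ^ l n)"
  have geom: "x j ^ a - y ^ (a - b) * x j ^ b = (x j - y) * (\<Sum>m\<in>{b..<a}. x j ^ m * y ^ (a - 1 - m))"
    if "b \<le> a" for a b j
  proof -
    have "(\<Sum>m\<in>{b..<a}. x j ^ m * y ^ (a - 1 - m)) = (\<Sum>m<a - b. x j ^ (m + b) * y ^ (a - 1 - (m + b)))"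
      using that sum.shift_bounds_nat_ivl[of "\<lambda>m. x j ^ m * y ^ (a - 1 - m)" 0 b "a - b"]
      by (simp add: lessThan_atLeast0)
    also have "\<dots> = x j ^ b * (\<Sum>m<a - b. y ^ (a - b - Suc m) * x j ^ m)"
      by (auto simp: sum_distrib_left power_add mult_ac add.commute intro!: sum.cong arg_cong[of _ _ "\<lambda>e. y ^ e"])
    finally have "(x j - y) * (\<Sum>m\<in>{b..<a}. x j ^ m * y ^ (a - 1 - m)) = x j ^ b * (x j ^ (a - b) - y ^ (a - b))"
      by (simp add: power_diff_sumr2 mult_ac)
    also have "\<dots> = x j ^ a - y ^ (a - b) * x j ^ b"
      using that by (simp add: algebra_simps flip: power_add)
    finally show ?thesis ..
  qed
  have entry: "(\<Sum>k = 0..<Suc n. u i k * x j ^ l k) =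
      x j ^ l i - (if i < n then y ^ (l i - l (Suc i)) * x j ^ l (Suc i) else 0)" if "i < Suc n" for i j
  proof -
    have "(\<Sum>k = 0..<Suc n. u i k * x j ^ l k) =
      (\<Sum>k = 0..<Suc n. (if k = i then x j ^ l i else 0) - (if k = Suc i then y ^ (l i - l (Suc i)) * x j ^ l (Suc i) else 0))"
      by (rule sum.cong) (auto simp: u_def)
    also have "\<dots> = x j ^ l i - (if i < n then y ^ (l i - l (Suc i)) * x j ^ l (Suc i) else 0)"
      using that unfolding sum_subtractf by (simp add: sum.delta)
    finally show ?thesis .
  qed
  have "det (?U * ?A) = det ?U * det ?A" by (rule det_mult[of _ "Suc n"]) auto
  moreover have "det ?U = 1"
    by (subst det_upper_triangular[of _ "Suc n"]) (auto simp: upper_triangular_def prod_list_diag_prod u_def)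
  moreover have "?U * ?A = four_block_mat ?B1 (0\<^sub>m n 1) ?B3 ?B4"
  proof (rule eq_matI)
    fix i j assume "i < dim_row (four_block_mat ?B1 (0\<^sub>m n 1) ?B3 ?B4)"
      "j < dim_col (four_block_mat ?B1 (0\<^sub>m n 1) ?B3 ?B4)"
    then have ij: "i < Suc n" "j < Suc n" by auto
    have "(?U * ?A) $$ (i, j) = x j ^ l i - (if i < n then y ^ (l i - l (Suc i)) * x j ^ l (Suc i) else 0)"
      using ij by (simp add: scalar_prod_def entry del: sum.op_ivl_Suc)
    also have "\<dots> = four_block_mat ?B1 (0\<^sub>m n 1) ?B3 ?B4 $$ (i, j)"
    proof (cases "i < n")
      case True
      have "x j ^ l i - y ^ (l i - l (Suc i)) * x j ^ l (Suc i) = (x j - y) * g i j"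
        unfolding g_def by (rule geom) (rule l[OF True])
      moreover have "(x j - y) * g i j = 0" if "\<not> j < n"
        using that ij(2) by (simp add: less_Suc_eq x_def y_def)
      ultimately show ?thesis using True ij by simp
    next
      case False
      then have "i = n" using ij by simp
      then show ?thesis using ij by (auto simp: less_Suc_eq x_def y_def)
    qed
    finally show "(?U * ?A) $$ (i, j) = four_block_mat ?B1 (0\<^sub>m n 1) ?B3 ?B4 $$ (i, j)" .
  qed auto
  moreover have "det (four_block_mat ?B1 (0\<^sub>m n 1) ?B3 ?B4) = det ?B1 * det ?B4"
    by (rule det_four_block_mat_upper_right_zero_col[of _ n]) auto
  moreover have "det ?B4 = y ^ l n" by (simp add: det_single)
  ultimately have 1: "alt (Suc n) l = det ?B1 * y ^ l n" by (simp add: alt_def x_def)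
  have "det ?B1 = (\<Sum>p | p permutes {..<n}. of_int (sign p) * (\<Prod>i<n. ?B1 $$ (i, p i)))"
    by (subst det_def'[of _ n]) (auto simp: lessThan_atLeast0)
  also have "\<dots> = (\<Sum>p | p permutes {..<n}. \<Sum>m\<in>PiE {..<n} (\<lambda>i. {l (Suc i)..<l i}).
     (\<Prod>j<n. x j - y) * (y ^ (\<Sum>i<n. l i - 1 - m i) * (of_int (sign p) * (\<Prod>i<n. x (p i) ^ m i))))"
  proof (rule sum.cong[OF refl])
    fix p assume "p \<in> {p. p permutes {..<n}}"
    then have p: "p permutes {..<n}" by simp
    have "(\<Prod>i<n. ?B1 $$ (i, p i)) = (\<Prod>i<n. (x (p i) - y) * g i (p i))"
      by (rule prod.cong) (use permutes_in_image[OF p] in auto)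
    also have "\<dots> = (\<Prod>i<n. x (p i) - y) * (\<Prod>i<n. g i (p i))" by (rule prod.distrib)
    also have "(\<Prod>i<n. x (p i) - y) = (\<Prod>j<n. x j - y)"
      using prod.permute[OF p, of "\<lambda>j. x j - y"] by (simp add: comp_def)
    \<comment> \<open>Expanding the product picks one exponent \<open>m i\<close> per row, from
      ranges that do not depend on p, so each choice m collects its own alternant.\<close>
    also have "(\<Prod>i<n. g i (p i)) = (\<Sum>m\<in>PiE {..<n} (\<lambda>i. {l (Suc i)..<l i}). \<Prod>i<n. x (p i) ^ m i * y ^ (l i - 1 - m i))"
      unfolding g_def by (rule prod_sum_PiE) auto
    finally show "of_int (sign p) * (\<Prod>i<n. ?B1 $$ (i, p i)) = (\<Sum>m\<in>PiE {..<n} (\<lambda>i. {l (Suc i)..<l i}).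
     (\<Prod>j<n. x j - y) * (y ^ (\<Sum>i<n. l i - 1 - m i) * (of_int (sign p) * (\<Prod>i<n. x (p i) ^ m i))))"
      by (simp add: prod.distrib sum_distrib_left mult_ac flip: power_sum)
  qed
  also have "\<dots> = (\<Prod>j<n. x j - y) * (\<Sum>m\<in>PiE {..<n} (\<lambda>i. {l (Suc i)..<l i}). y ^ (\<Sum>i<n. l i - 1 - m i) * alt n m)"
    unfolding alt_expand x_def sum_distrib_left by (rule sum.swap)
  finally show ?thesis unfolding 1 x_def y_def
    by (simp add: sum_distrib_left sum_distrib_right power_add mult_ac)
qed

section \<open>The Vandermonde product and the bialternant formula\<close>

definition vand :: "nat \<Rightarrow> 'a::comm_ring_1 power_series" where
  "vand n = (\<Prod>j<n. \<Prod>i<j. var i - var j)"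

lemma vand_Suc: "vand (Suc n) = vand n * (\<Prod>i<n. var i - var n)"
  by (simp add: vand_def)

lemma prod_mult_eq_0:
  assumes "finite A" "\<And>x f. x \<in> A \<Longrightarrow> g x * f = 0 \<Longrightarrow> f = (0 :: 'a::comm_ring_1 power_series)"
    and "(\<Prod>x\<in>A. g x) * f = 0"
  shows "f = 0"
  using assms by (induction A) (auto simp: mult.assoc)

lemma vand_mult_eq_0: "vand n * f = 0 \<Longrightarrow> f = (0 :: 'a::comm_ring_1 power_series)"
  unfolding vand_def
proof (erule prod_mult_eq_0[rotated 2])
  fix j and h :: "'a power_series" assume "(\<Prod>i<j. var i - var j) * h = 0"
  then show "h = 0"
  proof (rule prod_mult_eq_0[rotated 2])
    fix i and f :: "'a power_series" assume "i \<in> {..<j}" "(var i - var j) * f = 0"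
    then show "f = 0" by (intro var_diff_mult_eq_0[of i j f]) auto
  qed simp
qed simp

lemma vand_mult_cancel: "vand n * f = vand n * g \<Longrightarrow> f = g"
  using vand_mult_eq_0[of n "f - g"] by (simp add: algebra_simps)

definition beads :: "nat \<Rightarrow> (nat \<Rightarrow>\<^sub>0 nat) \<Rightarrow> nat \<Rightarrow> nat" where
  "beads n lam i = lookup lam i + (n - 1 - i)"

lemma beads_decreasing: "is_partition lam \<Longrightarrow> i < j \<Longrightarrow> j < n \<Longrightarrow> beads n lam j < beads n lam i"
  using partition_antimono[of lam i j] by (simp add: beads_def)

text \<open>Induction on the number of variables: the branching rule for the Schur function and
  \<open>alt_Suc\<close> for the alternant are the same recursion once interlacing partitions are
  written as beads.\<close>

theorem vand_mult_schur:
  assumes "is_partition lam" "lookup lam n = 0"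
  shows "vand n * restr n (schur lam) = (alt n (beads n lam) :: 'a::comm_ring_1 power_series)"
  using assms
proof (induction n arbitrary: lam)
  case 0
  have "lam = 0"
    by (rule poly_mapping_eqI) (use partition_antimono[OF 0(1), of 0] 0(2) in simp)
  then show ?case by (simp add: vand_def schur_0 alt_expand)
next
  case (Suc n)
  note lam = Suc.prems(1)
  have lam0: "lookup lam i = 0" if "n < i" for i
    using partition_antimono[OF lam, of "Suc n" i] Suc.prems(2) that by simp
  define l where "l = beads (Suc n) lam"
  let ?P = "PiE {..<n} (\<lambda>i. {l (Suc i)..<l i})"
  let ?H = "{mu. horizontal_strip lam mu \<and> lookup mu n = 0}"
  have "vand n * restr (Suc n) (schur lam :: 'a power_series) =
    (\<Sum>mu | horizontal_strip lam mu. var n ^ (weight lam - weight mu) * (vand n * restr n (schur mu)))"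
    by (simp add: restr_Suc_schur[OF lam] sum_distrib_left mult_ac)
  also have "\<dots> = (\<Sum>mu\<in>?H. var n ^ (weight lam - weight mu) * (alt n (beads n mu)))"
  proof (rule sum.mono_neutral_cong_right, goal_cases)
    case 3
    have "restr n (schur mu) = (0 :: 'a power_series)" if "horizontal_strip lam mu" "lookup mu n \<noteq> 0" for mu
      by (rule restr_schur_eq_0[OF horizontal_strip_partition[OF that(1)] that(2)])
    then show ?case by auto
  next
    case (4 mu)
    then show ?case using Suc.IH[of mu] horizontal_strip_partition[of lam mu] by simp
  qed (use finite_horizontal_strips[of lam "\<lambda>_. True"] in auto)
  \<comment> \<open>Here l uses n + 1 beads and mu only n, so the staircase of mu is lower by one:
    \<open>l (Suc i) \<le> beads n mu i < l i\<close> says that the i-th part of mu lies between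
    parts i + 1 and i of lam, both bounds included.\<close>
  also have "\<dots> = (\<Sum>m\<in>?P. var n ^ (l n + (\<Sum>i<n. l i - 1 - m i)) * alt n m)"
  proof (rule sum.reindex_bij_witness[where
        i = "\<lambda>m. of_fun n (\<lambda>i. m i - (n - 1 - i))" and j = "\<lambda>mu. restrict (beads n mu) {..<n}"], goal_cases)
    case (1 mu)
    then have "is_partition mu" using horizontal_strip_partition by blast
    then have "keys mu \<subseteq> {..<n}" using 1 by (intro partition_keys) auto
    then show ?case
      by (intro poly_mapping_eqI) (auto simp: beads_def in_keys_iff subset_iff)
  next
    case (2 mu)
    then have le: "lookup lam (Suc i) \<le> lookup mu i \<and> lookup mu i \<le> lookup lam i" for i
      by (auto simp: horizontal_strip_def)
    have "beads n mu i \<in> {l (Suc i)..<l i}" if "i < n" for i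
      using le[of i] that by (auto simp: l_def beads_def)
    then show ?case by simp
  next
    case (3 m)
    have ge: "n - 1 - i \<le> m i" if "i < n" for i
      using 3 that unfolding l_def by (fastforce simp: PiE_def Pi_def beads_def)
    show ?case
    proof
      fix i show "restrict (beads n (of_fun n (\<lambda>i. m i - (n - 1 - i)))) {..<n} i = m i"
        using ge[of i] 3 by (cases "i < n") (auto simp: beads_def PiE_def extensional_def)
    qed
  next
    case (4 m)
    have m: "l (Suc i) \<le> m i \<and> m i < l i" if "i < n" for i
      using 4 that by (auto simp: PiE_def Pi_def)
    have "m i - (n - 1 - i) \<le> lookup lam i \<and> lookup lam (Suc i) \<le> m i - (n - 1 - i)" if "i < n" for i
      using m[OF that] that unfolding l_def beads_def by auto
    then show ?case using lam0 by (auto simp: horizontal_strip_def)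
  next
    case (5 mu)
    have mu: "lookup lam (Suc i) \<le> lookup mu i" "lookup mu i \<le> lookup lam i" for i
      using 5 by (auto simp: horizontal_strip_def)
    have "keys mu \<subseteq> {..<n}"
      using 5 horizontal_strip_partition by (intro partition_keys) auto
    then have wmu: "weight mu = (\<Sum>i<n. lookup mu i)" by (rule weight_eq_sum) simp
    have wlam: "weight lam = (\<Sum>i<n. lookup lam i) + lookup lam n"
      using weight_eq_sum[of lam "{..<Suc n}"] partition_keys[OF lam Suc.prems(2)] by simp
    have "(\<Sum>i<n. l i - 1 - restrict (beads n mu) {..<n} i) = (\<Sum>i<n. lookup lam i - lookup mu i)"
      by (rule sum.cong) (auto simp: l_def beads_def)
    also have "\<dots> = (\<Sum>i<n. lookup lam i) - (\<Sum>i<n. lookup mu i)"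
      using mu by (intro sum_subtractf_nat) auto
    \<comment> \<open>\<open>l n\<close> is the last part of lam, so the exponent is the number of
      boxes of lam/mu.\<close>
    finally have "l n + (\<Sum>i<n. l i - 1 - restrict (beads n mu) {..<n} i) = weight lam - weight mu"
      using sum_mono[of "{..<n}" "lookup mu" "lookup lam"] mu
      by (simp add: wmu wlam l_def beads_def)
    moreover have "alt n (restrict (beads n mu) {..<n}) = (alt n (beads n mu) :: 'a power_series)"
      by (rule alt_cong) simp
    ultimately show ?case by simp
  qed
  finally have eq: "vand n * restr (Suc n) (schur lam) =
      (\<Sum>m\<in>?P. var n ^ (l n + (\<Sum>i<n. l i - 1 - m i)) * (alt n m :: 'a power_series))" .
  have "vand (Suc n) * restr (Suc n) (schur lam :: 'a power_series) =
      (\<Prod>j<n. var j - var n) * (\<Sum>m\<in>?P. var n ^ (l n + (\<Sum>i<n. l i - 1 - m i)) * alt n m)"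
    unfolding vand_Suc eq[symmetric] by (simp only: mult_ac)
  also have "\<dots> = alt (Suc n) l"
    by (rule alt_Suc[symmetric]) (use beads_decreasing[OF lam] in \<open>auto simp: l_def intro!: less_imp_le\<close>)
  finally show ?case by (simp add: l_def)
qed

lemma beads_inject:
  assumes "is_partition lam" "is_partition mu" "lookup lam n = 0" "lookup mu n = 0"
    and "\<And>i. i < n \<Longrightarrow> beads n lam i = beads n mu i"
  shows "lam = mu"
proof (rule poly_mapping_eqI)
  fix i show "lookup lam i = lookup mu i"
    using assms(3,4) assms(5)[of i] partition_antimono[OF assms(1), of n i]
      partition_antimono[OF assms(2), of n i]
    by (cases "i < n") (auto simp: beads_def)
qed

text \<open>For \<open>n\<close> at least the number of parts of \<open>\<lambda>\<close>, this functional extracts the coefficient of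
  \<open>s\<^sub>\<lambda>\<close> from a linear combination of Schur functions.\<close>

definition schur_coeff :: "(nat \<Rightarrow>\<^sub>0 nat) \<Rightarrow> 'a::comm_ring_1 power_series \<Rightarrow> 'a" where
  "schur_coeff lam f = (let n = (LEAST n. lookup lam n = 0) in
     coeff (vand n * restr n f) (of_fun n (beads n lam)))"

lemma schur_coeff_sum: "schur_coeff lam (sum f A) = (\<Sum>x\<in>A. schur_coeff lam (f x))"
  by (simp add: schur_coeff_def Let_def restr_sum sum_distrib_left)

lemma schur_coeff_scale: "schur_coeff lam (scale c f) = c * schur_coeff lam f"
  by (simp add: schur_coeff_def Let_def restr_scale scale_mult_right)

text \<open>With n the number of parts of lam, a mu with more parts restricts to 0 and differs from
  lam. Any other mu gives an alternant whose beads agree with those of lam only for mu =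
  lam.\<close>

lemma schur_coeff_schur:
  assumes "is_partition lam" "is_partition mu"
  shows "schur_coeff lam (schur mu) = (if lam = mu then 1 else 0)"
proof -
  define n where "n = (LEAST n. lookup lam n = 0)"
  obtain m where "keys lam \<subseteq> {..<m}"
    using keys_bounded by blast
  then have "lookup lam m = 0" by (auto simp: in_keys_iff subset_iff)
  then have n: "lookup lam n = 0" unfolding n_def by (rule LeastI)
  show ?thesis
  proof (cases "lookup mu n = 0")
    case True
    have "(\<forall>i<n. beads n mu i = beads n lam i) \<longleftrightarrow> lam = mu"
      using beads_inject[OF assms n True] by auto
    then show ?thesis
      unfolding schur_coeff_def Let_def n_def[symmetric] vand_mult_schur[OF assms(2) True]
      by (subst coeff_alt_decreasing) (simp_all add: beads_decreasing assms)
  next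
    case False
    then show ?thesis using n
      by (auto simp: schur_coeff_def Let_def restr_schur_eq_0[OF assms(2)] simp flip: n_def)
  qed
qed

lemma add_self_cancel_series:
  fixes f g :: "'a :: {idom, ring_char_0} power_series"
  shows "f + f = g + g \<Longrightarrow> f = g"
  using series_add_self_eq_0[of "f - g"] by (simp add: algebra_simps)

text \<open>Reindexing shows that the whole sum is its own negative, so fixed points of the
  involution are covered as well.\<close>

lemma sum_sign_reversing:
  fixes f :: "'b \<Rightarrow> 'a :: {idom, ring_char_0} power_series"
  assumes "\<And>x. x \<in> A \<Longrightarrow> \<phi> x \<in> A" "\<And>x. x \<in> A \<Longrightarrow> \<phi> (\<phi> x) = x" "\<And>x. x \<in> A \<Longrightarrow> f (\<phi> x) = - f x"
  shows "sum f A = 0"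
proof (rule series_add_self_eq_0)
  have "sum f A = (\<Sum>x\<in>A. f (\<phi> x))"
    by (rule sum.reindex_bij_witness[of _ \<phi> \<phi>]) (use assms in auto)
  also have "\<dots> = - sum f A" by (simp add: assms(3) sum_negf)
  finally show "sum f A + sum f A = 0" by simp
qed

section \<open>Pieri's rule\<close>

lemma restr_complete_hom:
  "restr n (complete_hom r) = (\<Sum>\<beta> | keys \<beta> \<subseteq> {..<n} \<and> weight \<beta> = r. mon \<beta>)"
  and finite_exponents: "finite {\<beta>. keys \<beta> \<subseteq> {..<n} \<and> weight \<beta> = r}"
proof -
  have *: "\<beta> \<in> of_fun n ` PiE {..<n} (\<lambda>_. {..r})" if "keys \<beta> \<subseteq> {..<n}" "weight \<beta> = r" for \<beta>
  proof -
    have "lookup \<beta> i \<le> r" if "i < n" for i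
      using member_le_sum[of i "{..<n}" "lookup \<beta>"] that weight_eq_sum[OF \<open>keys \<beta> \<subseteq> {..<n}\<close>] \<open>weight \<beta> = r\<close> by simp
    then have "restrict (lookup \<beta>) {..<n} \<in> PiE {..<n} (\<lambda>_. {..r})" by auto
    moreover have "\<beta> = of_fun n (restrict (lookup \<beta>) {..<n})"
      by (rule poly_mapping_eqI) (use that in \<open>auto simp: in_keys_iff\<close>)
    ultimately show ?thesis by blast
  qed
  have "finite (of_fun n ` PiE {..<n} (\<lambda>_. {..r}))" by (intro finite_imageI finite_PiE) auto
  then show fin: "finite {\<beta>. keys \<beta> \<subseteq> {..<n} \<and> weight \<beta> = r}"
    by (rule finite_subset[rotated]) (use * in blast)
  show "restr n (complete_hom r) = (\<Sum>\<beta> | keys \<beta> \<subseteq> {..<n} \<and> weight \<beta> = r. mon \<beta>)"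
    by (rule series_eqI) (use fin in \<open>simp add: coeff_restr complete_hom_def coeff_mon\<close>)
qed

text \<open>For a fixed permutation p, multiplying by a monomial \<beta> raises the exponent of row
  i by \<open>lookup \<beta> (p i)\<close>. The resulting set \<open>?V\<close> of exponent vectors
  is the same for all p, so the signed sums over p reassemble to alternants.\<close>

lemma complete_hom_mult_alt:
  fixes l :: "nat \<Rightarrow> nat"
  shows "restr n (complete_hom r) * (alt n l :: 'a::comm_ring_1 power_series) =
    (\<Sum>v\<in>{v \<in> extensional {..<n}. (\<forall>i<n. l i \<le> v i) \<and> (\<Sum>i<n. v i) = (\<Sum>i<n. l i) + r}. alt n v)"
    (is "_ = (\<Sum>v\<in>?V. _)")
proof -
  let ?B = "{\<beta>. keys \<beta> \<subseteq> {..<n} \<and> weight \<beta> = r}"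
  have "restr n (complete_hom r) * (\<Prod>i<n. var (p i) ^ l i) =
      (\<Sum>v\<in>?V. \<Prod>i<n. var (p i) ^ v i :: 'a power_series)"
    if p: "p permutes {..<n}" for p
  proof -
    let ?q = "inv_into UNIV p"
    have pn: "p i < n \<longleftrightarrow> i < n" for i using permutes_in_image[OF p, of i] by simp
    have qn: "?q i < n \<longleftrightarrow> i < n" for i using permutes_in_image[OF permutes_inv[OF p], of i] by simp
    have pq: "p (?q i) = i" "?q (p i) = i" for i using permutes_inverses[OF p] by auto
    have "restr n (complete_hom r) * (\<Prod>i<n. var (p i) ^ l i :: 'a power_series) =
       (\<Sum>\<beta>\<in>?B. mon (\<beta> + of_fun n (\<lambda>j. l (?q j))))"
      by (simp add: restr_complete_hom prod_var_permuted[OF p] sum_distrib_right mon_mult)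
    also have "\<dots> = (\<Sum>v\<in>?V. mon (of_fun n (\<lambda>j. v (?q j))))"
    proof (rule sum.reindex_bij_witness[where
        i = "\<lambda>v. of_fun n (\<lambda>j. v (?q j) - l (?q j))" and
        j = "\<lambda>\<beta>. restrict (\<lambda>i. l i + lookup \<beta> (p i)) {..<n}"], goal_cases)
      case (1 \<beta>)
      then show ?case by (intro poly_mapping_eqI) (auto simp: qn pq in_keys_iff subset_iff)
    next
      case (2 \<beta>)
      have "(\<Sum>i<n. lookup \<beta> (p i)) = (\<Sum>i<n. lookup \<beta> i)"
        using sum.permute[OF p, of "lookup \<beta>"] by (simp add: comp_def)
      also have "\<dots> = r" using 2 weight_eq_sum[of \<beta> "{..<n}"] by simp
      finally show ?case by (simp add: sum.distrib)
    next
      case (3 v)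
      then show ?case by (auto simp: qn pn pq extensional_def restrict_def fun_eq_iff)
    next
      case (4 v)
      have "(\<Sum>j<n. v (?q j) - l (?q j)) = (\<Sum>i<n. v i - l i)"
        using sum.permute[OF permutes_inv[OF p], of "\<lambda>i. v i - l i"] by (simp add: comp_def)
      also have "\<dots> = (\<Sum>i<n. v i) - (\<Sum>i<n. l i)" using 4 by (intro sum_subtractf_nat) auto
      also have "\<dots> = r" using 4 by simp
      finally show ?case using keys_of_fun by (simp add: weight_of_fun)
    next
      case (5 \<beta>)
      have "of_fun n (\<lambda>j. restrict (\<lambda>i. l i + lookup \<beta> (p i)) {..<n} (?q j)) = \<beta> + of_fun n (\<lambda>j. l (?q j))"
        by (rule poly_mapping_eqI) (use 5 in \<open>auto simp: lookup_add qn pq in_keys_iff subset_iff\<close>)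
      then show ?case by simp
    qed
    finally show ?thesis by (simp add: prod_var_permuted[OF p])
  qed
  then have "restr n (complete_hom r) * (alt n l :: 'a power_series) =
      (\<Sum>p | p permutes {..<n}. of_int (sign p) * (\<Sum>v\<in>?V. \<Prod>i<n. var (p i) ^ v i))"
    by (simp add: alt_expand sum_distrib_left mult.left_commute)
  also have "\<dots> = (\<Sum>v\<in>?V. alt n v)"
    unfolding alt_expand sum_distrib_left by (rule sum.swap)
  finally show ?thesis .
qed

text \<open>Exponents violating the interlacing condition cancel in pairs: exchange the values at
  \<open>i\<close> and \<open>i + 1\<close> for the last \<open>i\<close> at which the condition fails. Choosing the last one makes
  this an involution, since the condition at later positions is not affected.\<close>

lemma sum_alt_not_interlacing:
  fixes l :: "nat \<Rightarrow> nat"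
  assumes l: "\<And>i. Suc i < n \<Longrightarrow> l (Suc i) \<le> l i"
  shows "(\<Sum>v\<in>{v \<in> extensional {..<n}. (\<forall>i<n. l i \<le> v i) \<and> (\<Sum>i<n. v i) = N \<and>
      (\<exists>i. Suc i < n \<and> l i \<le> v (Suc i))}. alt n v :: 'a :: {idom, ring_char_0} power_series) = 0"
    (is "sum _ ?B = 0")
proof -
  define I where "I v = {i. Suc i < n \<and> l i \<le> v (Suc i)}" for v :: "nat \<Rightarrow> nat"
  define m where "m v = Max (I v)" for v
  define \<phi> where "\<phi> v = (\<lambda>i. v (transpose (m v) (Suc (m v)) i))" for v :: "nat \<Rightarrow> nat"
  have finI: "finite (I v)" for v by (rule finite_subset[of _ "{..<n}"]) (auto simp: I_def)
  have m: "Suc (m v) < n" "l (m v) \<le> v (Suc (m v))" if "v \<in> ?B" for v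
  proof -
    have "I v \<noteq> {}" using that by (auto simp: I_def)
    then have "m v \<in> I v" unfolding m_def by (rule Max_in[OF finI])
    then show "Suc (m v) < n" "l (m v) \<le> v (Suc (m v))" by (auto simp: I_def)
  qed
  have m\<phi>: "m (\<phi> v) = m v" if v: "v \<in> ?B" for v
    unfolding m_def[of "\<phi> v"]
  proof (rule Max_eqI)
    fix i assume i: "i \<in> I (\<phi> v)"
    show "i \<le> m v"
    proof (rule ccontr)
      assume "\<not> i \<le> m v"
      then have "\<phi> v (Suc i) = v (Suc i)" by (simp add: \<phi>_def transpose_def)
      then have "i \<in> I v" using i by (simp add: I_def)
      then have "i \<le> m v" unfolding m_def by (intro Max_ge finI)
      with \<open>\<not> i \<le> m v\<close> show False by simp
    qed
  next
    have "\<phi> v (Suc (m v)) = v (m v)" by (simp add: \<phi>_def transpose_def)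
    then show "m v \<in> I (\<phi> v)" using m[OF v] v by (simp add: I_def)
  qed (rule finI)
  show ?thesis
  proof (rule sum_sign_reversing[of _ \<phi>])
    fix v assume v: "v \<in> ?B"
    note mv = m[OF v]
    have p: "transpose (m v) (Suc (m v)) permutes {..<n}"
      using mv by (intro permutes_swap_id) auto
    have pn: "transpose (m v) (Suc (m v)) i < n \<longleftrightarrow> i < n" for i
      using permutes_in_image[OF p, of i] by simp
    have "l i \<le> \<phi> v i" if "i < n" for i
    proof -
      consider "i = m v" | "i = Suc (m v)" | "i \<noteq> m v" "i \<noteq> Suc (m v)" by blast
      then show ?thesis
      proof cases
        case 2
        have "l (Suc (m v)) \<le> l (m v)" by (rule l) (rule mv)
        also have "\<dots> \<le> v (m v)" using v mv by simp
        finally show ?thesis using 2 by (simp add: \<phi>_def)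
      qed (use mv v that in \<open>auto simp: \<phi>_def\<close>)
    qed
    moreover have "(\<Sum>i<n. \<phi> v i) = (\<Sum>i<n. v i)"
      using sum.permute[OF p, of v] by (simp add: \<phi>_def comp_def)
    moreover have "\<phi> v \<in> extensional {..<n}"
      using v pn by (auto simp: \<phi>_def extensional_def)
    moreover have "Suc (m v) < n \<and> l (m v) \<le> \<phi> v (Suc (m v))"
      using mv v by (simp add: \<phi>_def)
    ultimately show "\<phi> v \<in> ?B" using v by auto
    show "\<phi> (\<phi> v) = v"
      unfolding \<phi>_def[of "\<phi> v"] m\<phi>[OF v] by (simp add: \<phi>_def)
    show "alt n (\<phi> v) = (- alt n v :: 'a power_series)"
      unfolding \<phi>_def using mv by (intro alt_swap) auto
  qed
qed

text \<open>The nonzero parts occupy an initial segment of rows and each is at least 1, so the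
  weight bounds their number.\<close>

lemma finite_partitions: "finite {mu. is_partition mu \<and> weight mu = d}"
proof (rule finite_subset)
  have "i < Suc (weight mu)" if mu: "is_partition mu" "i \<in> keys mu" for mu i
  proof (rule ccontr)
    assume i: "\<not> i < Suc (weight mu)"
    have "{..i} \<subseteq> keys mu"
      using mu(2) partition_antimono[OF mu(1), of _ i] by (force simp: in_keys_iff)
    then have "card {..i} \<le> card (keys mu)" by (intro card_mono) auto
    also have "\<dots> \<le> weight mu"
      unfolding weight_def card_eq_sum by (rule sum_mono) (simp add: in_keys_iff)
    finally show False using i by simp
  qed
  then show "{mu. is_partition mu \<and> weight mu = d} \<subseteq> {mu. keys mu \<subseteq> {..<Suc d} \<and> weight mu = d}"
    by blast
qed (rule finite_exponents)

lemma sum_beads: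
  assumes "is_partition lam" "lookup lam n = 0"
  shows "(\<Sum>i<n. beads n lam i) = weight lam + (\<Sum>i<n. n - 1 - i)"
  using weight_eq_sum[OF partition_keys[OF assms]] unfolding beads_def sum.distrib by simp

text \<open>In n variables the exponents that survive the cancellation satisfy v (i + 1) < l i \<le>
  v i. In particular they decrease, so they are the beads of a partition, and the inequalities say
  that it exceeds lam by a horizontal strip.\<close>

theorem pieri:
  assumes lam: "is_partition lam"
  shows "complete_hom r * schur lam =
    (\<Sum>mu | is_partition mu \<and> horizontal_strip mu lam \<and> weight mu = weight lam + r.
       schur mu :: 'a :: {idom, ring_char_0} power_series)"
    (is "_ = sum _ ?M")
proof -
  have finM: "finite ?M"
    by (rule finite_subset[OF _ finite_partitions[of "weight lam + r"]]) auto
  obtain n0 where n0: "keys lam \<subseteq> {..<n0}"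
    using keys_bounded by blast
  show ?thesis
  proof (rule restr_eqI)
    fix n assume "n0 \<le> n"
    then have n: "lookup lam n = 0" using n0 by (auto simp: in_keys_iff subset_iff)
    have lam0: "lookup lam i = 0" if "n \<le> i" for i
      using partition_antimono[OF lam that] n by simp
    let ?l = "beads n lam"
    let ?V = "{v \<in> extensional {..<n}. (\<forall>i<n. ?l i \<le> v i) \<and> (\<Sum>i<n. v i) = (\<Sum>i<n. ?l i) + r}"
    let ?G = "{v \<in> ?V. \<not> (\<exists>i. Suc i < n \<and> ?l i \<le> v (Suc i))}"
    let ?B = "{v \<in> extensional {..<n}. (\<forall>i<n. ?l i \<le> v i) \<and> (\<Sum>i<n. v i) = (\<Sum>i<n. ?l i) + r \<and>
      (\<exists>i. Suc i < n \<and> ?l i \<le> v (Suc i))}"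
    have "?V \<subseteq> PiE {..<n} (\<lambda>_. {..(\<Sum>i<n. ?l i) + r})"
    proof
      fix v assume v: "v \<in> ?V"
      have "v i \<le> (\<Sum>i<n. ?l i) + r" if "i < n" for i
        using member_le_sum[of i "{..<n}" v] v that by simp
      then show "v \<in> PiE {..<n} (\<lambda>_. {..(\<Sum>i<n. ?l i) + r})" using v by (auto simp: PiE_def)
    qed
    then have finV: "finite ?V" by (rule finite_subset) (auto intro: finite_PiE)
    have "vand n * restr n (complete_hom r * schur lam) = restr n (complete_hom r) * alt n ?l"
      by (simp add: restr_mult vand_mult_schur[OF lam n, symmetric] mult_ac)
    also have "\<dots> = (\<Sum>v\<in>?V. alt n v)" by (rule complete_hom_mult_alt)
    also have "\<dots> = (\<Sum>v\<in>?G \<union> ?B. alt n v)" by (rule sum.cong) auto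
    also have "\<dots> = (\<Sum>v\<in>?G. alt n v) + (\<Sum>v\<in>?B. alt n v)"
      by (rule sum.union_disjoint) (auto intro: finite_subset[OF _ finV])
    also have "(\<Sum>v\<in>?B. alt n v :: 'a power_series) = 0"
      by (rule sum_alt_not_interlacing) (use beads_decreasing[OF lam] in \<open>auto intro!: less_imp_le\<close>)
    also have "(\<Sum>v\<in>?G. alt n v) = (\<Sum>mu\<in>{mu \<in> ?M. lookup mu n = 0}. alt n (beads n mu))"
    proof (rule sum.reindex_bij_witness[where
        j = "\<lambda>m. of_fun n (\<lambda>i. m i - (n - 1 - i))" and i = "\<lambda>mu. restrict (beads n mu) {..<n}"], goal_cases)
      case (1 v)
      have ge: "n - 1 - i \<le> v i" if "i < n" for i using 1 that by (force simp: beads_def)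
      show ?case
      proof
        fix i show "restrict (beads n (of_fun n (\<lambda>i. v i - (n - 1 - i)))) {..<n} i = v i"
          using ge[of i] 1 by (cases "i < n") (auto simp: beads_def extensional_def)
      qed
    next
      case (2 v)
      define mu where "mu = of_fun n (\<lambda>i. v i - (n - 1 - i))"
      have ge: "lookup lam i \<le> v i - (n - 1 - i) \<and> n - 1 - i \<le> v i" if "i < n" for i
        using 2 that by (force simp: beads_def)
      have lt: "v (Suc i) - (n - 1 - Suc i) \<le> lookup lam i" if "Suc i < n" for i
        using 2 that by (force simp: beads_def)
      have hs: "horizontal_strip mu lam"
        unfolding horizontal_strip_def
      proof (intro allI conjI)
        fix i
        show "lookup lam i \<le> lookup mu i" using ge[of i] lam0[of i] by (cases "i < n") (auto simp: mu_def)
        show "lookup mu (Suc i) \<le> lookup lam i" using lt[of i] by (cases "Suc i < n") (auto simp: mu_def)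
      qed
      have mu: "is_partition mu"
      proof (rule is_partition_SucI)
        fix i show "lookup mu (Suc i) \<le> lookup mu i"
          using hs by (meson horizontal_strip_def order_trans)
      qed
      have mun: "lookup mu n = 0" by (simp add: mu_def)
      have "beads n mu i = v i" if "i < n" for i using ge[OF that] that by (auto simp: beads_def mu_def)
      then have "(\<Sum>i<n. beads n mu i) = (\<Sum>i<n. v i)"
        by simp
      then have "weight mu = weight lam + r"
        using 2 by (simp add: sum_beads[OF lam n] sum_beads[OF mu mun])
      then show ?case using hs mu mun by (simp add: mu_def)
    next
      case (3 mu)
      then have "keys mu \<subseteq> {..<n}" by (intro partition_keys) auto
      then show ?case by (intro poly_mapping_eqI) (auto simp: beads_def in_keys_iff subset_iff)
    next
      case (4 mu)
      then have mu: "is_partition mu" "lookup mu n = 0" "weight mu = weight lam + r" by auto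
      have hs: "lookup lam i \<le> lookup mu i" "lookup mu (Suc i) \<le> lookup lam i" for i
        using 4 by (auto simp: horizontal_strip_def)
      have "(\<Sum>i<n. beads n mu i) = (\<Sum>i<n. ?l i) + r"
        by (simp add: sum_beads[OF lam n] sum_beads[OF mu(1,2)] mu(3))
      moreover have "\<not> ?l i \<le> beads n mu (Suc i)" if "Suc i < n" for i
        using hs[of i] that by (simp add: beads_def)
      moreover have "?l i \<le> beads n mu i" for i using hs by (simp add: beads_def)
      ultimately show ?case by simp
    next
      case (5 v)
      have ge: "n - 1 - i \<le> v i" if "i < n" for i using 5 that by (force simp: beads_def)
      have "beads n (of_fun n (\<lambda>i. v i - (n - 1 - i))) i = v i" if "i < n" for i
        using ge[OF that] that by (auto simp: beads_def)
      then show ?case by (intro alt_cong) simp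
    qed
    also have "\<dots> = (\<Sum>mu\<in>?M. vand n * restr n (schur mu))"
    proof (rule sum.mono_neutral_cong_left, goal_cases)
      case 3
      then show ?case by (auto simp: restr_schur_eq_0)
    next
      case (4 mu)
      then show ?case by (simp add: vand_mult_schur)
    qed (use finM in auto)
    finally have "vand n * restr n (complete_hom r * schur lam) = vand n * restr n (\<Sum>mu\<in>?M. schur mu :: 'a power_series)"
      by (simp add: restr_sum sum_distrib_left)
    then show "restr n (complete_hom r * schur lam) = restr n (\<Sum>mu\<in>?M. schur mu :: 'a power_series)"
      by (rule vand_mult_cancel)
  qed
qed

lemma complete_hom_0: "complete_hom 0 = 1"
proof (rule series_eqI)
  fix \<alpha> :: "nat \<Rightarrow>\<^sub>0 nat"
  have "weight \<alpha> = 0 \<longleftrightarrow> \<alpha> = 0"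
    by (auto simp: weight_def in_keys_iff intro!: poly_mapping_eqI)
  then show "coeff (complete_hom 0) \<alpha> = (coeff 1 \<alpha> :: 'a)"
    by (simp add: complete_hom_def coeff_1)
qed

lemma complete_sym_eq_prod:
  assumes "keys \<alpha> \<subseteq> A" "finite A"
  shows "complete_sym \<alpha> = (\<Prod>i\<in>A. complete_hom (lookup \<alpha> i))"
  unfolding complete_sym_def
  by (rule prod.mono_neutral_left) (use assms in \<open>auto simp: in_keys_iff complete_hom_0\<close>)

text \<open>Splitting off the last factor on the left invokes Pieri's rule, splitting off the last
  entry on the right invokes the branching rule, and both sum over the same horizontal
  strips.\<close>

theorem complete_sym_eq_sum_schur:
  "complete_sym \<alpha> = (\<Sum>lam | is_partition lam \<and> weight lam = weight \<alpha>.
     scale (of_nat (kostka lam \<alpha>)) (schur lam) :: 'a :: {idom, ring_char_0} power_series)"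
proof -
  obtain n where "keys \<alpha> \<subseteq> {..<n}"
    using keys_bounded by blast
  then show ?thesis
  proof (induction n arbitrary: \<alpha>)
    case 0
    then have "\<alpha> = 0" by simp
    have "{lam. is_partition lam \<and> weight lam = 0} = {0}"
      by (auto simp: weight_def in_keys_iff is_partition_def antimono_def intro!: poly_mapping_eqI)
    then show ?case by (simp add: \<open>\<alpha> = 0\<close> complete_sym_def kostka_0 schur_0)
  next
    case (Suc n)
    define r where "r = lookup \<alpha> n"
    define \<beta> where "\<beta> = \<alpha> - Poly_Mapping.single n r"
    have \<alpha>: "\<alpha> = \<beta> + Poly_Mapping.single n r"
      by (rule poly_mapping_eqI) (simp add: \<beta>_def r_def lookup_add lookup_minus lookup_single when_def)
    have \<beta>: "keys \<beta> \<subseteq> {..<n}"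
      using Suc.prems by (auto simp: \<beta>_def r_def in_keys_iff lookup_minus lookup_single when_def subset_iff
          less_Suc_eq split: if_splits)
    have w\<alpha>: "weight \<alpha> = weight \<beta> + r" by (simp add: \<alpha> weight_add)
    let ?P = "\<lambda>d. {lam. is_partition lam \<and> weight lam = d}"
    have "complete_sym \<alpha> = complete_sym \<beta> * (complete_hom r :: 'a power_series)"
    proof -
      have "complete_sym \<alpha> = (\<Prod>i<n. complete_hom (lookup \<alpha> i)) * complete_hom r"
        using complete_sym_eq_prod[OF Suc.prems] by (simp add: r_def)
      also have "(\<Prod>i<n. complete_hom (lookup \<alpha> i)) = (\<Prod>i<n. complete_hom (lookup \<beta> i))"
        by (rule prod.cong) (auto simp: \<alpha> lookup_add lookup_single)
      finally show ?thesis using complete_sym_eq_prod[OF \<beta>, where ?'a = 'a] by simp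
    qed
    also have "\<dots> = (\<Sum>mu\<in>?P (weight \<beta>). scale (of_nat (kostka mu \<beta>)) (complete_hom r * schur mu))"
      by (simp add: Suc.IH[OF \<beta>] sum_distrib_left scale_mult_right mult.commute)
    also have "\<dots> = (\<Sum>mu\<in>?P (weight \<beta>). \<Sum>lam\<in>{lam\<in>?P (weight \<alpha>). horizontal_strip lam mu}.
        scale (of_nat (kostka mu \<beta>)) (schur lam))"
    proof (rule sum.cong[OF refl])
      fix mu assume mu: "mu \<in> ?P (weight \<beta>)"
      then have "{lam\<in>?P (weight \<alpha>). horizontal_strip lam mu} =
          {lam. is_partition lam \<and> horizontal_strip lam mu \<and> weight lam = weight mu + r}"
        by (auto simp: w\<alpha>)
      then show "scale (of_nat (kostka mu \<beta>)) (complete_hom r * schur mu :: 'a power_series) =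
        (\<Sum>lam\<in>{lam\<in>?P (weight \<alpha>). horizontal_strip lam mu}. scale (of_nat (kostka mu \<beta>)) (schur lam))"
        using mu by (simp add: pieri scale_sum)
    qed
    also have "\<dots> = (\<Sum>lam\<in>?P (weight \<alpha>). \<Sum>mu\<in>{mu\<in>?P (weight \<beta>). horizontal_strip lam mu}.
        scale (of_nat (kostka mu \<beta>)) (schur lam))"
      by (rule sum.swap_restrict) (rule finite_partitions)+
    also have "\<dots> = (\<Sum>lam\<in>?P (weight \<alpha>). scale (of_nat (kostka lam \<alpha>)) (schur lam))"
    proof (rule sum.cong[OF refl])
      fix lam assume lam: "lam \<in> ?P (weight \<alpha>)"
      then have "{mu\<in>?P (weight \<beta>). horizontal_strip lam mu} =
          {mu. horizontal_strip lam mu \<and> weight lam = weight mu + r}"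
        by (auto simp: w\<alpha> dest: horizontal_strip_partition)
      moreover have "kostka lam \<alpha> = (\<Sum>mu | horizontal_strip lam mu \<and> weight lam = weight mu + r. kostka mu \<beta>)"
        unfolding \<alpha> using lam by (intro kostka_branching \<beta>) auto
      ultimately show "(\<Sum>mu\<in>{mu\<in>?P (weight \<beta>). horizontal_strip lam mu}.
        scale (of_nat (kostka mu \<beta>)) (schur lam)) = scale (of_nat (kostka lam \<alpha>)) (schur lam :: 'a power_series)"
        by (simp add: scale_sum_left)
    qed
    finally show ?case .
  qed
qed

section \<open>The derivation on alternants\<close>

text \<open>In the term of p, variable p i has exponent \<open>l i\<close>. The factor produced by
  the Euler derivation thus belongs to row i for every p and leaves the sum over
  permutations.\<close>

lemma Dn_alt:
  fixes l :: "nat \<Rightarrow> nat"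
  shows "Dn n k (alt n l :: 'a::comm_ring_1 power_series) = (\<Sum>i<n. of_nat (l i) * alt n (l(i := l i + k)))"
proof -
  have "Dn n k (alt n l :: 'a power_series) = (\<Sum>p | p permutes {..<n}. \<Sum>i<n.
      of_nat (l i) * (of_int (sign p) * (\<Prod>j<n. var (p j) ^ (l(i := l i + k)) j)))"
    unfolding alt_expand Dn_sum Dn_of_int_mult
  proof (rule sum.cong[OF refl])
    fix p assume "p \<in> {p. p permutes {..<n}}"
    then have p: "p i < n" if "i < n" for i using that permutes_in_image[of p "{..<n}" i] by simp
    have "Dn n k (\<Prod>i<n. var (p i) ^ l i :: 'a power_series) =
        (\<Sum>i<n. of_nat (l i) * var (p i) ^ k) * (\<Prod>i<n. var (p i) ^ l i)"
      by (rule Dn_prod) (use p in \<open>auto simp: Dn_var_power power_add mult_ac\<close>)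
    also have "\<dots> = (\<Sum>i<n. of_nat (l i) * (\<Prod>j<n. var (p j) ^ (l(i := l i + k)) j))"
      unfolding sum_distrib_right
    proof (rule sum.cong[OF refl])
      fix i assume "i \<in> {..<n}"
      then have "(\<Prod>j<n. var (p j) ^ (l(i := l i + k)) j) =
          var (p i) ^ k * (\<Prod>j<n. var (p j) ^ l j :: 'a power_series)"
        by (subst (1 2) prod.remove[of _ i]) (auto simp: power_add mult_ac intro!: prod.cong)
      then show "of_nat (l i) * var (p i) ^ k * (\<Prod>i<n. var (p i) ^ l i :: 'a power_series) =
          of_nat (l i) * (\<Prod>j<n. var (p j) ^ (l(i := l i + k)) j)"
        by (simp only: mult.assoc)
    qed
    finally show "of_int (sign p) * Dn n k (\<Prod>i<n. var (p i) ^ l i :: 'a power_series) = (\<Sum>i<n.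
      of_nat (l i) * (of_int (sign p) * (\<Prod>j<n. var (p j) ^ (l(i := l i + k)) j)))"
      by (simp add: sum_distrib_left mult_ac)
  qed
  also have "\<dots> = (\<Sum>i<n. of_nat (l i) * alt n (l(i := l i + k)))"
    unfolding alt_expand sum_distrib_left by (rule sum.swap)
  finally show ?thesis .
qed

text \<open>The logarithmic derivative of \<open>vand n\<close> under \<open>Dn n k\<close>: each
  factor x_i - x_j becomes x_i^(k+1) - x_j^(k+1), whose quotient by x_i - x_j is the complete
  homogeneous polynomial of degree k in two variables.\<close>

definition pair_sum :: "nat \<Rightarrow> nat \<Rightarrow> 'a::comm_ring_1 power_series" where
  "pair_sum n k = (\<Sum>j<n. \<Sum>i<j. \<Sum>a\<le>k. var i ^ a * var j ^ (k - a))"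

lemma Dn_vand: "Dn n k (vand n :: 'a::comm_ring_1 power_series) = pair_sum n k * vand n"
  unfolding vand_def pair_sum_def
proof (rule Dn_prod)
  fix j assume j: "j \<in> {..<n}"
  show "Dn n k (\<Prod>i<j. var i - var j :: 'a power_series) =
      (\<Sum>i<j. \<Sum>a\<le>k. var i ^ a * var j ^ (k - a)) * (\<Prod>i<j. var i - var j)"
  proof (rule Dn_prod)
    fix i assume "i \<in> {..<j}"
    then have "Dn n k (var i - var j :: 'a power_series) = var i ^ Suc k - var j ^ Suc k"
      using j Dn_var_power[of i n k 1, where ?'a = 'a] Dn_var_power[of j n k 1, where ?'a = 'a]
      by (simp add: Dn_diff)
    then show "Dn n k (var i - var j :: 'a power_series) = (\<Sum>a\<le>k. var i ^ a * var j ^ (k - a)) * (var i - var j)"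
      by (simp only: diff_power_eq_sum lessThan_Suc_atMost mult.commute)
  qed simp
qed simp

lemma sum_pairs_eq:
  fixes g :: "nat \<Rightarrow> nat \<Rightarrow> 'a::comm_monoid_add"
  shows "(\<Sum>j<n. \<Sum>i<j. g i j) + (\<Sum>j<n. \<Sum>i<j. g j i) = (\<Sum>i<n. \<Sum>j\<in>{..<n} - {i}. g i j)"
proof -
  have "(\<Sum>j<n. \<Sum>i<j. g i j) = (\<Sum>j<n. \<Sum>i\<in>{i\<in>{..<n}. i < j}. g i j)"
    by (intro sum.cong) auto
  also have "\<dots> = (\<Sum>i<n. \<Sum>j\<in>{j\<in>{..<n}. i < j}. g i j)"
    by (rule sum.swap_restrict) auto
  finally have "(\<Sum>j<n. \<Sum>i<j. g i j) + (\<Sum>i<n. \<Sum>j<i. g i j) =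
      (\<Sum>i<n. (\<Sum>j\<in>{j\<in>{..<n}. i < j}. g i j) + (\<Sum>j<i. g i j))"
    by (simp add: sum.distrib)
  also have "\<dots> = (\<Sum>i<n. \<Sum>j\<in>{..<n} - {i}. g i j)"
  proof (rule sum.cong[OF refl])
    fix i assume "i \<in> {..<n}"
    then have "{..<n} - {i} = {j\<in>{..<n}. i < j} \<union> {..<i}" by auto
    moreover have "(\<Sum>j\<in>{j\<in>{..<n}. i < j} \<union> {..<i}. g i j) = (\<Sum>j\<in>{j\<in>{..<n}. i < j}. g i j) + (\<Sum>j<i. g i j)"
      by (rule sum.union_disjoint) auto
    ultimately show "(\<Sum>j\<in>{j\<in>{..<n}. i < j}. g i j) + (\<Sum>j<i. g i j) = (\<Sum>j\<in>{..<n} - {i}. g i j)" by simp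
  qed
  finally show ?thesis .
qed

text \<open>The product is symmetric in \<open>i\<close> and \<open>j\<close>, so it is computed for ordered pairs and
  divided by two.\<close>

lemma pair_sum_mult_alt:
  fixes l :: "nat \<Rightarrow> nat"
  shows "pair_sum n k * alt n l =
    (\<Sum>j<n. \<Sum>i<j. \<Sum>a\<le>k. alt n (l(i := l i + a, j := l j + (k - a))) :: 'a :: {idom, ring_char_0} power_series)"
proof (rule add_self_cancel_series)
  define q :: "nat \<Rightarrow> nat \<Rightarrow> 'a power_series" where "q i j = (\<Sum>a\<le>k. var i ^ a * var j ^ (k - a))" for i j
  define h :: "nat \<Rightarrow> nat \<Rightarrow> 'a power_series" where "h i j = (\<Sum>a\<le>k. alt n (l(i := l i + a, j := l j + (k - a))))" for i j
  have q: "q i j = q j i" for i j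
    unfolding q_def by (rule sum.reindex_bij_witness[of _ "\<lambda>a. k - a" "\<lambda>a. k - a"]) (auto simp: mult.commute)
  have h: "h i j = h j i" if "i \<noteq> j" for i j
    unfolding h_def
    by (rule sum.reindex_bij_witness[of _ "\<lambda>a. k - a" "\<lambda>a. k - a"]) (use that in \<open>auto simp: fun_upd_twist\<close>)
  have "pair_sum n k * alt n l + pair_sum n k * (alt n l :: 'a power_series) = (\<Sum>i<n. \<Sum>j\<in>{..<n} - {i}. q i j) * alt n l"
  proof -
    have "pair_sum n k = (\<Sum>j<n. \<Sum>i<j. q i j)" by (simp add: pair_sum_def q_def)
    moreover from this have "pair_sum n k = (\<Sum>j<n. \<Sum>i<j. q j i)" by (simp add: q)
    ultimately have "pair_sum n k + pair_sum n k = (\<Sum>i<n. \<Sum>j\<in>{..<n} - {i}. q i j)"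
      using sum_pairs_eq[of q n] by simp
    then show ?thesis by (metis distrib_right)
  qed
  also have "\<dots> = (\<Sum>p | p permutes {..<n}. of_int (sign p) *
      ((\<Sum>i<n. \<Sum>j\<in>{..<n} - {i}. q i j) * (\<Prod>i<n. var (p i) ^ l i)))"
    unfolding alt_expand by (simp add: sum_distrib_left mult_ac)
  also have "\<dots> = (\<Sum>p | p permutes {..<n}. \<Sum>i<n. \<Sum>j\<in>{..<n} - {i}. \<Sum>a\<le>k. of_int (sign p) *
      (\<Prod>m<n. var (p m) ^ (l(i := l i + a, j := l j + (k - a))) m))"
  proof (rule sum.cong[OF refl])
    fix p assume "p \<in> {p. p permutes {..<n}}"
    then have p: "p permutes {..<n}" by simp
    \<comment> \<open>Reindexing along p makes the factor act on the variables of rows i and j.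
      Permutations act on ordered pairs but do not respect i < j, hence the doubled sum.\<close>
    have "(\<Sum>i<n. \<Sum>j\<in>{..<n} - {i}. q i j) = (\<Sum>i<n. \<Sum>j\<in>{..<n} - {p i}. q (p i) j)"
      using sum.permute[OF p, of "\<lambda>i. \<Sum>j\<in>{..<n} - {i}. q i j"] by (simp add: comp_def)
    also have "\<dots> = (\<Sum>i<n. \<Sum>j\<in>{..<n} - {i}. q (p i) (p j))"
    proof (rule sum.cong[OF refl])
      fix i assume "i \<in> {..<n}"
      then have "bij_betw p ({..<n} - {i}) ({..<n} - {p i})"
        using permutes_imp_bij[OF p] by (intro bij_betw_DiffI) (auto simp: bij_betw_def)
      then show "(\<Sum>j\<in>{..<n} - {p i}. q (p i) j) = (\<Sum>j\<in>{..<n} - {i}. q (p i) (p j))"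
        by (rule sum.reindex_bij_betw[symmetric])
    qed
    finally have "(\<Sum>i<n. \<Sum>j\<in>{..<n} - {i}. q i j) * (\<Prod>i<n. var (p i) ^ l i) =
        (\<Sum>i<n. \<Sum>j\<in>{..<n} - {i}. \<Sum>a\<le>k. var (p i) ^ a * var (p j) ^ (k - a) * (\<Prod>i<n. var (p i) ^ l i))"
      by (simp add: q_def sum_distrib_right)
    also have "\<dots> = (\<Sum>i<n. \<Sum>j\<in>{..<n} - {i}. \<Sum>a\<le>k.
        \<Prod>m<n. var (p m) ^ (l(i := l i + a, j := l j + (k - a))) m)"
    proof (intro sum.cong[OF refl])
      fix i j a assume "i \<in> {..<n}" "j \<in> {..<n} - {i}"
      then have ij: "i < n" "j < n" "i \<noteq> j" by auto
      have "(\<Prod>m<n. var (p m) ^ (l(i := l i + a, j := l j + (k - a))) m) =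
          (\<Prod>m<n. (if m = i then var (p i) ^ a else 1) * (if m = j then var (p j) ^ (k - a) else 1) * var (p m) ^ l m)"
        by (rule prod.cong) (use ij in \<open>auto simp: power_add\<close>)
      also have "\<dots> = var (p i) ^ a * var (p j) ^ (k - a) * (\<Prod>i<n. var (p i) ^ l i)"
        using ij by (simp add: prod.distrib prod.delta)
      finally show "var (p i) ^ a * var (p j) ^ (k - a) * (\<Prod>i<n. var (p i) ^ l i) =
          (\<Prod>m<n. var (p m) ^ (l(i := l i + a, j := l j + (k - a))) m)" ..
    qed
    finally show "of_int (sign p) * ((\<Sum>i<n. \<Sum>j\<in>{..<n} - {i}. q i j) * (\<Prod>i<n. var (p i) ^ l i)) =
        (\<Sum>i<n. \<Sum>j\<in>{..<n} - {i}. \<Sum>a\<le>k. of_int (sign p) *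
          (\<Prod>m<n. var (p m) ^ (l(i := l i + a, j := l j + (k - a))) m))"
      by (simp add: sum_distrib_left)
  qed
  also have "\<dots> = (\<Sum>i<n. \<Sum>p | p permutes {..<n}. \<Sum>j\<in>{..<n} - {i}. \<Sum>a\<le>k. of_int (sign p) *
      (\<Prod>m<n. var (p m) ^ (l(i := l i + a, j := l j + (k - a))) m))"
    by (rule sum.swap)
  also have "\<dots> = (\<Sum>i<n. \<Sum>j\<in>{..<n} - {i}. \<Sum>p | p permutes {..<n}. \<Sum>a\<le>k. of_int (sign p) *
      (\<Prod>m<n. var (p m) ^ (l(i := l i + a, j := l j + (k - a))) m))"
    by (intro sum.cong[OF refl], rule sum.swap)
  also have "\<dots> = (\<Sum>i<n. \<Sum>j\<in>{..<n} - {i}. h i j)"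
    unfolding h_def alt_expand by (intro sum.cong[OF refl], rule sum.swap)
  also have "\<dots> = (\<Sum>j<n. \<Sum>i<j. h i j) + (\<Sum>j<n. \<Sum>i<j. h j i)"
    by (rule sum_pairs_eq[symmetric])
  also have "(\<Sum>j<n. \<Sum>i<j. h j i) = (\<Sum>j<n. \<Sum>i<j. h i j)"
    by (intro sum.cong[OF refl] h) auto
  finally show "pair_sum n k * alt n l + pair_sum n k * alt n l =
    (\<Sum>j<n. \<Sum>i<j. \<Sum>a\<le>k. alt n (l(i := l i + a, j := l j + (k - a)))) +
    (\<Sum>j<n. \<Sum>i<j. \<Sum>a\<le>k. alt n (l(i := l i + a, j := l j + (k - a))) :: 'a power_series)"
    by (simp only: h_def)
qed

text \<open>The substitution \<open>b \<mapsto> l i - l j + k - b\<close> exchanges the two new exponents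
  \<open>l i + (k - b)\<close> and \<open>l j + b\<close>, so the terms with \<open>l i \<le> l j + b\<close> cancel.\<close>

lemma sum_alt_pair:
  fixes l :: "nat \<Rightarrow> nat" and k :: nat
  assumes ij: "i < j" "j < n" and lt: "l j < l i" and k: "0 < k"
  shows "(\<Sum>a\<le>k. alt n (l(i := l i + a, j := l j + (k - a)))) =
    (alt n (l(i := l i + k)) + (if l j + k < l i then alt n (l(j := l j + k)) else 0) +
     (\<Sum>b | 0 < b \<and> b < k \<and> l j + b < l i. alt n (l(i := l i + (k - b), j := l j + b)))
      :: 'a :: {idom, ring_char_0} power_series)"
proof -
  define F :: "nat \<Rightarrow> 'a power_series" where "F b = alt n (l(i := l i + (k - b), j := l j + b))" for b
  have "(\<Sum>a\<le>k. alt n (l(i := l i + a, j := l j + (k - a)))) = (\<Sum>b\<le>k. F b)"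
    unfolding F_def by (rule sum.reindex_bij_witness[of _ "\<lambda>a. k - a" "\<lambda>a. k - a"]) (use ij in auto)
  also have "\<dots> = (\<Sum>b\<in>{b. b \<le> k \<and> l j + b < l i} \<union> {b. b \<le> k \<and> l i \<le> l j + b}. F b)"
    by (rule sum.cong) auto
  also have "\<dots> = (\<Sum>b | b \<le> k \<and> l j + b < l i. F b) + (\<Sum>b | b \<le> k \<and> l i \<le> l j + b. F b)"
    by (rule sum.union_disjoint) auto
  also have "(\<Sum>b | b \<le> k \<and> l i \<le> l j + b. F b) = 0"
  proof (rule sum_sign_reversing[of _ "\<lambda>b. (l i - l j) + k - b"])
    fix b assume b: "b \<in> {b. b \<le> k \<and> l i \<le> l j + b}"
    show "(l i - l j) + k - b \<in> {b. b \<le> k \<and> l i \<le> l j + b}" using b lt by auto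
    show "(l i - l j) + k - ((l i - l j) + k - b) = b" using b by auto
    have "F ((l i - l j) + k - b) = alt n (\<lambda>m. (l(i := l i + (k - b), j := l j + b)) (transpose i j m))"
      unfolding F_def by (rule alt_cong) (use b lt ij in \<open>auto simp: transpose_def\<close>)
    also have "\<dots> = - F b"
      unfolding F_def by (rule alt_swap) (use ij in auto)
    finally show "F ((l i - l j) + k - b) = - F b" .
  qed
  \<comment> \<open>b is the distance moved by bead j. For b = 0 bead i makes the whole move, for b
    = k bead j does and stays below bead i, otherwise both move.\<close>
  also have "(\<Sum>b | b \<le> k \<and> l j + b < l i. F b) = (\<Sum>b\<in>{b. 0 < b \<and> b < k \<and> l j + b < l i} \<union>
      ({0} \<union> (if l j + k < l i then {k} else {})). F b)"
    by (rule sum.cong) (use lt in auto)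
  also have "\<dots> = (\<Sum>b | 0 < b \<and> b < k \<and> l j + b < l i. F b) +
      (\<Sum>b\<in>{0} \<union> (if l j + k < l i then {k} else {}). F b)"
    by (rule sum.union_disjoint) auto
  also have "(\<Sum>b\<in>{0} \<union> (if l j + k < l i then {k} else {}). F b) =
      alt n (l(i := l i + k)) + (if l j + k < l i then alt n (l(j := l j + k)) else 0)"
  proof -
    have "F 0 = alt n (l(i := l i + k))" unfolding F_def by (rule alt_cong) (use ij in auto)
    moreover have "F k = alt n (l(j := l j + k))" unfolding F_def by (rule alt_cong) auto
    ultimately show ?thesis using k by simp
  qed
  finally show ?thesis by (simp only: F_def add.commute add.left_commute add_0_left add_0_right)
qed

text \<open>The full move of bead j has coefficient l j from the Euler derivation, minus n - 1 - j
  for the pairs in which j is the upper bead, minus the number of upper beads it stays below. The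
  first two give the j-th part of lam, so n disappears.\<close>

lemma vand_mult_D_schur:
  assumes lam: "is_partition lam" "lookup lam n = 0" and k: "0 < k"
  defines "l \<equiv> beads n lam"
  shows "vand n * restr n (D k (schur lam)) =
    ((\<Sum>j<n. of_int (int (lookup lam j) - int (card {i. i < j \<and> l j + k < l i})) * alt n (l(j := l j + k))) -
     (\<Sum>j<n. \<Sum>i<j. \<Sum>b | 0 < b \<and> b < k \<and> l j + b < l i. alt n (l(i := l i + (k - b), j := l j + b)))
      :: 'a :: {idom, ring_char_0} power_series)"
proof -
  define A :: "nat \<Rightarrow> 'a power_series" where "A j = alt n (l(j := l j + k))" for j
  define P :: "nat \<Rightarrow> nat \<Rightarrow> 'a power_series" where
    "P i j = (\<Sum>b | 0 < b \<and> b < k \<and> l j + b < l i. alt n (l(i := l i + (k - b), j := l j + b)))" for i j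
  let ?s = "restr n (schur lam) :: 'a power_series"
  have s: "vand n * ?s = alt n l" unfolding l_def by (rule vand_mult_schur[OF lam])
  have "vand n * restr n (D k (schur lam)) = Dn n k (vand n * ?s) - Dn n k (vand n) * ?s"
    by (simp add: restr_D Dn_mult)
  also have "\<dots> = Dn n k (alt n l) - pair_sum n k * alt n l"
    by (simp add: s Dn_vand mult.assoc)
  also have "pair_sum n k * alt n l = (\<Sum>j<n. \<Sum>i<j. A i + (if l j + k < l i then A j else 0) + P i j)"
    unfolding pair_sum_mult_alt A_def P_def
    by (intro sum.cong[OF refl] sum_alt_pair) (use beads_decreasing[OF lam(1)] k in \<open>auto simp: l_def\<close>)
  also have "\<dots> = (\<Sum>j<n. \<Sum>i<j. A i) + (\<Sum>j<n. \<Sum>i<j. if l j + k < l i then A j else 0) + (\<Sum>j<n. \<Sum>i<j. P i j)"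
    by (simp add: sum.distrib)
  also have "(\<Sum>j<n. \<Sum>i<j. A i) = (\<Sum>i<n. of_nat (n - 1 - i) * A i)"
  proof -
    have "(\<Sum>j<n. \<Sum>i<j. A i) = (\<Sum>j<n. \<Sum>i\<in>{i\<in>{..<n}. i < j}. A i)"
      by (intro sum.cong) auto
    also have "\<dots> = (\<Sum>i<n. \<Sum>j\<in>{j\<in>{..<n}. i < j}. A i)"
      by (rule sum.swap_restrict) auto
    also have "\<dots> = (\<Sum>i<n. of_nat (n - 1 - i) * A i)"
    proof (rule sum.cong[OF refl])
      fix i
      have "{j\<in>{..<n}. i < j} = {i<..<n}" by auto
      then show "(\<Sum>j\<in>{j\<in>{..<n}. i < j}. A i) = of_nat (n - 1 - i) * A i" by simp
    qed
    finally show ?thesis .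
  qed
  also have "(\<Sum>j<n. \<Sum>i<j. if l j + k < l i then A j else 0) =
      (\<Sum>j<n. of_nat (card {i. i < j \<and> l j + k < l i}) * A j)"
  proof (rule sum.cong[OF refl])
    fix j
    have "(\<Sum>i<j. if l j + k < l i then A j else 0) = (\<Sum>i\<in>{i. i < j \<and> l j + k < l i}. A j)"
      by (subst sum.inter_filter[symmetric]) (auto intro!: sum.cong)
    then show "(\<Sum>i<j. if l j + k < l i then A j else 0) = of_nat (card {i. i < j \<and> l j + k < l i}) * A j"
      by simp
  qed
  also have "Dn n k (alt n l) = (\<Sum>i<n. of_nat (l i) * A i)"
    unfolding A_def by (rule Dn_alt)
  finally have "vand n * restr n (D k (schur lam)) =
      (\<Sum>j<n. of_nat (l j) * A j - of_nat (n - 1 - j) * A j - of_nat (card {i. i < j \<and> l j + k < l i}) * A j) -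
      (\<Sum>j<n. \<Sum>i<j. P i j)"
    by (simp only: sum_subtractf sum.distrib diff_diff_eq add.assoc)
  also have "(\<Sum>j<n. of_nat (l j) * A j - of_nat (n - 1 - j) * A j - of_nat (card {i. i < j \<and> l j + k < l i}) * A j) =
      (\<Sum>j<n. of_int (int (lookup lam j) - int (card {i. i < j \<and> l j + k < l i})) * A j)"
    unfolding l_def beads_def by (rule sum.cong) (simp_all only: of_nat_add of_int_diff of_int_of_nat_eq ring_distribs, simp)
  finally show ?thesis by (simp add: A_def P_def)
qed

section \<open>Adding border strips\<close>

definition shift_row :: "nat \<Rightarrow> nat \<Rightarrow> (nat \<Rightarrow> nat) \<Rightarrow> nat \<Rightarrow> nat" where
  "shift_row r s v i = (if i = r then v s else if r < i \<and> i \<le> s then v (i - 1) else v i)"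

text \<open>A cycle of length s - r + 1 is a product of s - r adjacent transpositions. The
  permutation is chosen before v, so it serves for alternants and for sums alike.\<close>

lemma shift_row_permutation:
  assumes "r \<le> s" "s < n"
  shows "\<exists>p. p permutes {..<n} \<and> sign p = (-1) ^ (s - r) \<and> (\<forall>v i. shift_row r s v i = v (p i))"
  using assms(1)
proof (induction r rule: inc_induct)
  case base
  show ?case by (intro exI[of _ id] conjI permutes_id) (auto simp: shift_row_def)
next
  case (step r)
  then obtain p where p: "p permutes {..<n}" "sign p = (-1) ^ (s - Suc r)"
    "\<And>v i. shift_row (Suc r) s v i = v (p i)" by auto
  have t: "transpose r (Suc r) permutes {..<n}"
    using step(2) assms(2) by (intro permutes_swap_id) auto
  have "shift_row r s v i = v ((p \<circ> transpose r (Suc r)) i)" for v i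
  proof -
    have "shift_row r s v i = shift_row (Suc r) s v (transpose r (Suc r) i)"
      using step(2) by (auto simp: shift_row_def transpose_def)
    then show ?thesis by (simp add: p(3))
  qed
  moreover have "sign (p \<circ> transpose r (Suc r)) = (-1) ^ (s - r)"
  proof -
    have "sign (p \<circ> transpose r (Suc r)) = sign p * sign (transpose r (Suc r))"
      using p(1) t by (intro sign_compose permutation_permutes[THEN iffD2] exI conjI) auto
    moreover have "s - r = Suc (s - Suc r)" using step(2) by simp
    ultimately show ?thesis by (simp add: p(2) sign_swap_id)
  qed
  ultimately show ?case using permutes_compose[OF t p(1)] by blast
qed

lemma alt_shift_row:
  assumes "r \<le> s" "s < n"
  shows "alt n (shift_row r s v) = (-1) ^ (s - r) * alt n v"
proof -
  obtain p where p: "p permutes {..<n}" "sign p = (-1) ^ (s - r)" "\<And>v i. shift_row r s v i = v (p i)"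
    using shift_row_permutation[OF assms] by blast
  have "alt n (shift_row r s v) = alt n (\<lambda>i. v (p i))" by (rule alt_cong) (rule p)
  then show ?thesis by (simp add: alt_permute[OF p(1)] p(2))
qed

lemma sum_shift_row:
  assumes "r \<le> s" "s < n"
  shows "(\<Sum>i<n. shift_row r s v i) = (\<Sum>i<n. v i)"
proof -
  obtain p where p: "p permutes {..<n}" "\<And>v i. shift_row r s v i = v (p i)"
    using shift_row_permutation[OF assms] by blast
  show ?thesis using sum.permute[OF p(1), of v] by (simp add: p(2) comp_def)
qed

text \<open>\<open>add_strip lam r s b\<close> adds to \<open>lam\<close> a border strip of \<open>b\<close> boxes occupying the rows
  \<open>r, \<dots>, s\<close>; on bead positions, the bead \<open>s\<close> moves up by \<open>b\<close>, passing the beads \<open>r, \<dots>, s - 1\<close>.\<close>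

definition add_strip :: "(nat \<Rightarrow>\<^sub>0 nat) \<Rightarrow> nat \<Rightarrow> nat \<Rightarrow> nat \<Rightarrow> (nat \<Rightarrow>\<^sub>0 nat)" where
  "add_strip lam r s b = Abs_poly_mapping
     (\<lambda>i. if i = r then lookup lam s + b - (s - r) else if r < i \<and> i \<le> s then Suc (lookup lam (i - 1)) else lookup lam i)"

text \<open>In terms of beads: the target l s + b lies strictly between beads r and r - 1. The
  second inequality is not strict because row r - 1 contributes one more staircase step than row
  r.\<close>

definition strip_addable :: "(nat \<Rightarrow>\<^sub>0 nat) \<Rightarrow> nat \<Rightarrow> nat \<Rightarrow> nat \<Rightarrow> bool" where
  "strip_addable lam r s b \<longleftrightarrow> r \<le> s \<and> lookup lam r + (s - r) < lookup lam s + b \<and>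
     (r = 0 \<or> lookup lam s + b \<le> lookup lam (r - 1) + (s - r))"

lemma lookup_add_strip:
  "lookup (add_strip lam r s b) i =
     (if i = r then lookup lam s + b - (s - r) else if r < i \<and> i \<le> s then Suc (lookup lam (i - 1)) else lookup lam i)"
proof -
  let ?f = "\<lambda>i. if i = r then lookup lam s + b - (s - r) else if r < i \<and> i \<le> s then Suc (lookup lam (i - 1)) else lookup lam i"
  have "finite {i. ?f i \<noteq> 0}"
    by (rule finite_subset[of _ "keys lam \<union> {..max r s}"]) (auto simp: in_keys_iff split: if_splits)
  then show ?thesis by (simp add: add_strip_def)
qed

lemma beads_add_strip:
  assumes "strip_addable lam r s b" "s < n" "i < n"
  shows "beads n (add_strip lam r s b) i =
    shift_row r s ((beads n lam)(s := beads n lam s + b)) i"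
  using assms unfolding strip_addable_def beads_def lookup_add_strip shift_row_def
  by auto

section \<open>Rows and overlaps of skew shapes\<close>

definition strip_rows :: "(nat \<Rightarrow>\<^sub>0 nat) \<Rightarrow> (nat \<Rightarrow>\<^sub>0 nat) \<Rightarrow> nat set" where
  "strip_rows lam mu = {i. lookup lam i < lookup mu i}"

text \<open>Rows of the shape that share no column with the row above. Every component has exactly
  one, so they replace the count of components.\<close>

definition strip_tops :: "(nat \<Rightarrow>\<^sub>0 nat) \<Rightarrow> (nat \<Rightarrow>\<^sub>0 nat) \<Rightarrow> nat set" where
  "strip_tops lam mu = {i \<in> strip_rows lam mu. i = 0 \<or> lookup mu i \<le> lookup lam (i - 1)}"

text \<open>Rows i and i + 1 of the shape overlap in the columns from the i-th part of lam up to the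
  end of row i + 1 of mu; at most one common column means no 2x2 block.\<close>

definition thin :: "(nat \<Rightarrow>\<^sub>0 nat) \<Rightarrow> (nat \<Rightarrow>\<^sub>0 nat) \<Rightarrow> bool" where
  "thin lam mu \<longleftrightarrow> (\<forall>i. lookup mu (Suc i) \<le> Suc (lookup lam i))"

lemma finite_strip_rows: "finite (strip_rows lam mu)"
  by (rule finite_subset[of _ "keys mu"]) (auto simp: strip_rows_def in_keys_iff)

lemma finite_strip_tops: "finite (strip_tops lam mu)"
  using finite_strip_rows[of lam mu] by (simp add: strip_tops_def)

text \<open>Each of the rows r + 1 to s ends in the column in which the strip begins one row higher
  (\<open>linked\<close>); all other consecutive rows share no column
  (\<open>unlinked\<close>).\<close>

lemma add_strip_props:
  assumes lam: "is_partition lam" and a: "strip_addable lam r s b"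
  defines "mu \<equiv> add_strip lam r s b"
  shows "is_partition mu" "\<And>i. lookup lam i \<le> lookup mu i" "strip_rows lam mu = {r..s}"
    "strip_tops lam mu = {r}" "thin lam mu"
proof -
  note anti = partition_antimono[OF lam]
  have rs: "r \<le> s" and b1: "lookup lam r + (s - r) < lookup lam s + b"
    and b2: "r = 0 \<or> lookup lam s + b \<le> lookup lam (r - 1) + (s - r)"
    using a by (auto simp: strip_addable_def)
  have mur: "lookup lam r < lookup mu r" "r = 0 \<or> lookup mu r \<le> lookup lam (r - 1)"
    using b1 b2 by (auto simp: mu_def lookup_add_strip)
  have mum: "lookup mu i = Suc (lookup lam (i - 1))" if "r < i" "i \<le> s" for i
    using that by (simp add: mu_def lookup_add_strip)
  have muo: "lookup mu i = lookup lam i" if "i < r \<or> s < i" for i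
    using that rs by (auto simp: mu_def lookup_add_strip)
  have cases: "i < r \<or> s < i \<or> i = r \<or> (r < i \<and> i \<le> s)" for i by auto
  have grow: "lookup lam i < lookup mu i" if "r \<le> i" "i \<le> s" for i
    using that mur(1) mum[of i] anti[of "i - 1" i] by (cases "i = r") auto
  have linked: "lookup mu (Suc i) = Suc (lookup lam i)" if "r \<le> i" "i < s" for i
    using mum[of "Suc i"] that by simp
  have unlinked: "lookup mu (Suc i) \<le> lookup lam i" if "\<not> (r \<le> i \<and> i < s)" for i
    using that mur(2) muo[of "Suc i"] anti[of i "Suc i"] by (cases "Suc i = r") auto
  show ge: "lookup lam i \<le> lookup mu i" for i
    using grow[of i] muo[of i] by (cases "r \<le> i \<and> i \<le> s") auto
  show rows: "strip_rows lam mu = {r..s}"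
    using grow muo unfolding strip_rows_def by (auto simp: not_le[symmetric]) (metis leI less_irrefl)+
  show "strip_tops lam mu = {r}"
  proof -
    have "i = r" if "r \<le> i" "i \<le> s" "i = 0 \<or> lookup mu i \<le> lookup lam (i - 1)" for i
      using that linked[of "i - 1"] by (cases i; cases "i = r") auto
    then show ?thesis unfolding strip_tops_def rows using rs mur(2) by auto
  qed
  show "thin lam mu"
    unfolding thin_def using linked unlinked by (metis le_SucI order_refl)
  show "is_partition mu"
  proof (rule is_partition_SucI)
    fix i show "lookup mu (Suc i) \<le> lookup mu i"
      using linked[of i] unlinked[of i] grow[of i] ge[of i] by (cases "r \<le> i \<and> i < s") auto
  qed
qed

lemma lookup_add_strip_beyond:
  "lookup lam n = 0 \<Longrightarrow> s < n \<Longrightarrow> strip_addable lam r s b \<Longrightarrow> lookup (add_strip lam r s b) n = 0"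
  by (simp add: lookup_add_strip strip_addable_def)

text \<open>The weight is read off from the sum of the beads: one bead grows by b, and reordering
  does not change the sum.\<close>

lemma weight_add_strip:
  assumes lam: "is_partition lam" and a: "strip_addable lam r s b"
  shows "weight (add_strip lam r s b) = weight lam + b"
proof -
  obtain m where "keys lam \<subseteq> {..<m}"
    using keys_bounded by blast
  define n where "n = max m (Suc s)"
  have n: "lookup lam n = 0" "s < n"
    using \<open>keys lam \<subseteq> {..<m}\<close> by (auto simp: n_def in_keys_iff subset_iff)
  let ?l = "beads n lam"
  have "weight (add_strip lam r s b) + (\<Sum>i<n. n - 1 - i) = (\<Sum>i<n. beads n (add_strip lam r s b) i)"
    by (rule sum_beads[symmetric]) (use add_strip_props(1)[OF lam a] lookup_add_strip_beyond[OF n a] in auto)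
  also have "\<dots> = (\<Sum>i<n. shift_row r s (?l(s := ?l s + b)) i)"
    by (rule sum.cong) (simp_all add: beads_add_strip[OF a n(2)])
  also have "\<dots> = (\<Sum>i<n. (?l(s := ?l s + b)) i)"
    by (rule sum_shift_row) (use a n in \<open>auto simp: strip_addable_def\<close>)
  also have "\<dots> = (\<Sum>i<n. ?l i + (if i = s then b else 0))"
    by (rule sum.cong) auto
  also have "\<dots> = weight lam + (\<Sum>i<n. n - 1 - i) + b"
    using n(2) by (simp add: sum.distrib sum_beads[OF lam n(1)])
  finally show ?thesis by simp
qed

text \<open>Every row of the shape other than r overlaps the row above in exactly one column, which
  determines its end and puts the row above into the shape. So the rows form an interval from r to
  some s, and only the length of row r is free.\<close>

lemma add_strip_exists:
  assumes lam: "is_partition lam" and mu: "is_partition mu" and ge: "\<And>i. lookup lam i \<le> lookup mu i"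
    and thin: "thin lam mu" and tops: "strip_tops lam mu = {r}"
  shows "\<exists>s b. strip_addable lam r s b \<and> mu = add_strip lam r s b"
proof -
  note anti = partition_antimono[OF lam] and anti' = partition_antimono[OF mu]
  have r: "r \<in> strip_rows lam mu" "r = 0 \<or> lookup mu r \<le> lookup lam (r - 1)"
    using tops by (auto simp: strip_tops_def)
  have linked: "lookup mu (Suc i) = Suc (lookup lam i)" if "Suc i \<in> strip_rows lam mu" "Suc i \<noteq> r" for i
  proof -
    have "Suc i \<notin> strip_tops lam mu" using tops that(2) by auto
    then have "lookup lam i < lookup mu (Suc i)" using that(1) by (auto simp: strip_tops_def)
    moreover have "lookup mu (Suc i) \<le> Suc (lookup lam i)" using thin by (simp add: thin_def)
    ultimately show ?thesis by simp
  qed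
  have down: "r \<le> i \<and> {r..i} \<subseteq> strip_rows lam mu" if "i \<in> strip_rows lam mu" for i
    using that
  proof (induction i)
    case 0
    then have "0 \<in> strip_tops lam mu" by (simp add: strip_tops_def)
    then show ?case using tops r by auto
  next
    case (Suc i)
    show ?case
    proof (cases "Suc i = r")
      case True
      then show ?thesis using r(1) by auto
    next
      case False
      then have "lookup lam i < lookup mu i"
        using linked[OF Suc.prems] anti'[of i "Suc i"] by simp
      then have "r \<le> i \<and> {r..i} \<subseteq> strip_rows lam mu" by (intro Suc.IH) (simp add: strip_rows_def)
      then show ?thesis using Suc.prems by (auto simp: atLeastAtMostSuc_conv)
    qed
  qed
  define s where "s = Max (strip_rows lam mu)"
  have s: "s \<in> strip_rows lam mu" "\<And>i. i \<in> strip_rows lam mu \<Longrightarrow> i \<le> s"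
    unfolding s_def using r(1) Max_in[OF finite_strip_rows] Max_ge[OF finite_strip_rows] by blast+
  have rs: "r \<le> s" and rows: "strip_rows lam mu = {r..s}"
    using down s by auto
  \<comment> \<open>Solved from the requirement that \<open>add_strip\<close> give row r its length
    in mu.\<close>
  define b where "b = lookup mu r + (s - r) - lookup lam s"
  have mur: "lookup lam r < lookup mu r" using r(1) by (simp add: strip_rows_def)
  have b: "lookup lam s + b = lookup mu r + (s - r)"
    using mur anti[OF rs] by (simp add: b_def)
  have "lookup mu i = lookup (add_strip lam r s b) i" for i
  proof -
    consider "i = r" | "r < i" "i \<le> s" | "i < r \<or> s < i" by linarith
    then show ?thesis
    proof cases
      case 2
      then have "Suc (i - 1) \<in> strip_rows lam mu" by (simp add: rows)
      then have "lookup mu (Suc (i - 1)) = Suc (lookup lam (i - 1))" by (rule linked) (use 2 in simp)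
      then show ?thesis using 2 by (simp add: lookup_add_strip)
    next
      case 3
      then have "i \<notin> strip_rows lam mu" by (auto simp: rows)
      then have "lookup mu i = lookup lam i" using ge[of i] by (simp add: strip_rows_def)
      then show ?thesis using 3 rs by (auto simp: lookup_add_strip)
    qed (simp add: lookup_add_strip b)
  qed
  then have "mu = add_strip lam r s b" by (rule poly_mapping_eqI)
  moreover have "strip_addable lam r s b"
    unfolding strip_addable_def b using rs mur r(2) by auto
  ultimately show ?thesis by blast
qed

lemma strip_addable_unique_top:
  assumes lam: "is_partition lam" and "strip_addable lam r s b" "strip_addable lam r' s b"
  shows "r = r'"
proof -
  have False if a: "strip_addable lam r s b" "strip_addable lam r' s b" and lt: "r < r'" for r r'
  proof -
    have "lookup lam (r' - 1) \<le> lookup lam r" by (rule partition_antimono[OF lam]) (use lt in simp)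
    moreover have "lookup lam r + (s - r) < lookup lam s + b" "lookup lam s + b \<le> lookup lam (r' - 1) + (s - r')"
      using a lt by (auto simp: strip_addable_def)
    moreover have "s - r' \<le> s - r" using lt by simp
    ultimately show False by linarith
  qed
  then show ?thesis using assms(2,3) by (metis nat_neq_iff)
qed

text \<open>The top row r of the strip counts the beads that bead s does not overtake; this converts
  the cardinality in \<open>vand_mult_D_schur\<close> into r.\<close>

lemma strip_addable_count:
  assumes lam: "is_partition lam" and a: "strip_addable lam r s b" and s: "s < n"
  shows "i < s \<and> beads n lam s + b < beads n lam i \<longleftrightarrow> i < r"
proof -
  have rs: "r \<le> s" and b1: "lookup lam r + (s - r) < lookup lam s + b"
    and b2: "r = 0 \<or> lookup lam s + b \<le> lookup lam (r - 1) + (s - r)"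
    using a by (auto simp: strip_addable_def)
  show ?thesis
  proof (cases "i < r")
    case True
    then have "lookup lam (r - 1) \<le> lookup lam i" by (intro partition_antimono[OF lam]) simp
    then show ?thesis using True b2 rs s by (auto simp: beads_def)
  next
    case False
    then have "lookup lam i \<le> lookup lam r" by (intro partition_antimono[OF lam]) simp
    then show ?thesis using False b1 rs s by (auto simp: beads_def)
  qed
qed

text \<open>r is the first bead below the target position; the hypothesis \<open>free\<close> keeps
  bead r - 1 from occupying the target.\<close>

lemma strip_addable_exists:
  assumes lam: "is_partition lam" and s: "s < n" and b: "0 < b"
    and free: "\<And>i. i < s \<Longrightarrow> beads n lam i \<noteq> beads n lam s + b"
  shows "\<exists>r. strip_addable lam r s b"
proof -
  define r where "r = (LEAST r. beads n lam r < beads n lam s + b)"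
  have ex: "beads n lam s < beads n lam s + b" using b by simp
  have r1: "beads n lam r < beads n lam s + b" unfolding r_def by (rule LeastI) (rule ex)
  have rs: "r \<le> s" unfolding r_def by (rule Least_le) (rule ex)
  have r2: "beads n lam s + b < beads n lam (r - 1)" if "r \<noteq> 0"
  proof -
    have "\<not> beads n lam (r - 1) < beads n lam s + b"
      using not_less_Least[of "r - 1" "\<lambda>r. beads n lam r < beads n lam s + b"] that by (simp add: r_def)
    moreover have "beads n lam (r - 1) \<noteq> beads n lam s + b" using free[of "r - 1"] that rs by simp
    ultimately show ?thesis by simp
  qed
  have "lookup lam s + b \<le> lookup lam (r - 1) + (s - r)" if "r \<noteq> 0"
    using r2[OF that] rs s that unfolding beads_def by linarith
  moreover have "lookup lam r + (s - r) < lookup lam s + b"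
    using r1 rs s unfolding beads_def by linarith
  ultimately have "strip_addable lam r s b" using rs by (auto simp: strip_addable_def)
  then show ?thesis by blast
qed

text \<open>The sum has at most one term: none if the target is occupied, where two rows of the
  determinant agree. Only beads up to the target are prescribed for v, so a higher bead may already
  have been moved.\<close>

lemma alt_move_bead:
  assumes lam: "is_partition lam" and s: "s < n" and b: "0 < b"
    and v: "\<And>i. i \<noteq> s \<Longrightarrow> beads n lam i \<le> beads n lam s + b \<Longrightarrow> v i = beads n lam i" "v s = beads n lam s + b"
  shows "alt n v = (\<Sum>r | strip_addable lam r s b. (-1) ^ (s - r) * alt n (shift_row r s v) :: 'a::comm_ring_1 power_series)"
proof (cases "\<exists>i<s. beads n lam i = beads n lam s + b")
  case True
  then obtain i where i: "i < s" "beads n lam i = beads n lam s + b" by blast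
  have "\<not> strip_addable lam r s b" for r
  proof
    assume a: "strip_addable lam r s b"
    have "\<not> i < r" using strip_addable_count[OF lam a s, of i] i by simp
    moreover have "lookup lam i \<le> lookup lam r" if "r \<le> i" using that by (rule partition_antimono[OF lam])
    ultimately show False using a i s by (auto simp: strip_addable_def beads_def)
  qed
  moreover have "alt n v = (0 :: 'a power_series)"
    by (rule alt_eq_0[of i n s]) (use i v s in auto)
  ultimately show ?thesis by simp
next
  case False
  then obtain r where r: "strip_addable lam r s b" using strip_addable_exists[OF lam s b] by blast
  then have "{r. strip_addable lam r s b} = {r}" using strip_addable_unique_top[OF lam] by auto
  moreover have "alt n (shift_row r s v) = (-1) ^ (s - r) * (alt n v :: 'a power_series)"
    by (rule alt_shift_row) (use r s in \<open>auto simp: strip_addable_def\<close>)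
  ultimately show ?thesis by (simp add: mult.assoc[symmetric] flip: power_add)
qed

lemma alt_add_strip:
  assumes lam: "is_partition lam" and s: "s < n" and b: "0 < b"
  shows "alt n ((beads n lam)(s := beads n lam s + b)) =
    (\<Sum>r | strip_addable lam r s b. (-1) ^ (s - r) * alt n (beads n (add_strip lam r s b)) :: 'a::comm_ring_1 power_series)"
proof -
  have "alt n (shift_row r s ((beads n lam)(s := beads n lam s + b))) =
      (alt n (beads n (add_strip lam r s b)) :: 'a power_series)"
    if "strip_addable lam r s b" for r
    by (rule alt_cong) (simp add: beads_add_strip[OF that s])
  then show ?thesis by (subst alt_move_bead[OF lam s b]) auto
qed

text \<open>The lower bead j is sorted in first. Its target stays below bead i, so its strip starts
  below row i and leaves bead i in place; the second strip is then added to the new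
  partition.\<close>

lemma alt_add_two_strips:
  assumes lam: "is_partition lam" and ij: "i < j" "j < n" and a: "0 < a" and b: "0 < b"
    and lt: "beads n lam j + b < beads n lam i"
  shows "alt n ((beads n lam)(i := beads n lam i + a, j := beads n lam j + b)) =
    (\<Sum>r | strip_addable lam r j b. \<Sum>r' | strip_addable (add_strip lam r j b) r' i a.
       (-1) ^ (j - r + (i - r')) * alt n (beads n (add_strip (add_strip lam r j b) r' i a))
       :: 'a::comm_ring_1 power_series)"
proof -
  let ?v = "(beads n lam)(i := beads n lam i + a, j := beads n lam j + b)"
  have "alt n ?v = (\<Sum>r | strip_addable lam r j b. (-1) ^ (j - r) * (alt n (shift_row r j ?v) :: 'a power_series))"
    by (rule alt_move_bead[OF lam ij(2) b]) (use ij lt in auto)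
  also have "\<dots> = (\<Sum>r | strip_addable lam r j b. (-1) ^ (j - r) * (\<Sum>r' | strip_addable (add_strip lam r j b) r' i a.
       (-1) ^ (i - r') * alt n (beads n (add_strip (add_strip lam r j b) r' i a))))"
  proof (rule sum.cong[OF refl])
    fix r assume "r \<in> {r. strip_addable lam r j b}"
    then have r: "strip_addable lam r j b" by simp
    let ?nu = "add_strip lam r j b"
    have ir: "i < r" using strip_addable_count[OF lam r ij(2), of i] ij lt by simp
    have i: "beads n ?nu i = beads n lam i"
      using ir r by (simp add: beads_def lookup_add_strip strip_addable_def)
    have "alt n (shift_row r j ?v) = (alt n ((beads n ?nu)(i := beads n ?nu i + a)) :: 'a power_series)"
      by (rule alt_cong) (use ir ij i in \<open>auto simp: beads_add_strip[OF r ij(2)] shift_row_def\<close>)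
    also have "\<dots> = (\<Sum>r' | strip_addable ?nu r' i a. (-1) ^ (i - r') * alt n (beads n (add_strip ?nu r' i a)))"
      by (rule alt_add_strip[OF add_strip_props(1)[OF lam r]]) (use ij a in auto)
    finally show "(-1) ^ (j - r) * alt n (shift_row r j ?v) = (-1) ^ (j - r) *
       (\<Sum>r' | strip_addable ?nu r' i a. (-1) ^ (i - r') * alt n (beads n (add_strip ?nu r' i a)) :: 'a power_series)"
      by simp
  qed
  finally show ?thesis by (simp add: sum_distrib_left power_add mult.assoc)
qed

text \<open>Above row r only the second strip changes anything, from row r on only the first. The
  strips may occupy neighbouring rows; r remains a top because its condition involves only row r of
  mu and \<open>lam\<close>.\<close>

lemma add_two_strips_props:
  assumes lam: "is_partition lam" and v: "strip_addable lam r j b" and ir: "i < r"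
    and v': "strip_addable (add_strip lam r j b) r' i a"
  defines "mu \<equiv> add_strip (add_strip lam r j b) r' i a"
  shows "is_partition mu" "\<And>i. lookup lam i \<le> lookup mu i" "strip_rows lam mu = {r'..i} \<union> {r..j}"
    "strip_tops lam mu = {r', r}" "thin lam mu" "r' < r" "weight mu = weight lam + (a + b)"
    "lookup mu r = lookup lam j + b - (j - r)"
proof -
  let ?nu = "add_strip lam r j b"
  note nu = add_strip_props[OF lam v]
  note mu = add_strip_props[OF nu(1) v', folded mu_def]
  show "is_partition mu" by (rule mu(1))
  show "lookup lam i \<le> lookup mu i" for i using nu(2) mu(2) order_trans by blast
  have rj: "r \<le> j" and r'i: "r' \<le> i" using v v' by (auto simp: strip_addable_def)
  show r'r: "r' < r" using r'i ir by simp
  have lo: "lookup ?nu i = lookup lam i" if "i < r" for i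
    using that v by (simp add: lookup_add_strip strip_addable_def)
  have hi: "lookup mu m = lookup ?nu m" if "r \<le> m" for m
    using that ir r'i by (simp add: mu_def lookup_add_strip)
  show "lookup mu r = lookup lam j + b - (j - r)"
    by (simp add: hi) (simp add: lookup_add_strip)
  show "weight mu = weight lam + (a + b)"
    unfolding mu_def by (simp add: weight_add_strip[OF nu(1) v'] weight_add_strip[OF lam v])
  have split: "m \<in> strip_rows lam mu \<longleftrightarrow> (if m < r then m \<in> strip_rows ?nu mu else m \<in> strip_rows lam ?nu)" for m
    using lo[of m] hi[of m] by (simp add: strip_rows_def)
  then show "strip_rows lam mu = {r'..i} \<union> {r..j}"
    using nu(3) mu(3) ir by (auto split: if_splits)
  have "m \<in> strip_tops lam mu \<longleftrightarrow> (if m < r then m \<in> strip_tops ?nu mu else m \<in> strip_tops lam ?nu)" for m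
    using split[of m] lo[of "m - 1"] hi[of m] by (auto simp: strip_tops_def)
  then show "strip_tops lam mu = {r', r}"
    using nu(4) mu(4) r'r by (auto split: if_splits)
  show "thin lam mu"
    unfolding thin_def
  proof
    fix m
    show "lookup mu (Suc m) \<le> Suc (lookup lam m)"
    proof (cases "m < r")
      case True
      then show ?thesis using mu(5) lo[of m] by (metis thin_def)
    next
      case False
      then show ?thesis using nu(5) hi[of "Suc m"] by (simp add: thin_def)
    qed
  qed
qed

text \<open>The shape is cut at the lower top r: nu follows lam above row r and mu from there on. It
  is a partition precisely because row r does not reach below row r - 1 of the shape, and each half
  has a single top.\<close>

lemma two_strips_exist:
  assumes lam: "is_partition lam" and mu: "is_partition mu" and ge: "\<And>i. lookup lam i \<le> lookup mu i"
    and thin: "thin lam mu" and tops: "strip_tops lam mu = {r', r}" and r'r: "r' < r"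
  shows "\<exists>j b i a. strip_addable lam r j b \<and> i < r \<and> strip_addable (add_strip lam r j b) r' i a \<and>
    mu = add_strip (add_strip lam r j b) r' i a"
proof -
  note anti = partition_antimono[OF lam] and anti' = partition_antimono[OF mu]
  define nu where "nu = Abs_poly_mapping (\<lambda>i. if i < r then lookup lam i else lookup mu i)"
  have "finite {i. (if i < r then lookup lam i else lookup mu i) \<noteq> 0}"
    by (rule finite_subset[of _ "keys lam \<union> keys mu"]) (auto simp: in_keys_iff split: if_splits)
  then have nu: "lookup nu i = (if i < r then lookup lam i else lookup mu i)" for i
    by (simp add: nu_def)
  have ge1: "lookup lam i \<le> lookup nu i" and ge2: "lookup nu i \<le> lookup mu i" for i
    using ge by (simp_all add: nu)
  have top: "r \<in> strip_tops lam mu" using tops by simp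
  then have rtop: "lookup mu r \<le> lookup lam (r - 1)" using r'r by (auto simp: strip_tops_def)
  have nup: "is_partition nu"
  proof (rule is_partition_SucI)
    fix i
    show "lookup nu (Suc i) \<le> lookup nu i"
      using rtop anti[of i "Suc i"] anti'[of i "Suc i"] by (cases "Suc i = r") (auto simp: nu)
  qed
  have "strip_tops lam nu = {r}"
  proof -
    have "m \<in> strip_tops lam nu \<longleftrightarrow> r \<le> m \<and> m \<in> strip_tops lam mu" for m
      by (auto simp: strip_tops_def strip_rows_def nu split: if_splits)
    then show ?thesis using tops r'r by auto
  qed
  moreover have "thin lam nu"
    unfolding thin_def using thin anti by (auto simp: nu thin_def le_SucI)
  ultimately obtain j b where jb: "strip_addable lam r j b" "nu = add_strip lam r j b"
    using add_strip_exists[OF lam nup ge1] by blast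
  have tops': "strip_tops nu mu = {r'}"
  proof -
    have "m \<in> strip_tops nu mu \<longleftrightarrow> m < r \<and> m \<in> strip_tops lam mu" for m
      by (auto simp: strip_tops_def strip_rows_def nu split: if_splits)
    then show ?thesis using tops r'r by auto
  qed
  moreover have "thin nu mu"
    unfolding thin_def using thin anti' by (auto simp: nu thin_def le_SucI)
  ultimately obtain i a where ia: "strip_addable nu r' i a" "mu = add_strip nu r' i a"
    using add_strip_exists[OF nup mu ge2] by blast
  have "strip_rows nu mu = {r'..i}" using add_strip_props(3)[OF nup ia(1)] ia(2) by simp
  then have "i \<in> strip_rows nu mu" using ia(1) by (auto simp: strip_addable_def)
  then have "i < r" by (auto simp: strip_rows_def nu split: if_splits)
  then show ?thesis using jb ia by blast
qed

section \<open>Components and corners of skew shapes\<close>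

lemma mem_skew [simp]: "(i, j) \<in> skew mu lam \<longleftrightarrow> lookup lam i \<le> j \<and> j < lookup mu i"
  by (auto simp: skew_def)

lemma strip_rows_eq: "strip_rows lam mu = fst ` skew mu lam"
proof
  show "strip_rows lam mu \<subseteq> fst ` skew mu lam"
  proof
    fix i assume "i \<in> strip_rows lam mu"
    then have "(i, lookup lam i) \<in> skew mu lam" by (simp add: strip_rows_def)
    then show "i \<in> fst ` skew mu lam" by (rule image_eqI[rotated]) simp
  qed
qed (auto simp: strip_rows_def)

text \<open>If rows i and i + 1 share two columns, a 2x2 block starts at the first box of row
  i.\<close>

lemma broken_border_strip_iff_thin:
  assumes lam: "is_partition lam" and mu: "is_partition mu"
  shows "broken_border_strip (skew mu lam) \<longleftrightarrow> thin lam mu"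
proof
  assume b: "broken_border_strip (skew mu lam)"
  show "thin lam mu"
    unfolding thin_def
  proof (rule allI, rule ccontr)
    fix i assume "\<not> lookup mu (Suc i) \<le> Suc (lookup lam i)"
    then have "{(i, lookup lam i), (i, Suc (lookup lam i)), (Suc i, lookup lam i), (Suc i, Suc (lookup lam i))}
        \<subseteq> skew mu lam"
      using partition_antimono[OF lam, of i "Suc i"] partition_antimono[OF mu, of i "Suc i"] by auto
    then show False using b unfolding broken_border_strip_def by blast
  qed
next
  assume t: "thin lam mu"
  show "broken_border_strip (skew mu lam)"
    unfolding broken_border_strip_def
  proof (rule notI, elim exE)
    fix i j assume "{(i, j), (i, Suc j), (Suc i, j), (Suc i, Suc j)} \<subseteq> skew mu lam"
    then have "lookup lam i \<le> j" "Suc j < lookup mu (Suc i)" by auto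
    moreover have "lookup mu (Suc i) \<le> Suc (lookup lam i)" using t by (simp add: thin_def)
    ultimately show False by simp
  qed
qed

text \<open>Walking along a row and up from a row to the one above it whenever they overlap, every box
  is connected to the first box of a top row, and this top row is the same for adjacent boxes.\<close>

lemma card_shape_components:
  assumes lam: "is_partition lam" and mu: "is_partition mu"
  shows "card (shape_components (skew mu lam)) = card (strip_tops lam mu)"
    and "connected_shape (skew mu lam) \<longleftrightarrow> card (strip_tops lam mu) = 1"
proof -
  note anti = partition_antimono[OF lam] and anti' = partition_antimono[OF mu]
  let ?S = "skew mu lam" and ?T = "strip_tops lam mu"
  let ?R = "{(b, c). b \<in> ?S \<and> c \<in> ?S \<and> adjacent b c}"
  \<comment> \<open>The last top row weakly above row i, used as the label of the component that
    contains row i.\<close>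
  define \<tau> where "\<tau> i = Max {t \<in> ?T. t \<le> i}" for i
  have \<tau>_top: "\<tau> i = i" if "i \<in> ?T" for i
    unfolding \<tau>_def by (rule Max_eqI) (use that in auto)
  have \<tau>_Suc: "\<tau> (Suc i) = \<tau> i" if "Suc i \<notin> ?T" for i
  proof -
    have "{t \<in> ?T. t \<le> Suc i} = {t \<in> ?T. t \<le> i}" using that by (auto simp: le_Suc_eq)
    then show ?thesis by (simp add: \<tau>_def)
  qed
  have sym: "sym (connection ?S)"
    unfolding connection_def by (rule sym_rtrancl) (auto simp: sym_def adjacent_def)
  have vertical: "\<tau> (Suc i) = \<tau> i" if "(i, j) \<in> ?S" "(Suc i, j) \<in> ?S" for i j
    by (rule \<tau>_Suc) (use that in \<open>auto simp: strip_tops_def\<close>)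
  have adj: "\<tau> (fst b) = \<tau> (fst c)" if bc: "b \<in> ?S" "c \<in> ?S" "adjacent b c" for b c
  proof -
    obtain i j i' j' where [simp]: "b = (i, j)" "c = (i', j')" by (cases b, cases c)
    have "i = i' \<or> (j = j' \<and> (i' = Suc i \<or> i = Suc i'))" using bc(3) by (auto simp: adjacent_def)
    then show ?thesis using vertical[of i j] vertical[of i' j'] bc(1,2) by auto
  qed
  have conn_\<tau>: "c \<in> ?S \<and> \<tau> (fst c) = \<tau> (fst b)" if "(b, c) \<in> connection ?S" "b \<in> ?S" for b c
    using that(1) unfolding connection_def
    by (induction rule: rtrancl_induct) (use that(2) adj in auto)
  have row: "((i, lookup lam i + d), (i, lookup lam i)) \<in> connection ?S"
    if "(i, lookup lam i + d) \<in> ?S" for i d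
    using that
  proof (induction d)
    case (Suc d)
    then have "((i, lookup lam i + Suc d), (i, lookup lam i + d)) \<in> ?R" by (auto simp: adjacent_def)
    moreover have "((i, lookup lam i + d), (i, lookup lam i)) \<in> connection ?S"
      using Suc.prems by (intro Suc.IH) auto
    ultimately show ?case unfolding connection_def by (rule converse_rtrancl_into_rtrancl)
  qed (simp add: connection_def)
  have to_top: "((i, lookup lam i), (\<tau> i, lookup lam (\<tau> i))) \<in> connection ?S" if "i \<in> strip_rows lam mu" for i
    using that
  proof (induction i)
    case 0
    then have "0 \<in> ?T" by (simp add: strip_tops_def)
    then show ?case by (simp add: \<tau>_top connection_def)
  next
    case (Suc i)
    show ?case
    proof (cases "Suc i \<in> ?T")
      case True
      then show ?thesis by (simp add: \<tau>_top connection_def)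
    next
      case False
      then have l: "lookup lam i < lookup mu (Suc i)" using Suc.prems by (auto simp: strip_tops_def)
      have i: "i \<in> strip_rows lam mu" using l anti'[of i "Suc i"] by (simp add: strip_rows_def)
      obtain d where d: "lookup lam i = lookup lam (Suc i) + d"
        using anti[of i "Suc i"] le_iff_add by auto
      have "((Suc i, lookup lam (Suc i) + d), (Suc i, lookup lam (Suc i))) \<in> connection ?S"
        by (rule row) (use l d in simp)
      then have "((Suc i, lookup lam (Suc i)), (Suc i, lookup lam i)) \<in> connection ?S"
        using sym d by (auto dest: symD)
      moreover have "((Suc i, lookup lam i), (i, lookup lam i)) \<in> ?R"
        using l d i by (auto simp: adjacent_def strip_rows_def)
      ultimately have "((Suc i, lookup lam (Suc i)), (i, lookup lam i)) \<in> connection ?S"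
        unfolding connection_def by (rule rtrancl_into_rtrancl)
      then show ?thesis using Suc.IH[OF i] \<tau>_Suc[OF False] unfolding connection_def by simp
    qed
  qed
  have box_to_top: "((i, j), (\<tau> i, lookup lam (\<tau> i))) \<in> connection ?S" if "(i, j) \<in> ?S" for i j
  proof -
    have "lookup lam i \<le> j" using that by simp
    then obtain d where d: "j = lookup lam i + d" by (auto simp: le_iff_add)
    have "((i, j), (i, lookup lam i)) \<in> connection ?S" unfolding d by (rule row) (use that d in simp)
    moreover have "i \<in> strip_rows lam mu" using that by (simp add: strip_rows_def)
    ultimately show ?thesis using to_top unfolding connection_def by (meson rtrancl_trans)
  qed
  have conn: "(b, c) \<in> connection ?S \<longleftrightarrow> \<tau> (fst c) = \<tau> (fst b)" if bc: "b \<in> ?S" "c \<in> ?S" for b c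
  proof
    assume eq: "\<tau> (fst c) = \<tau> (fst b)"
    have "(b, (\<tau> (fst b), lookup lam (\<tau> (fst b)))) \<in> connection ?S"
      using box_to_top[of "fst b" "snd b"] bc by simp
    moreover have "((\<tau> (fst b), lookup lam (\<tau> (fst b))), c) \<in> connection ?S"
      using box_to_top[of "fst c" "snd c"] bc eq sym by (auto dest: symD)
    ultimately show "(b, c) \<in> connection ?S" unfolding connection_def by (rule rtrancl_trans)
  qed (use conn_\<tau> bc in blast)
  have img: "(\<lambda>b. \<tau> (fst b)) ` ?S = ?T"
  proof
    show "?T \<subseteq> (\<lambda>b. \<tau> (fst b)) ` ?S"
    proof
      fix t assume t: "t \<in> ?T"
      then have "(t, lookup lam t) \<in> ?S" by (simp add: strip_tops_def strip_rows_def)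
      then show "t \<in> (\<lambda>b. \<tau> (fst b)) ` ?S" using \<tau>_top[OF t]
        by (intro rev_image_eqI[of "(t, lookup lam t)"]) simp_all
    qed
    show "(\<lambda>b. \<tau> (fst b)) ` ?S \<subseteq> ?T"
    proof (rule image_subsetI)
      fix b assume b: "b \<in> ?S"
      have "\<tau> i \<in> ?T" if "i \<in> strip_rows lam mu" for i using that
      proof (induction i)
        case 0
        then have "0 \<in> ?T" by (simp add: strip_tops_def)
        then show ?case by (simp add: \<tau>_top)
      next
        case (Suc i)
        show ?case
        proof (cases "Suc i \<in> ?T")
          case False
          then have "lookup lam i < lookup mu (Suc i)" using Suc.prems by (auto simp: strip_tops_def)
          then have "i \<in> strip_rows lam mu" using anti'[of i "Suc i"] by (simp add: strip_rows_def)
          then show ?thesis using Suc.IH \<tau>_Suc[OF False] by simp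
        qed (simp add: \<tau>_top)
      qed
      then show "\<tau> (fst b) \<in> ?T" using b by (simp add: strip_rows_eq)
    qed
  qed
  have "shape_components ?S = (\<lambda>t. {c \<in> ?S. \<tau> (fst c) = t}) ` ?T"
  proof -
    have "c \<in> connection ?S `` {b} \<longleftrightarrow> c \<in> {c \<in> ?S. \<tau> (fst c) = \<tau> (fst b)}" if "b \<in> ?S" for b c
      using conn[OF that, of c] conn_\<tau>[of b c] that
      by (simp only: Image_singleton_iff mem_Collect_eq) blast
    then have "connection ?S `` {b} = {c \<in> ?S. \<tau> (fst c) = \<tau> (fst b)}" if "b \<in> ?S" for b
      using that by (intro Set.set_eqI)
    then have "shape_components ?S = (\<lambda>b. {c \<in> ?S. \<tau> (fst c) = \<tau> (fst b)}) ` ?S"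
      unfolding shape_components_def quotient_def by (simp add: UNION_singleton_eq_range cong: image_cong_simp)
    then show ?thesis by (simp add: img[symmetric] image_image)
  qed
  moreover have "inj_on (\<lambda>t. {c \<in> ?S. \<tau> (fst c) = t}) ?T"
  proof (rule inj_onI)
    fix t t' assume t: "t \<in> ?T" and eq: "{c \<in> ?S. \<tau> (fst c) = t} = {c \<in> ?S. \<tau> (fst c) = t'}"
    have "t \<in> (\<lambda>b. \<tau> (fst b)) ` ?S" unfolding img by (rule t)
    then obtain b where "t = \<tau> (fst b)" "b \<in> ?S" by (rule imageE)
    then have "b \<in> {c \<in> ?S. \<tau> (fst c) = t}" by simp
    then show "t = t'" unfolding eq by (simp add: \<open>t = \<tau> (fst b)\<close>)
  qed
  ultimately show "card (shape_components ?S) = card ?T" by (simp add: card_image)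
  have "connected_shape ?S \<longleftrightarrow> ?S \<noteq> {} \<and> (\<forall>b\<in>?S. \<forall>c\<in>?S. \<tau> (fst c) = \<tau> (fst b))"
    unfolding connected_shape_def by (intro conj_cong ball_cong refl conn)
  also have "\<dots> \<longleftrightarrow> (\<exists>t. (\<lambda>b. \<tau> (fst b)) ` ?S = {t})" (is "?L \<longleftrightarrow> ?R")
  proof
    assume L: ?L
    then obtain b where b: "b \<in> ?S" by blast
    have "(\<lambda>b. \<tau> (fst b)) ` ?S = {\<tau> (fst b)}"
    proof
      show "(\<lambda>b. \<tau> (fst b)) ` ?S \<subseteq> {\<tau> (fst b)}" using L b by blast
    qed (use b in blast)
    then show ?R by blast
  next
    assume ?R
    then obtain t where t: "(\<lambda>b. \<tau> (fst b)) ` ?S = {t}" by blast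
    then have "\<tau> (fst b) = t" if "b \<in> ?S" for b using that by blast
    moreover have "?S \<noteq> {}" using t by blast
    ultimately show ?L by metis
  qed
  also have "\<dots> \<longleftrightarrow> card ?T = 1" unfolding img by (auto simp: card_1_singleton_iff)
  finally show "connected_shape ?S \<longleftrightarrow> card ?T = 1" .
qed

section \<open>Contents of corners and the coefficients\<close>

text \<open>Besides the sharp corner of row r, sharp and dull corners come in pairs in the rows
  \<open>?C\<close> in which lam gets strictly shorter. In each pair the row indices cancel, and the
  differences of consecutive parts telescope from row r to row s.\<close>

lemma sum_corners:
  assumes lam: "is_partition lam" and a: "strip_addable lam r s b"
  defines "mu \<equiv> add_strip lam r s b"
  shows "(\<Sum>c\<in>sharp_corners (skew mu lam). content c) - (\<Sum>c\<in>dull_corners (skew mu lam). content c) =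
    int (lookup lam s) - int r"
proof -
  note anti = partition_antimono[OF lam]
  note props = add_strip_props[OF lam a, folded mu_def]
  note anti' = partition_antimono[OF props(1)]
  let ?C = "{i \<in> {r<..s}. lookup lam i < lookup lam (i - 1)}"
  have rs: "r \<le> s" using a by (simp add: strip_addable_def)
  have row_iff: "lookup lam i < lookup mu i \<longleftrightarrow> r \<le> i \<and> i \<le> s" for i
    using props(3) by (auto simp: strip_rows_def set_eq_iff)
  have link_iff: "lookup lam i < lookup mu (Suc i) \<longleftrightarrow> r \<le> i \<and> i < s" for i
  proof
    assume l: "lookup lam i < lookup mu (Suc i)"
    then have "r \<le> i" using row_iff[of i] anti'[of i "Suc i"] by simp
    moreover have "Suc i \<le> s" using l row_iff[of "Suc i"] anti[of i "Suc i"] by simp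
    ultimately show "r \<le> i \<and> i < s" by simp
  next
    assume i: "r \<le> i \<and> i < s"
    then have "Suc i \<in> strip_rows lam mu" "Suc i \<notin> strip_tops lam mu" using props(3,4) by auto
    then show "lookup lam i < lookup mu (Suc i)" by (auto simp: strip_tops_def)
  qed
  have r_corner: "r = 0 \<or> lookup lam r < lookup lam (r - 1)"
    using props(4) row_iff[of r] rs by (auto simp: strip_tops_def set_eq_iff intro: less_le_trans)
  have sharp: "sharp_corners (skew mu lam) =
      (\<lambda>i. (i, lookup lam i)) ` ({r} \<union> ?C)"
  proof (intro Set.set_eqI iffI)
    fix c assume c: "c \<in> sharp_corners (skew mu lam)"
    obtain i j where cij: "c = (i, j)" by (cases c)
    have ij: "lookup lam i \<le> j" "j < lookup mu i" using c by (auto simp: sharp_corners_def cij)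
    have j: "j = lookup lam i"
    proof (rule ccontr)
      assume "j \<noteq> lookup lam i"
      then have "j = Suc (j - 1) \<and> (i, j - 1) \<in> skew mu lam" using ij by auto
      then show False using c unfolding sharp_corners_def cij by blast
    qed
    have "lookup lam i < lookup lam (i - 1)" if "i \<noteq> 0"
    proof (rule ccontr)
      assume "\<not> lookup lam i < lookup lam (i - 1)"
      then have "i = Suc (i - 1) \<and> (i - 1, j) \<in> skew mu lam"
        using that ij j anti[of "i - 1" i] anti'[of "i - 1" i] by auto
      then show False using c unfolding sharp_corners_def cij by blast
    qed
    moreover have "r \<le> i \<and> i \<le> s" using row_iff[of i] ij by simp
    ultimately show "c \<in> (\<lambda>i. (i, lookup lam i)) ` ({r} \<union> ?C)"
      by (cases "i = r") (auto simp: cij j)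
  next
    fix c assume "c \<in> (\<lambda>i. (i, lookup lam i)) ` ({r} \<union> ?C)"
    then obtain i where i: "c = (i, lookup lam i)" "r \<le> i" "i \<le> s" "i = 0 \<or> lookup lam i < lookup lam (i - 1)"
      using r_corner rs by auto
    then show "c \<in> sharp_corners (skew mu lam)"
      using row_iff[of i] by (auto simp: sharp_corners_def)
  qed
  have dull: "dull_corners (skew mu lam) =
      (\<lambda>i. (i, lookup lam (i - 1))) ` ?C"
  proof (intro Set.set_eqI iffI)
    fix c assume "c \<in> dull_corners (skew mu lam)"
    then obtain i j where c: "c = (Suc i, Suc j)" "(Suc i, Suc j) \<in> skew mu lam" "(Suc i, j) \<in> skew mu lam"
      "(i, Suc j) \<in> skew mu lam" "(i, j) \<notin> skew mu lam" by (auto simp: dull_corners_def)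
    then have "lookup lam i = Suc j" "lookup lam i < lookup mu (Suc i)" "lookup lam (Suc i) < lookup lam i" by auto
    then have "Suc i \<in> ?C" "c = (Suc i, lookup lam (Suc i - 1))"
      using link_iff[of i] c(1) by auto
    then show "c \<in> (\<lambda>i. (i, lookup lam (i - 1))) ` ?C" by blast
  next
    fix c assume "c \<in> (\<lambda>i. (i, lookup lam (i - 1))) ` ?C"
    then obtain i' where i': "c = (i', lookup lam (i' - 1))" "r < i'" "i' \<le> s" "lookup lam i' < lookup lam (i' - 1)"
      by auto
    obtain i where "i' = Suc i" using i'(2) by (cases i') auto
    with i' have i: "c = (Suc i, lookup lam i)" "r \<le> i" "i < s" "lookup lam (Suc i) < lookup lam i" by auto
    obtain j where j: "lookup lam i = Suc j" using i(4) by (cases "lookup lam i") auto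
    have "(Suc i, Suc j) \<in> skew mu lam" "(Suc i, j) \<in> skew mu lam" "(i, Suc j) \<in> skew mu lam" "(i, j) \<notin> skew mu lam"
      using i j link_iff[of i] row_iff[of i] by auto
    then show "c \<in> dull_corners (skew mu lam)" unfolding dull_corners_def using i(1) j by auto
  qed
  have "(\<Sum>c\<in>sharp_corners (skew mu lam). content c) =
      (\<Sum>i\<in>{r} \<union> ?C. int (lookup lam i) - int i)"
    unfolding sharp by (subst sum.reindex) (auto simp: inj_on_def content_def)
  also have "\<dots> = int (lookup lam r) - int r +
      (\<Sum>i\<in>?C. int (lookup lam i) - int i)"
    by (subst sum.union_disjoint) auto
  finally have "(\<Sum>c\<in>sharp_corners (skew mu lam). content c) - (\<Sum>c\<in>dull_corners (skew mu lam). content c) =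
     int (lookup lam r) - int r + (\<Sum>i\<in>?C.
        int (lookup lam i) - int (lookup lam (i - 1)))"
    unfolding dull by (subst sum.reindex) (auto simp: inj_on_def content_def sum_subtractf)
  also have "(\<Sum>i\<in>?C. int (lookup lam i) - int (lookup lam (i - 1))) =
      (\<Sum>i\<in>{r<..s}. int (lookup lam i) - int (lookup lam (i - 1)))"
  proof (rule sum.mono_neutral_left)
    have "lookup lam i = lookup lam (i - 1)" if "\<not> lookup lam i < lookup lam (i - 1)" for i
      using that anti[of "i - 1" i] by simp
    then show "\<forall>i\<in>{r<..s} - ?C.
        int (lookup lam i) - int (lookup lam (i - 1)) = 0" by simp
  qed auto
  also have "\<dots> = int (lookup lam s) - int (lookup lam r)"
    using rs
  proof (induction s rule: dec_induct)
    case (step m)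
    then have "{r<..Suc m} = insert (Suc m) {r<..m}" by auto
    then show ?case using step by simp
  qed simp
  finally show ?thesis by simp
qed

lemma d_coeff_one_strip:
  assumes lam: "is_partition lam" and a: "strip_addable lam r s b"
  shows "d_coeff lam (add_strip lam r s b) = (-1) ^ (s - r) * (int (lookup lam s) - int r)"
proof -
  note props = add_strip_props[OF lam a]
  have "border_strip (skew (add_strip lam r s b) lam)"
    using props by (simp add: border_strip_def broken_border_strip_iff_thin[OF lam] card_shape_components[OF lam])
  moreover have "ht (skew (add_strip lam r s b) lam) = s - r"
    using props(3) a by (simp add: ht_def strip_rows_eq strip_addable_def)
  ultimately show ?thesis by (simp add: d_coeff_def sum_corners[OF lam a])
qed

text \<open>The height counts all rows minus one, hence one more than the heights of the two strips
  together. This sign absorbs the minus sign of the two-bead moves.\<close>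

lemma d_coeff_two_strips:
  assumes lam: "is_partition lam" and v: "strip_addable lam r j b" and ir: "i < r"
    and v': "strip_addable (add_strip lam r j b) r' i a"
  shows "d_coeff lam (add_strip (add_strip lam r j b) r' i a) = - ((-1) ^ (j - r + (i - r')))"
proof -
  let ?mu = "add_strip (add_strip lam r j b) r' i a"
  note props = add_two_strips_props[OF assms]
  have c: "card (strip_tops lam ?mu) = 2" using props(4,6) by simp
  have le: "r \<le> j" "r' \<le> i" using v v' by (auto simp: strip_addable_def)
  have "card ({r'..i} \<union> {r..j}) = card {r'..i} + card {r..j}"
    by (rule card_Un_disjoint) (use ir in auto)
  then have "ht (skew ?mu lam) = Suc (j - r + (i - r'))"
    using le by (simp add: ht_def flip: strip_rows_eq) (simp add: props(3))
  moreover have "\<not> border_strip (skew ?mu lam)"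
    by (simp add: border_strip_def card_shape_components[OF lam props(1)] c)
  moreover have "cc (skew ?mu lam) = 2"
    by (simp add: cc_def broken_border_strip_iff_thin[OF lam props(1)] props(5)
        card_shape_components[OF lam props(1)] c numeral_eq_enat)
  ultimately show ?thesis by (simp add: d_coeff_def)
qed

section \<open>Sums over shapes with one or two components\<close>

definition strip_extensions :: "nat \<Rightarrow> (nat \<Rightarrow>\<^sub>0 nat) \<Rightarrow> nat \<Rightarrow> (nat \<Rightarrow>\<^sub>0 nat) set" where
  "strip_extensions c lam k = {mu. is_partition mu \<and> (\<forall>i. lookup lam i \<le> lookup mu i) \<and>
     weight mu = weight lam + k \<and> thin lam mu \<and> card (strip_tops lam mu) = c}"

lemma bij_betw_one_strip:
  assumes lam: "is_partition lam" and n: "lookup lam n = 0"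
  shows "bij_betw (\<lambda>(s, r). add_strip lam r s k) (SIGMA s:{..<n}. {r. strip_addable lam r s k})
    {mu \<in> strip_extensions 1 lam k. lookup mu n = 0}"
  unfolding bij_betw_def
proof
  let ?V = "SIGMA s:{..<n}. {r. strip_addable lam r s k}"
  show "inj_on (\<lambda>(s, r). add_strip lam r s k) ?V"
  proof (rule inj_onI, clarify)
    fix s r s' r' assume a: "strip_addable lam r s k" "strip_addable lam r' s' k"
      and eq: "add_strip lam r s k = add_strip lam r' s' k"
    have "{r..s} = {r'..s'}"
      using add_strip_props(3)[OF lam a(1)] add_strip_props(3)[OF lam a(2)] eq by metis
    then show "s = s' \<and> r = r'" using a by (auto simp: strip_addable_def Icc_eq_Icc)
  qed
  show "(\<lambda>(s, r). add_strip lam r s k) ` ?V = {mu \<in> strip_extensions 1 lam k. lookup mu n = 0}"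
  proof (intro Set.set_eqI iffI)
    fix mu assume "mu \<in> (\<lambda>(s, r). add_strip lam r s k) ` ?V"
    then obtain r s where "s < n" "strip_addable lam r s k" "mu = add_strip lam r s k" by auto
    then show "mu \<in> {mu \<in> strip_extensions 1 lam k. lookup mu n = 0}"
      using add_strip_props[OF lam] weight_add_strip[OF lam] lookup_add_strip_beyond[OF n]
      by (simp add: strip_extensions_def)
  next
    fix mu assume "mu \<in> {mu \<in> strip_extensions 1 lam k. lookup mu n = 0}"
    then have mu: "is_partition mu" "\<And>i. lookup lam i \<le> lookup mu i" "weight mu = weight lam + k"
      "thin lam mu" "card (strip_tops lam mu) = 1" "lookup mu n = 0" by (auto simp: strip_extensions_def)
    obtain r where "strip_tops lam mu = {r}" using mu(5) by (auto simp: card_1_singleton_iff)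
    then obtain s b where sb: "strip_addable lam r s b" "mu = add_strip lam r s b"
      using add_strip_exists[OF lam mu(1,2,4)] by blast
    have "b = k" using mu(3) weight_add_strip[OF lam sb(1)] sb(2) by simp
    moreover have "s < n"
    proof (rule ccontr)
      assume "\<not> s < n"
      then have "lookup mu s = 0" using partition_antimono[OF mu(1), of n s] mu(6) by simp
      moreover have "s \<in> strip_rows lam mu"
        using add_strip_props(3)[OF lam sb(1)] sb by (simp add: strip_addable_def)
      ultimately show False by (simp add: strip_rows_def)
    qed
    ultimately show "mu \<in> (\<lambda>(s, r). add_strip lam r s k) ` ?V" using sb by auto
  qed
qed

text \<open>The tops of the shape give r' and r, its rows give i and j, and the length of row r
  gives the distance b.\<close>

lemma bij_betw_two_strips:
  assumes lam: "is_partition lam" and n: "lookup lam n = 0"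
  shows "bij_betw (\<lambda>(j, i, b, r, r'). add_strip (add_strip lam r j b) r' i (k - b))
    (SIGMA j:{..<n}. SIGMA i:{..<j}. SIGMA b:{b. 0 < b \<and> b < k \<and> beads n lam j + b < beads n lam i}.
       SIGMA r:{r. strip_addable lam r j b}. {r'. strip_addable (add_strip lam r j b) r' i (k - b)})
    {mu \<in> strip_extensions 2 lam k. lookup mu n = 0}"
    (is "bij_betw ?f ?W ?M")
  unfolding bij_betw_def
proof
  \<comment> \<open>The condition on beads becomes i < r: the strip of bead j ends below row
    i.\<close>
  have W: "(j, i, b, r, r') \<in> ?W \<longleftrightarrow> j < n \<and> 0 < b \<and> b < k \<and> i < r \<and> strip_addable lam r j b \<and>
      strip_addable (add_strip lam r j b) r' i (k - b)" for j i b r r'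
    using strip_addable_count[OF lam, of r j b n i] by (auto simp: strip_addable_def)
  show "inj_on ?f ?W"
  proof (rule inj_onI)
    fix w w' assume w: "w \<in> ?W" "w' \<in> ?W" and eq: "?f w = ?f w'"
    obtain j i b r q where w1: "w = (j, i, b, r, q)" by (metis prod_cases5)
    obtain j' i' b' r' q' where w2: "w' = (j', i', b', r', q')" by (metis prod_cases5)
    have a: "i < r" "strip_addable lam r j b" "strip_addable (add_strip lam r j b) q i (k - b)"
      and a': "i' < r'" "strip_addable lam r' j' b'" "strip_addable (add_strip lam r' j' b') q' i' (k - b')"
      using w W unfolding w1 w2 by blast+
    note p = add_two_strips_props[OF lam a(2,1,3)] and p' = add_two_strips_props[OF lam a'(2,1,3)]
    let ?mu = "add_strip (add_strip lam r j b) q i (k - b)"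
    have mu: "add_strip (add_strip lam r' j' b') q' i' (k - b') = ?mu" using eq by (simp add: w1 w2)
    have "{q, r} = {q', r'}" using p(4) p'(4) mu by simp
    then have qr: "q = q'" "r = r'" using p(6) p'(6) by (auto simp: doubleton_eq_iff)
    have le: "r \<le> j" "r \<le> j'" "q \<le> i" "q \<le> i'" using a a' qr by (auto simp: strip_addable_def)
    have rows: "{q..i} \<union> {r..j} = {q..i'} \<union> {r..j'}" using p(3) p'(3) mu qr by simp
    have "{r..j} = {r..j'}"
    proof -
      have "({q..i} \<union> {r..j}) \<inter> {r..} = {r..j}" "({q..i'} \<union> {r..j'}) \<inter> {r..} = {r..j'}"
        using a(1) a'(1) qr by auto
      then show ?thesis using rows by metis
    qed
    then have j: "j = j'" using le by (simp add: Icc_eq_Icc)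
    have "{q..i} = {q..i'}"
    proof -
      have "({q..i} \<union> {r..j}) \<inter> {..<r} = {q..i}" "({q..i'} \<union> {r..j'}) \<inter> {..<r} = {q..i'}"
        using a(1) a'(1) qr by auto
      then show ?thesis using rows j by metis
    qed
    then have i: "i = i'" using le by (simp add: Icc_eq_Icc)
    have "lookup lam j + b - (j - r) = lookup lam j + b' - (j - r)"
      using p(8) p'(8) mu j qr by simp
    moreover have "j - r < lookup lam j + b" "j - r < lookup lam j + b'"
      using a(2) a'(2) j qr by (auto simp: strip_addable_def)
    ultimately have "b = b'" by simp
    then show "w = w'" by (simp add: w1 w2 qr i j)
  qed
  show "?f ` ?W = ?M"
  proof (intro Set.set_eqI iffI)
    fix mu assume "mu \<in> ?f ` ?W"
    then obtain j i b r q where w: "(j, i, b, r, q) \<in> ?W" and mu: "mu = add_strip (add_strip lam r j b) q i (k - b)"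
      by auto
    have a: "j < n" "b < k" "i < r" "strip_addable lam r j b" "strip_addable (add_strip lam r j b) q i (k - b)"
      using w unfolding W by auto
    note p = add_two_strips_props[OF lam a(4,3,5), folded mu]
    have "r \<le> j" using a(4) by (simp add: strip_addable_def)
    then have "lookup mu n = 0"
      unfolding mu using a
      by (intro lookup_add_strip_beyond[OF lookup_add_strip_beyond[OF n]]) auto
    then show "mu \<in> ?M"
      using p a by (simp add: strip_extensions_def)
  next
    fix mu assume "mu \<in> ?M"
    then have mu: "is_partition mu" "\<And>i. lookup lam i \<le> lookup mu i" "weight mu = weight lam + k"
      "thin lam mu" "card (strip_tops lam mu) = 2" "lookup mu n = 0" by (auto simp: strip_extensions_def)
    obtain x y where xy: "strip_tops lam mu = {x, y}" "x \<noteq> y" using mu(5) by (auto simp: card_2_iff)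
    define q r where "q = min x y" and "r = max x y"
    have qr: "strip_tops lam mu = {q, r}" "q < r"
      unfolding q_def r_def using xy by (simp_all add: min_def max_def insert_commute)
    obtain j b i a where w: "strip_addable lam r j b" "i < r" "strip_addable (add_strip lam r j b) q i a"
      "mu = add_strip (add_strip lam r j b) q i a"
      using two_strips_exist[OF lam mu(1,2,4) qr] by (elim exE conjE) (rule that)
    note p = add_two_strips_props[OF lam w(1,2,3), folded w(4)]
    have k: "k = a + b" using p(7) mu(3) by simp
    have "0 < b" using w(1) partition_antimono[OF lam, of r j] by (auto simp: strip_addable_def)
    moreover have "0 < a"
      using w(3) partition_antimono[OF add_strip_props(1)[OF lam w(1)], of q i] by (auto simp: strip_addable_def)
    moreover have "j < n"
    proof (rule ccontr)
      assume "\<not> j < n"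
      then have "lookup mu j = 0" using partition_antimono[OF mu(1), of n j] mu(6) by simp
      moreover have "j \<in> strip_rows lam mu" using p(3) w(1) by (simp add: strip_addable_def)
      ultimately show False by (simp add: strip_rows_def)
    qed
    ultimately have "(j, i, b, r, q) \<in> ?W" unfolding W using w k by simp
    moreover have "mu = ?f (j, i, b, r, q)" using w(4) k by simp
    ultimately show "mu \<in> ?f ` ?W" by blast
  qed
qed

lemma finite_strip_extensions: "finite (strip_extensions c lam k)"
  by (rule finite_subset[OF _ finite_partitions[of "weight lam + k"]]) (auto simp: strip_extensions_def)

lemma vand_mult_D_schur_strips:
  assumes lam: "is_partition lam" and n: "lookup lam n = 0" and k: "0 < k"
  defines "M \<equiv> strip_extensions 1 lam k \<union> strip_extensions 2 lam k"
  shows "vand n * restr n (D k (schur lam) :: 'a :: {idom, ring_char_0} power_series) =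
    (\<Sum>mu\<in>{mu \<in> M. lookup mu n = 0}. of_int (d_coeff lam mu) * alt n (beads n mu))"
proof -
  let ?l = "beads n lam"
  let ?c = "\<lambda>j. of_int (int (lookup lam j) - int (card {i. i < j \<and> ?l j + k < ?l i})) :: 'a power_series"
  let ?A = "\<lambda>j. alt n (?l(j := ?l j + k)) :: 'a power_series"
  let ?B = "\<lambda>i j. {b. 0 < b \<and> b < k \<and> ?l j + b < ?l i}"
  let ?P = "\<lambda>i j b. alt n (?l(i := ?l i + (k - b), j := ?l j + b)) :: 'a power_series"
  define g :: "(nat \<Rightarrow>\<^sub>0 nat) \<Rightarrow> 'a power_series" where
    "g mu = of_int (d_coeff lam mu) * alt n (beads n mu)" for mu
  let ?M = "\<lambda>c. {mu \<in> strip_extensions c lam k. lookup mu n = 0}"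
  have finV: "finite {r. strip_addable nu r s b}" for nu s b
    by (rule finite_subset[of _ "{..s}"]) (auto simp: strip_addable_def)
  have one: "(\<Sum>j<n. ?c j * ?A j) =
      (\<Sum>mu\<in>?M 1. g mu)"
  proof -
    have "(\<Sum>j<n. ?c j * ?A j) =
        (\<Sum>j<n. \<Sum>r | strip_addable lam r j k. g (add_strip lam r j k))"
    proof (rule sum.cong[OF refl])
      fix j assume "j \<in> {..<n}"
      then have j: "j < n" by simp
      have "?c j * ?A j =
          (\<Sum>r | strip_addable lam r j k. ?c j * ((-1) ^ (j - r) * alt n (beads n (add_strip lam r j k))))"
        by (simp add: alt_add_strip[OF lam j k] sum_distrib_left)
      also have "\<dots> = (\<Sum>r | strip_addable lam r j k. g (add_strip lam r j k))"
      proof (rule sum.cong[OF refl])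
        fix r assume "r \<in> {r. strip_addable lam r j k}"
        then have r: "strip_addable lam r j k" by simp
        have "{i. i < j \<and> ?l j + k < ?l i} = {..<r}"
          using strip_addable_count[OF lam r j] by auto
        then show "?c j * ((-1) ^ (j - r) * alt n (beads n (add_strip lam r j k))) = g (add_strip lam r j k)"
          by (simp add: g_def d_coeff_one_strip[OF lam r])
      qed
      finally show "?c j * ?A j = (\<Sum>r | strip_addable lam r j k. g (add_strip lam r j k))" .
    qed
    also have "\<dots> = (\<Sum>(j, r)\<in>(SIGMA j:{..<n}. {r. strip_addable lam r j k}). g (add_strip lam r j k))"
      by (rule sum.Sigma) (auto simp: finV)
    also have "\<dots> = (\<Sum>mu\<in>?M 1. g mu)"
      using sum.reindex_bij_betw[OF bij_betw_one_strip[OF lam n, of k], of g] by (simp add: case_prod_beta)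
    finally show ?thesis .
  qed
  have two: "(\<Sum>j<n. \<Sum>i<j. \<Sum>b\<in>?B i j. ?P i j b) =
      - (\<Sum>mu\<in>?M 2. g mu)"
  proof -
    let ?f = "\<lambda>j i b r r'. add_strip (add_strip lam r j b) r' i (k - b)"
    have "(\<Sum>j<n. \<Sum>i<j. \<Sum>b\<in>?B i j. ?P i j b) =
      (\<Sum>j<n. \<Sum>i<j. \<Sum>b\<in>?B i j. \<Sum>r | strip_addable lam r j b.
        \<Sum>r' | strip_addable (add_strip lam r j b) r' i (k - b). - g (?f j i b r r'))"
    proof (intro sum.cong[OF refl])
      fix j i b assume "j \<in> {..<n}" "i \<in> {..<j}" "b \<in> ?B i j"
      then have ij: "i < j" "j < n" and b: "0 < b" "0 < k - b" "?l j + b < ?l i" by auto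
      have "(-1) ^ (j - r + (i - r')) * alt n (beads n (?f j i b r r')) = - g (?f j i b r r')"
        if r: "strip_addable lam r j b" "strip_addable (add_strip lam r j b) r' i (k - b)" for r r'
      proof -
        have "i < r" using strip_addable_count[OF lam r(1) ij(2), of i] ij b by simp
        then show ?thesis by (simp add: g_def d_coeff_two_strips[OF lam r(1) _ r(2)])
      qed
      then show "?P i j b = (\<Sum>r | strip_addable lam r j b.
        \<Sum>r' | strip_addable (add_strip lam r j b) r' i (k - b). - g (?f j i b r r'))"
        unfolding alt_add_two_strips[OF lam ij b(2,1,3)] by (intro sum.cong[OF refl]) simp
    qed
    also have "\<dots> = (\<Sum>(j, i, b, r, r')\<in>(SIGMA j:{..<n}. SIGMA i:{..<j}.
        SIGMA b:?B i j. SIGMA r:{r. strip_addable lam r j b}.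
          {r'. strip_addable (add_strip lam r j b) r' i (k - b)}). - g (?f j i b r r'))"
      by (simp add: sum.Sigma finV)
    also have "\<dots> = (\<Sum>mu\<in>?M 2. - g mu)"
      using sum.reindex_bij_betw[OF bij_betw_two_strips[OF lam n, of k], of "\<lambda>mu. - g mu"]
      by (simp add: case_prod_beta)
    finally show ?thesis by (simp add: sum_negf)
  qed
  have "vand n * restr n (D k (schur lam) :: 'a power_series) = (\<Sum>mu\<in>?M 1. g mu) + (\<Sum>mu\<in>?M 2. g mu)"
    unfolding vand_mult_D_schur[OF lam n k] one two by simp
  also have "\<dots> = (\<Sum>mu\<in>?M 1 \<union> ?M 2. g mu)"
  proof (rule sum.union_disjoint[symmetric])
    show "finite (?M 1)" "finite (?M 2)"
      using finite_strip_extensions by simp_all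
  qed (auto simp: strip_extensions_def)
  also have "?M 1 \<union> ?M 2 = {mu \<in> M. lookup mu n = 0}"
    by (auto simp: M_def)
  finally show ?thesis by (simp add: g_def)
qed

lemma D_schur:
  assumes lam: "is_partition lam" and k: "0 < k"
  shows "D k (schur lam :: 'a :: {idom, ring_char_0} power_series) =
    (\<Sum>mu\<in>strip_extensions 1 lam k \<union> strip_extensions 2 lam k. scale (of_int (d_coeff lam mu)) (schur mu))"
    (is "_ = sum _ ?M")
proof -
  have fin: "finite ?M" by (simp add: finite_strip_extensions)
  obtain n0 where n0: "keys lam \<subseteq> {..<n0}"
    using keys_bounded by blast
  show ?thesis
  proof (rule restr_eqI)
    fix n assume "n0 \<le> n"
    then have n: "lookup lam n = 0" using n0 by (auto simp: in_keys_iff subset_iff)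
    have "vand n * restr n (D k (schur lam) :: 'a power_series) =
        (\<Sum>mu\<in>{mu \<in> ?M. lookup mu n = 0}. of_int (d_coeff lam mu) * alt n (beads n mu))"
      by (rule vand_mult_D_schur_strips[OF lam n k])
    also have "\<dots> = (\<Sum>mu\<in>?M. of_int (d_coeff lam mu) * (vand n * restr n (schur mu)))"
    proof (rule sum.mono_neutral_cong_left, goal_cases)
      case 3
      show ?case
      proof
        fix mu assume "mu \<in> ?M - {mu \<in> ?M. lookup mu n = 0}"
        then have "restr n (schur mu) = (0 :: 'a power_series)"
          by (intro restr_schur_eq_0) (auto simp: strip_extensions_def)
        then show "of_int (d_coeff lam mu) * (vand n * restr n (schur mu)) = (0 :: 'a power_series)" by simp
      qed
    next
      case (4 mu)
      then have "is_partition mu" "lookup mu n = 0" by (auto simp: strip_extensions_def)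
      then show ?case by (simp add: vand_mult_schur)
    qed (use fin in auto)
    also have "\<dots> = vand n * restr n (\<Sum>mu\<in>?M. scale (of_int (d_coeff lam mu)) (schur mu))"
      by (simp add: restr_sum restr_scale of_int_mult_series scale_mult_right sum_distrib_left)
    finally show "restr n (D k (schur lam)) =
        restr n (\<Sum>mu\<in>?M. scale (of_int (d_coeff lam mu)) (schur mu :: 'a power_series))"
      by (rule vand_mult_cancel)
  qed
qed

text \<open>A positive number of added boxes makes the shape nonempty, so it has a top row, and at
  most two components means one or two; the value \<infinity> of \<open>cc\<close> excludes shapes
  that are not thin.\<close>

lemma strip_extensions_eq:
  assumes lam: "is_partition lam" and k: "0 < k"
  shows "{mu. is_partition mu \<and> diagram lam \<subseteq> diagram mu \<and> weight mu - weight lam = k \<and> cc (skew mu lam) \<le> 2} =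
    strip_extensions 1 lam k \<union> strip_extensions 2 lam k"
proof (intro Set.set_eqI)
  fix mu
  have "cc (skew mu lam) \<le> 2 \<longleftrightarrow> thin lam mu \<and> (card (strip_tops lam mu) = 1 \<or> card (strip_tops lam mu) = 2)"
    if mu: "is_partition mu" and w: "weight mu - weight lam = k"
  proof -
    have "strip_tops lam mu \<noteq> {}"
    proof
      assume "strip_tops lam mu = {}"
      have "i \<notin> strip_rows lam mu" for i
      proof (induction i)
        case (Suc i)
        show ?case
        proof
          assume i: "Suc i \<in> strip_rows lam mu"
          then have "lookup lam i < lookup mu (Suc i)"
            using \<open>strip_tops lam mu = {}\<close> by (auto simp: strip_tops_def)
          then show False using Suc partition_antimono[OF mu, of i "Suc i"] by (simp add: strip_rows_def)
        qed
      qed (use \<open>strip_tops lam mu = {}\<close> in \<open>auto simp: strip_tops_def\<close>)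
      then have "diagram mu \<subseteq> diagram lam" by (auto simp: diagram_subset_iff strip_rows_def not_less)
      then show False using weight_mono w k by fastforce
    qed
    then have "card (strip_tops lam mu) \<noteq> 0" using finite_strip_tops by simp
    then show ?thesis
      by (auto simp: cc_def broken_border_strip_iff_thin[OF lam mu] card_shape_components[OF lam mu] numeral_eq_enat)
  qed
  then show "mu \<in> {mu. is_partition mu \<and> diagram lam \<subseteq> diagram mu \<and> weight mu - weight lam = k \<and> cc (skew mu lam) \<le> 2} \<longleftrightarrow>
    mu \<in> strip_extensions 1 lam k \<union> strip_extensions 2 lam k"
    using k weight_mono[of lam mu] by (auto simp: strip_extensions_def diagram_subset_iff)
qed

section \<open>Bases of the ring of symmetric functions\<close>

lemma rearrangement_refl: "rearrangement \<alpha> \<alpha>"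
  unfolding rearrangement_def by (rule exI[of _ id]) simp

lemma rearrangement_sym: "rearrangement \<alpha> \<beta> \<Longrightarrow> rearrangement \<beta> \<alpha>"
  unfolding rearrangement_def
proof (elim exE conjE)
  fix \<pi> assume "bij \<pi>" "lookup \<beta> = lookup \<alpha> \<circ> \<pi>"
  then show "\<exists>\<pi>. bij \<pi> \<and> lookup \<alpha> = lookup \<beta> \<circ> \<pi>"
    by (intro exI[of _ "inv_into UNIV \<pi>"]) (auto simp: bij_imp_bij_inv fun_eq_iff bij_is_surj surj_f_inv_f)
qed

lemma rearrangement_trans: "rearrangement \<alpha> \<beta> \<Longrightarrow> rearrangement \<beta> \<gamma> \<Longrightarrow> rearrangement \<alpha> \<gamma>"
  unfolding rearrangement_def by (metis bij_comp comp_assoc)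

lemma bij_betw_superlevel:
  assumes "bij \<pi>" "lookup \<beta> = lookup \<alpha> \<circ> \<pi>"
  shows "bij_betw \<pi> {i. (j :: nat) < lookup \<beta> i} {i. j < lookup \<alpha> i}"
proof (rule bij_betw_imageI)
  show "inj_on \<pi> {i. j < lookup \<beta> i}" using assms(1) by (meson bij_is_inj inj_on_subset subset_UNIV)
  show "\<pi> ` {i. j < lookup \<beta> i} = {i. j < lookup \<alpha> i}"
  proof (intro Set.set_eqI iffI)
    fix i assume "i \<in> {i. j < lookup \<alpha> i}"
    moreover obtain m where "i = \<pi> m" using bij_is_surj[OF assms(1)] by (rule surjE)
    ultimately show "i \<in> \<pi> ` {i. j < lookup \<beta> i}" using assms(2) by auto
  qed (use assms(2) in auto)
qed

lemma bij_betw_keys: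
  fixes \<alpha> \<beta> :: "'b \<Rightarrow>\<^sub>0 nat"
  assumes "bij \<pi>" "lookup \<beta> = lookup \<alpha> \<circ> \<pi>"
  shows "bij_betw \<pi> (keys \<beta>) (keys \<alpha>)"
proof -
  have "keys \<gamma> = {i. 0 < lookup \<gamma> i}" for \<gamma> :: "'b \<Rightarrow>\<^sub>0 nat" by (auto simp: in_keys_iff)
  then show ?thesis using bij_betw_superlevel[OF assms, of 0] by simp
qed

lemma rearrangement_weight: "rearrangement \<alpha> \<beta> \<Longrightarrow> weight \<beta> = weight \<alpha>"
  unfolding rearrangement_def weight_def
  by (elim exE conjE) (use sum.reindex_bij_betw[OF bij_betw_keys] in fastforce)

lemma rearrangement_complete_sym:
  "rearrangement \<alpha> \<beta> \<Longrightarrow> complete_sym \<beta> = complete_sym \<alpha>"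
  unfolding rearrangement_def complete_sym_def
proof (elim exE conjE)
  fix \<pi> assume \<pi>: "bij \<pi>" "lookup \<beta> = lookup \<alpha> \<circ> \<pi>"
  show "(\<Prod>i\<in>keys \<beta>. complete_hom (lookup \<beta> i)) = (\<Prod>i\<in>keys \<alpha>. complete_hom (lookup \<alpha> i) :: 'a power_series)"
    using prod.reindex_bij_betw[OF bij_betw_keys[OF \<pi>], of "\<lambda>i. complete_hom (lookup \<alpha> i)"] \<pi>(2) by simp
qed

text \<open>The number of parts exceeding j is invariant under rearrangement. For a partition these
  parts come first, so the numbers determine it; they are the parts of the conjugate
  partition.\<close>

lemma partition_rearrangement_unique:
  assumes "is_partition lam" "is_partition mu" "rearrangement lam mu"
  shows "lam = mu"
proof -
  have card_eq: "card {i. j < lookup mu i} = card {i. j < lookup lam i}" for j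
  proof -
    obtain \<pi> where \<pi>: "bij \<pi>" "lookup mu = lookup lam \<circ> \<pi>" using assms(3) by (auto simp: rearrangement_def)
    show ?thesis by (rule bij_betw_same_card[OF bij_betw_superlevel[OF \<pi>]])
  qed
  have init: "i < card {i. j < lookup nu i} \<longleftrightarrow> j < lookup nu i" if nu: "is_partition nu" for nu i j
  proof -
    define m where "m = (LEAST m. \<not> j < lookup nu m)"
    have "finite {i. j < lookup nu i}"
      by (rule finite_subset[of _ "keys nu"]) (auto simp: in_keys_iff)
    then obtain m0 where "\<not> j < lookup nu m0"
      by (metis UNIV_I ex_new_if_finite infinite_UNIV_nat mem_Collect_eq)
    then have "\<not> j < lookup nu m" unfolding m_def by (rule LeastI)
    moreover have "j < lookup nu i" if "i < m" for i using not_less_Least[OF that[unfolded m_def]] by blast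
    ultimately have "j < lookup nu i \<longleftrightarrow> i < m" for i
      using partition_antimono[OF nu, of m i] by (meson leI order_less_le_trans)
    then have "{i. j < lookup nu i} = {..<m}" by auto
    then show ?thesis by auto
  qed
  show ?thesis
  proof (rule poly_mapping_eqI)
    fix i
    have "j < lookup lam i \<longleftrightarrow> j < lookup mu i" for j
      using init[OF assms(1), of i j] init[OF assms(2), of i j] card_eq[of j] by simp
    then show "lookup lam i = lookup mu i" by (meson less_irrefl nat_neq_iff)
  qed
qed

lemma partition_rearrangement_exists: "\<exists>lam. is_partition lam \<and> rearrangement lam \<alpha>"
proof -
  obtain n where n: "keys \<alpha> \<subseteq> {..<n}"
    using keys_bounded by blast
  define xs where "xs = rev (sort (map (lookup \<alpha>) [0..<n]))"
  have len: "length xs = n" by (simp add: xs_def)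
  have "mset xs = mset (map (lookup \<alpha>) [0..<n])" by (simp add: xs_def)
  then obtain p where p: "p permutes {..<length (map (lookup \<alpha>) [0..<n])}"
    "permute_list p (map (lookup \<alpha>) [0..<n]) = xs"
    by (rule mset_eq_permutation)
  then have pn: "p permutes {..<n}" by simp
  have xs: "xs ! i = lookup \<alpha> (p i)" if "i < n" for i
    using that p permute_list_nth[OF p(1), of i] permutes_in_image[OF pn, of i] by simp
  define lam where "lam = of_fun n (\<lambda>i. xs ! i)"
  have "lookup lam i = lookup \<alpha> (p i)" for i
  proof (cases "i < n")
    case False
    then have "p i = i" "i \<notin> keys \<alpha>" using pn n by (auto simp: permutes_def)
    then show ?thesis using False by (simp add: lam_def in_keys_iff)
  qed (simp add: lam_def xs)
  then have "rearrangement \<alpha> lam"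
    unfolding rearrangement_def using permutes_bij[OF pn] by (intro exI[of _ p]) auto
  moreover have "is_partition lam"
  proof (rule is_partition_SucI)
    fix i
    have "sorted (rev xs)" by (simp add: xs_def)
    then have "xs ! Suc i \<le> xs ! i" if "Suc i < n"
      using sorted_rev_nth_mono[of xs i "Suc i"] that len by simp
    then show "lookup lam (Suc i) \<le> lookup lam i" by (simp add: lam_def)
  qed
  ultimately show ?thesis using rearrangement_sym by blast
qed

lemma symmetric_coeff: "f \<in> symmetric_functions \<Longrightarrow> rearrangement \<alpha> \<beta> \<Longrightarrow> coeff f \<alpha> = coeff f \<beta>"
  by (simp add: symmetric_functions_def)

lemma symmetric_eqI:
  assumes "f \<in> symmetric_functions" "g \<in> symmetric_functions"
    and "\<And>lam. is_partition lam \<Longrightarrow> coeff f lam = coeff g lam"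
  shows "f = g"
proof (rule series_eqI)
  fix \<alpha>
  obtain lam where "is_partition lam" "rearrangement lam \<alpha>" using partition_rearrangement_exists by blast
  then show "coeff f \<alpha> = coeff g \<alpha>"
    using assms symmetric_coeff by metis
qed

lemma coeff_monomial_sym:
  "is_partition lam \<Longrightarrow> is_partition mu \<Longrightarrow> coeff (monomial_sym lam) mu = (if lam = mu then 1 else 0)"
  using partition_rearrangement_unique rearrangement_refl by (auto simp: monomial_sym_def)

lemma symmetric_0: "0 \<in> symmetric_functions"
  by (simp add: symmetric_functions_def)

lemma symmetric_add: "f \<in> symmetric_functions \<Longrightarrow> g \<in> symmetric_functions \<Longrightarrow> f + g \<in> symmetric_functions"
proof -
  assume f: "f \<in> symmetric_functions" and g: "g \<in> symmetric_functions"
  obtain d e where "\<And>\<alpha>. coeff f \<alpha> \<noteq> 0 \<Longrightarrow> weight \<alpha> \<le> d" "\<And>\<alpha>. coeff g \<alpha> \<noteq> 0 \<Longrightarrow> weight \<alpha> \<le> e"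
    using f g by (auto simp: symmetric_functions_def)
  then have "weight \<alpha> \<le> max d e" if "coeff (f + g) \<alpha> \<noteq> 0" for \<alpha>
    using that by (cases "coeff f \<alpha> = 0") (auto simp: le_max_iff_disj)
  then show ?thesis using f g by (auto simp: symmetric_functions_def)
qed

lemma symmetric_scale: "f \<in> symmetric_functions \<Longrightarrow> scale c f \<in> symmetric_functions"
proof -
  assume f: "f \<in> symmetric_functions"
  obtain d where "\<And>\<alpha>. coeff f \<alpha> \<noteq> 0 \<Longrightarrow> weight \<alpha> \<le> d" using f by (auto simp: symmetric_functions_def)
  then have "weight \<alpha> \<le> d" if "coeff (scale c f) \<alpha> \<noteq> 0" for \<alpha>
    using that by (cases "coeff f \<alpha> = 0") auto
  then show ?thesis using f by (auto simp: symmetric_functions_def)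
qed

lemma symmetric_sum: "(\<And>x. x \<in> A \<Longrightarrow> f x \<in> symmetric_functions) \<Longrightarrow> sum f A \<in> symmetric_functions"
  by (induction A rule: infinite_finite_induct) (auto simp: symmetric_0 symmetric_add)

lemma monomial_sym_symmetric: "monomial_sym lam \<in> symmetric_functions"
proof -
  have "weight \<alpha> \<le> weight lam" if "coeff (monomial_sym lam :: 'a power_series) \<alpha> \<noteq> 0" for \<alpha>
    using that rearrangement_weight[of lam \<alpha>] by (auto simp: monomial_sym_def split: if_splits)
  moreover have "coeff (monomial_sym lam :: 'a power_series) \<alpha> = coeff (monomial_sym lam) \<beta>"
    if "rearrangement \<alpha> \<beta>" for \<alpha> \<beta>
  proof -
    have "rearrangement lam \<alpha> \<longleftrightarrow> rearrangement lam \<beta>"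
      using that rearrangement_trans[of lam \<alpha> \<beta>] rearrangement_trans[of lam \<beta> \<alpha>] rearrangement_sym[of \<alpha> \<beta>] by blast
    then show ?thesis by (simp add: monomial_sym_def)
  qed
  ultimately show ?thesis unfolding symmetric_functions_def by blast
qed

lemma schur_coeff_sum_schur:
  assumes "finite A" "\<And>mu. mu \<in> A \<Longrightarrow> is_partition mu" "is_partition lam"
  shows "schur_coeff lam (\<Sum>mu\<in>A. scale (c mu) (schur mu)) = (if lam \<in> A then c lam else 0)"
proof -
  have "schur_coeff lam (\<Sum>mu\<in>A. scale (c mu) (schur mu)) = (\<Sum>mu\<in>A. if mu = lam then c lam else 0)"
    unfolding schur_coeff_sum schur_coeff_scale
    by (rule sum.cong) (auto simp: schur_coeff_schur assms)
  then show ?thesis using assms(1) by simp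
qed

lemma schur_coeff_complete_sym:
  assumes "is_partition lam"
  shows "schur_coeff lam (complete_sym \<alpha> :: 'a :: {idom, ring_char_0} power_series) = of_nat (kostka lam \<alpha>)"
proof -
  have "schur_coeff lam (complete_sym \<alpha> :: 'a power_series) =
      (if lam \<in> {lam. is_partition lam \<and> weight lam = weight \<alpha>} then of_nat (kostka lam \<alpha>) else 0)"
    unfolding complete_sym_eq_sum_schur
    by (rule schur_coeff_sum_schur) (use assms finite_partitions in auto)
  then show ?thesis using kostka_weight[of lam \<alpha>] assms by (cases "kostka lam \<alpha> = 0") auto
qed

text \<open>The Kostka number is the Schur coefficient of a product that ignores the order of its
  factors. Integers serve as coefficients here; being a statement about numbers, the result then
  applies over every ring.\<close>

lemma kostka_rearrangement:
  assumes "is_partition lam" "rearrangement \<alpha> \<beta>"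
  shows "kostka lam \<alpha> = kostka lam \<beta>"
proof -
  have "int (kostka lam \<alpha>) = int (kostka lam \<beta>)"
    using schur_coeff_complete_sym[OF assms(1), where ?'a = int] rearrangement_complete_sym[OF assms(2), where ?'a = int]
    by (metis of_nat_eq_iff)
  then show ?thesis by simp
qed

lemma schur_symmetric:
  assumes "is_partition lam"
  shows "(schur lam :: 'a::comm_ring_1 power_series) \<in> symmetric_functions"
proof -
  have "weight \<alpha> \<le> weight lam" if "coeff (schur lam :: 'a power_series) \<alpha> \<noteq> 0" for \<alpha>
    using that kostka_weight[of lam \<alpha>] by (cases "kostka lam \<alpha> = 0") (auto simp: coeff_schur)
  then show ?thesis
    unfolding symmetric_functions_def using kostka_rearrangement[OF assms] by (auto simp: coeff_schur)
qed

section \<open>Spans of families indexed by partitions\<close>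

text \<open>The shape of the sums matches those in \<open>scalar_product\<close>, so that its
  definition can be folded.\<close>

definition lin_comb :: "((nat \<Rightarrow>\<^sub>0 nat) \<Rightarrow> 'a power_series) \<Rightarrow> ((nat \<Rightarrow>\<^sub>0 nat) \<Rightarrow>\<^sub>0 'a) \<Rightarrow> 'a::comm_ring_1 power_series" where
  "lin_comb e a = (\<Sum>lam\<in>keys a. scale (lookup a lam) (e lam))"

lemma lin_comb_superset:
  assumes "keys a \<subseteq> A" "finite A"
  shows "lin_comb e a = (\<Sum>lam\<in>A. scale (lookup a lam) (e lam))"
  unfolding lin_comb_def by (rule sum.mono_neutral_left) (use assms in \<open>auto simp: in_keys_iff\<close>)

definition part_span :: "((nat \<Rightarrow>\<^sub>0 nat) \<Rightarrow> 'a power_series) \<Rightarrow> 'a::comm_ring_1 power_series set" where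
  "part_span e = {lin_comb e a | a. keys a \<subseteq> Collect is_partition}"

lemma part_span_base: "is_partition lam \<Longrightarrow> e lam \<in> part_span e"
  unfolding part_span_def
  by (rule CollectI, rule exI[of _ "Poly_Mapping.single lam 1"]) (auto simp: lin_comb_def)

lemma part_span_0: "0 \<in> part_span e"
  unfolding part_span_def by (rule CollectI, rule exI[of _ 0]) (simp add: lin_comb_def)

lemma part_span_add:
  assumes "f \<in> part_span e" "g \<in> part_span e"
  shows "f + g \<in> part_span e"
proof -
  obtain a b where a: "f = lin_comb e a" "keys a \<subseteq> Collect is_partition"
    and b: "g = lin_comb e b" "keys b \<subseteq> Collect is_partition"
    using assms by (auto simp: part_span_def)
  have ab: "keys (a + b) \<subseteq> keys a \<union> keys b" by (rule Poly_Mapping.keys_add)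
  have "lin_comb e (a + b) = (\<Sum>lam\<in>keys a \<union> keys b. scale (lookup a lam) (e lam) + scale (lookup b lam) (e lam))"
    by (subst lin_comb_superset[OF ab]) (auto simp: lookup_add algebra_simps intro!: sum.cong series_eqI)
  also have "\<dots> = f + g"
    by (simp add: a b sum.distrib lin_comb_superset[of a "keys a \<union> keys b"] lin_comb_superset[of b "keys a \<union> keys b"])
  finally show ?thesis using a(2) b(2) ab unfolding part_span_def by (metis (mono_tags, lifting) CollectI le_sup_iff order_trans)
qed

lemma part_span_scale:
  assumes "f \<in> part_span e"
  shows "scale c f \<in> part_span e"
proof -
  obtain a where a: "f = lin_comb e a" "keys a \<subseteq> Collect is_partition"
    using assms by (auto simp: part_span_def)
  let ?b = "Poly_Mapping.map ((*) c) a"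
  have b: "lookup ?b lam = c * lookup a lam" for lam
    by (simp add: Poly_Mapping.map.rep_eq when_def)
  have keys: "keys ?b \<subseteq> keys a" by (auto simp: in_keys_iff b)
  have "lin_comb e ?b = scale c f"
    unfolding lin_comb_superset[OF keys finite_keys] a(1) unfolding lin_comb_def scale_sum scale_scale b ..
  then show ?thesis using keys a(2) unfolding part_span_def by (metis (mono_tags, lifting) CollectI order_trans)
qed

lemma part_span_sum: "(\<And>x. x \<in> A \<Longrightarrow> f x \<in> part_span e) \<Longrightarrow> sum f A \<in> part_span e"
  by (induction A rule: infinite_finite_induct) (auto simp: part_span_0 part_span_add)

lemma part_span_trans:
  assumes "f \<in> part_span e" "\<And>lam. is_partition lam \<Longrightarrow> e lam \<in> part_span e'"
  shows "f \<in> part_span e'"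
proof -
  obtain a where a: "f = lin_comb e a" "keys a \<subseteq> Collect is_partition"
    using assms(1) by (auto simp: part_span_def)
  show ?thesis unfolding a(1) lin_comb_def
    by (intro part_span_sum part_span_scale assms(2)) (use a(2) in auto)
qed

lemma coeff_lin_comb_monomial:
  assumes "keys a \<subseteq> Collect is_partition" "is_partition mu"
  shows "coeff (lin_comb monomial_sym a) mu = lookup a mu"
proof -
  have "coeff (lin_comb monomial_sym a) mu = (\<Sum>lam\<in>keys a. if lam = mu then lookup a mu else 0)"
    unfolding lin_comb_def coeff_sum
    by (rule sum.cong) (use assms in \<open>auto simp: coeff_monomial_sym subset_iff\<close>)
  then show ?thesis by (simp add: in_keys_iff)
qed

lemma symmetric_eq_monomials:
  assumes f: "f \<in> symmetric_functions"
  shows "\<exists>a. keys a \<subseteq> Collect is_partition \<and> f = lin_comb monomial_sym a \<and>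
    (\<forall>lam. is_partition lam \<longrightarrow> lookup a lam = coeff f lam)"
proof -
  obtain d where d: "\<And>\<alpha>. coeff f \<alpha> \<noteq> 0 \<Longrightarrow> weight \<alpha> \<le> d" using f by (auto simp: symmetric_functions_def)
  define a where "a = Abs_poly_mapping (\<lambda>lam. if is_partition lam then coeff f lam else 0)"
  have "finite (\<Union>w\<le>d. {lam. is_partition lam \<and> weight lam = w})" by (intro finite_UN_I finite_partitions) auto
  then have "finite {lam. (if is_partition lam then coeff f lam else 0) \<noteq> 0}"
    by (rule finite_subset[rotated]) (use d in \<open>auto split: if_splits\<close>)
  then have a: "lookup a lam = (if is_partition lam then coeff f lam else 0)" for lam
    by (simp add: a_def)
  have keys: "keys a \<subseteq> Collect is_partition" by (auto simp: in_keys_iff a split: if_splits)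
  have "f = lin_comb monomial_sym a"
  proof (rule symmetric_eqI[OF f])
    show "lin_comb monomial_sym a \<in> symmetric_functions"
      unfolding lin_comb_def by (intro symmetric_sum symmetric_scale monomial_sym_symmetric)
    fix mu assume mu: "is_partition mu"
    then show "coeff f mu = coeff (lin_comb monomial_sym a) mu"
      by (simp add: coeff_lin_comb_monomial[OF keys] a)
  qed
  then show ?thesis using keys a by auto
qed

text \<open>The unitriangular system is solved for the Schur function: all other terms of the
  expansion have smaller \<open>row_sum\<close>.\<close>

lemma schur_in_complete_span:
  assumes "is_partition lam"
  shows "(schur lam :: 'a :: {idom, ring_char_0} power_series) \<in> part_span complete_sym"
  using assms
proof (induction "row_sum lam" arbitrary: lam rule: less_induct)
  case less
  let ?P = "{mu. is_partition mu \<and> weight mu = weight lam}"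
  let ?r = "\<Sum>mu\<in>?P - {lam}. scale (of_nat (kostka mu lam)) (schur mu :: 'a power_series)"
  have "complete_sym lam = scale (of_nat (kostka lam lam)) (schur lam) + ?r"
    unfolding complete_sym_eq_sum_schur
    by (rule sum.remove) (use less.prems finite_partitions in auto)
  then have eq: "schur lam = complete_sym lam + scale (-1) ?r"
    by (intro series_eqI) (simp add: kostka_self[OF less.prems])
  have "scale (of_nat (kostka mu lam)) (schur mu :: 'a power_series) \<in> part_span complete_sym" if "mu \<in> ?P - {lam}" for mu
  proof (cases "kostka mu lam = 0")
    case False
    then have "row_sum mu < row_sum lam" using that by (intro kostka_row_sum) auto
    then show ?thesis using that by (intro part_span_scale less.hyps) auto
  qed (simp add: part_span_0)
  then have "?r \<in> part_span complete_sym" by (rule part_span_sum)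
  then show ?case unfolding eq
    by (intro part_span_add part_span_base part_span_scale less.prems)
qed

text \<open>Here the other terms have larger \<open>row_sum\<close>. Among the finitely many
  partitions of one weight it is bounded by B, so \<open>B - row_sum mu\<close> can serve as
  induction measure.\<close>

lemma monomial_in_schur_span:
  assumes "is_partition lam"
  shows "(monomial_sym lam :: 'a::comm_ring_1 power_series) \<in> part_span schur"
proof -
  let ?P = "{mu. is_partition mu \<and> weight mu = weight lam}"
  define B where "B = Max (row_sum ` ?P)"
  have B: "row_sum mu \<le> B" if "mu \<in> ?P" for mu
    unfolding B_def using that finite_partitions by (intro Max_ge finite_imageI) auto
  have "(monomial_sym mu :: 'a power_series) \<in> part_span schur" if "mu \<in> ?P" for mu
    using that
  proof (induction "B - row_sum mu" arbitrary: mu rule: less_induct)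
    case less
    note mu = less.prems
    let ?r = "\<Sum>nu\<in>?P - {mu}. scale (of_nat (kostka mu nu)) (monomial_sym nu :: 'a power_series)"
    have eq: "monomial_sym mu = schur mu + scale (-1) ?r"
    proof (rule symmetric_eqI)
      show "schur mu + scale (-1) ?r \<in> symmetric_functions"
        using mu by (intro symmetric_add symmetric_scale symmetric_sum monomial_sym_symmetric schur_symmetric) auto
      fix nu assume nu: "is_partition nu"
      have "coeff ?r nu = (\<Sum>nu'\<in>?P - {mu}. if nu' = nu then of_nat (kostka mu nu) else 0)"
        unfolding coeff_sum by (rule sum.cong) (use nu in \<open>auto simp: coeff_monomial_sym\<close>)
      also have "\<dots> = (if nu = mu then 0 else of_nat (kostka mu nu))"
        using finite_partitions nu mu kostka_weight[of mu nu] by (cases "kostka mu nu = 0") (auto simp: sum.delta)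
      finally show "coeff (monomial_sym mu :: 'a power_series) nu = coeff (schur mu + scale (-1) ?r) nu"
        using mu nu by (simp add: coeff_monomial_sym coeff_schur kostka_self)
    qed (rule monomial_sym_symmetric)
    have "scale (of_nat (kostka mu nu)) (monomial_sym nu :: 'a power_series) \<in> part_span schur" if "nu \<in> ?P - {mu}" for nu
    proof (cases "kostka mu nu = 0")
      case False
      then have "row_sum mu < row_sum nu" using that mu by (intro kostka_row_sum) auto
      then have "B - row_sum nu < B - row_sum mu" using B[of nu] that by auto
      then show ?thesis using that by (intro part_span_scale less.hyps) auto
    qed (simp add: part_span_0)
    then have "?r \<in> part_span schur" by (rule part_span_sum)
    then show ?case unfolding eq
      by (intro part_span_add part_span_base part_span_scale) (use mu in auto)
  qed
  then show ?thesis using assms by simp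
qed

lemma symmetric_in_schur_span:
  assumes "f \<in> symmetric_functions"
  shows "f \<in> part_span schur"
proof -
  have "f \<in> part_span monomial_sym"
    using symmetric_eq_monomials[OF assms] unfolding part_span_def by blast
  then show ?thesis by (rule part_span_trans) (rule monomial_in_schur_span)
qed

lemma symmetric_in_complete_span:
  fixes f :: "'a :: {idom, ring_char_0} power_series"
  assumes "f \<in> symmetric_functions"
  shows "f \<in> part_span complete_sym"
  using symmetric_in_schur_span[OF assms] by (rule part_span_trans) (rule schur_in_complete_span)

section \<open>The scalar product\<close>

text \<open>The scalar product of \<open>f\<close> with \<open>\<Sum> b\<^sub>\<mu> h\<^sub>\<mu>\<close>. It depends on the coefficients \<open>b\<^sub>\<mu>\<close> only
  through this sum, because for \<open>f = s\<^sub>\<nu>\<close> it is the coefficient of \<open>s\<^sub>\<nu>\<close> in the sum.\<close>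

definition pairing :: "'a::comm_ring_1 power_series \<Rightarrow> ((nat \<Rightarrow>\<^sub>0 nat) \<Rightarrow>\<^sub>0 'a) \<Rightarrow> 'a" where
  "pairing f b = (\<Sum>mu\<in>keys b. lookup b mu * coeff f mu)"

lemma pairing_sum: "pairing (sum f A) b = (\<Sum>x\<in>A. pairing (f x) b)"
  unfolding pairing_def coeff_sum sum_distrib_left by (rule sum.swap)

lemma pairing_scale: "pairing (scale c f) b = c * pairing f b"
  by (simp add: pairing_def sum_distrib_left mult.left_commute)

lemma pairing_schur:
  fixes b :: "(nat \<Rightarrow>\<^sub>0 nat) \<Rightarrow>\<^sub>0 'a :: {idom, ring_char_0}"
  assumes "is_partition lam"
  shows "pairing (schur lam) b = schur_coeff lam (lin_comb complete_sym b)"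
  by (simp add: pairing_def lin_comb_def schur_coeff_sum schur_coeff_scale
      schur_coeff_complete_sym[OF assms] coeff_schur)

lemma pairing_cong:
  fixes f :: "'a :: {idom, ring_char_0} power_series"
  assumes f: "f \<in> symmetric_functions" and eq: "lin_comb complete_sym b = lin_comb complete_sym b'"
  shows "pairing f b = pairing f b'"
proof -
  obtain a where a: "f = lin_comb schur a" "keys a \<subseteq> Collect is_partition"
    using symmetric_in_schur_span[OF f] by (auto simp: part_span_def)
  have "pairing (schur lam) b = pairing (schur lam) b'" if "lam \<in> keys a" for lam
    using that a(2) eq by (subst (1 2) pairing_schur) auto
  then show ?thesis unfolding a(1) lin_comb_def pairing_sum pairing_scale by simp
qed

text \<open>The monomial coefficients of f are its coefficients at partitions, which collapses the
  double sum; \<open>pairing_cong\<close> makes the value independent of the chosen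
  expansions.\<close>

lemma scalar_product_eq_pairing:
  fixes f :: "'a :: {idom, ring_char_0} power_series"
  assumes f: "f \<in> symmetric_functions" and b: "keys b \<subseteq> Collect is_partition"
  shows "scalar_product f (lin_comb complete_sym b) = pairing f b"
  unfolding scalar_product_def lin_comb_def[symmetric]
proof (rule the_equality)
  let ?dot = "\<lambda>a b'. (\<Sum>lam\<in>keys a. \<Sum>mu\<in>keys b'. lookup a lam * lookup b' mu * (if lam = mu then 1 else 0)) :: 'a"
  have double: "?dot a b' = pairing f b'"
    if a: "keys a \<subseteq> Collect is_partition" "f = lin_comb monomial_sym a" and b': "keys b' \<subseteq> Collect is_partition"
    for a b' :: "(nat \<Rightarrow>\<^sub>0 nat) \<Rightarrow>\<^sub>0 'a"
  proof -
    have "?dot a b' =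
        (\<Sum>mu\<in>keys b'. \<Sum>lam\<in>keys a. if lam = mu then lookup a mu * lookup b' mu else 0)"
      by (subst sum.swap) (intro sum.cong[OF refl], simp)
    also have "\<dots> = (\<Sum>mu\<in>keys b'. lookup a mu * lookup b' mu)"
      by (rule sum.cong[OF refl]) (simp only: sum.delta finite_keys, simp add: in_keys_iff)
    also have "\<dots> = pairing f b'"
      unfolding pairing_def a(2)
      by (rule sum.cong) (use a(1) b' in \<open>auto simp: coeff_lin_comb_monomial mult.commute subset_iff\<close>)
    finally show ?thesis .
  qed
  obtain a where a: "keys a \<subseteq> Collect is_partition" "f = lin_comb monomial_sym a"
    using symmetric_eq_monomials[OF f] by blast
  show "\<exists>a b'. keys a \<subseteq> Collect is_partition \<and> keys b' \<subseteq> Collect is_partition \<and>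
      f = lin_comb monomial_sym a \<and>
      lin_comb complete_sym b = lin_comb complete_sym b' \<and>
      pairing f b = ?dot a b'"
    using a b double[OF a b] by (intro exI[of _ a] exI[of _ b]) auto
  fix c
  assume "\<exists>a b'. keys a \<subseteq> Collect is_partition \<and> keys b' \<subseteq> Collect is_partition \<and>
      f = lin_comb monomial_sym a \<and>
      lin_comb complete_sym b = lin_comb complete_sym b' \<and>
      c = ?dot a b'"
  then obtain a' b' where ab: "keys a' \<subseteq> Collect is_partition" "keys b' \<subseteq> Collect is_partition"
    "f = lin_comb monomial_sym a'" "lin_comb complete_sym b = lin_comb complete_sym b'"
    "c = ?dot a' b'"
    by blast
  have "c = pairing f b'" unfolding ab(5) by (rule double[OF ab(1,3,2)])
  then show "c = pairing f b" using pairing_cong[OF f ab(4)] by simp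
qed

lemma scalar_product_schur:
  fixes g :: "'a :: {idom, ring_char_0} power_series"
  assumes "is_partition lam" "g \<in> symmetric_functions"
  shows "scalar_product (schur lam) g = schur_coeff lam g"
proof -
  obtain b where "g = lin_comb complete_sym b" "keys b \<subseteq> Collect is_partition"
    using symmetric_in_complete_span[OF assms(2)] by (auto simp: part_span_def)
  then show ?thesis by (simp add: scalar_product_eq_pairing schur_symmetric pairing_schur assms(1))
qed

lemma scalar_product_sum_left:
  fixes g :: "'a :: {idom, ring_char_0} power_series"
  assumes "\<And>x. x \<in> A \<Longrightarrow> f x \<in> symmetric_functions" "g \<in> symmetric_functions"
  shows "scalar_product (\<Sum>x\<in>A. scale (c x) (f x)) g = (\<Sum>x\<in>A. c x * scalar_product (f x) g)"
proof -
  obtain b where b: "g = lin_comb complete_sym b" "keys b \<subseteq> Collect is_partition"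
    using symmetric_in_complete_span[OF assms(2)] by (auto simp: part_span_def)
  have "(\<Sum>x\<in>A. scale (c x) (f x)) \<in> symmetric_functions"
    using assms(1) by (intro symmetric_sum symmetric_scale)
  then show ?thesis
    unfolding b(1) using assms(1)
    by (simp add: scalar_product_eq_pairing[OF _ b(2)] pairing_sum pairing_scale)
qed

text \<open>Pairing with a complete homogeneous function reads off one monomial coefficient.\<close>

lemma scalar_product_nondegenerate:
  fixes f g :: "'a :: {idom, ring_char_0} power_series"
  assumes f: "f \<in> symmetric_functions" and g: "g \<in> symmetric_functions"
    and eq: "\<And>h. h \<in> symmetric_functions \<Longrightarrow> scalar_product f h = scalar_product g h"
  shows "f = g"
proof (rule symmetric_eqI[OF f g])
  fix lam :: "nat \<Rightarrow>\<^sub>0 nat" assume lam: "is_partition lam"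
  have h: "(complete_sym lam :: 'a power_series) = lin_comb complete_sym (Poly_Mapping.single lam 1)"
    by (simp add: lin_comb_def)
  have "(complete_sym lam :: 'a power_series) \<in> symmetric_functions"
    unfolding complete_sym_eq_sum_schur by (intro symmetric_sum symmetric_scale schur_symmetric) auto
  then have "scalar_product f (complete_sym lam) = scalar_product g (complete_sym lam)" by (rule eq)
  then show "coeff f lam = coeff g lam"
    unfolding h using lam by (simp add: scalar_product_eq_pairing f g pairing_def)
qed

theorem proposition1:
  fixes k :: nat and lam :: "nat \<Rightarrow>\<^sub>0 nat"
  assumes "k \<ge> 1" and "is_partition lam"
  shows "D k (schur lam :: 'a :: {idom, ring_char_0} power_series) =
           (\<Sum>mu | is_partition mu \<and> diagram lam \<subseteq> diagram mu \<and> weight mu - weight lam = k \<and>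
                  cc (skew mu lam) \<le> 2.
              scale (of_int (d_coeff lam mu)) (schur mu)) \<and>
         D_perp k (schur lam :: 'a power_series) =
           (\<Sum>mu | is_partition mu \<and> diagram mu \<subseteq> diagram lam \<and> weight lam - weight mu = k \<and>
                  cc (skew lam mu) \<le> 2.
              scale (of_int (d_coeff mu lam)) (schur mu))"
proof
  have k: "0 < k" using assms(1) by simp
  note lam = assms(2)
  let ?up = "\<lambda>nu. {mu. is_partition mu \<and> diagram nu \<subseteq> diagram mu \<and> weight mu - weight nu = k \<and> cc (skew mu nu) \<le> 2}"
  let ?down = "{mu. is_partition mu \<and> diagram mu \<subseteq> diagram lam \<and> weight lam - weight mu = k \<and> cc (skew lam mu) \<le> 2}"
  have D: "D k (schur nu :: 'a power_series) = (\<Sum>mu\<in>?up nu. scale (of_int (d_coeff nu mu)) (schur mu))"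
    if "is_partition nu" for nu
    unfolding strip_extensions_eq[OF that k] by (rule D_schur[OF that k])
  show "D k (schur lam :: 'a power_series) = (\<Sum>mu\<in>?up lam. scale (of_int (d_coeff lam mu)) (schur mu))"
    by (rule D[OF lam])
  have fin_up: "finite (?up nu)" if "is_partition nu" for nu
    unfolding strip_extensions_eq[OF that k] by (simp add: finite_strip_extensions)
  have fin_down: "finite ?down"
    by (rule finite_subset[OF _ finite_subdiagrams[of lam]]) auto
  define G :: "'a power_series" where "G = (\<Sum>mu\<in>?down. scale (of_int (d_coeff mu lam)) (schur mu))"
  have G: "G \<in> symmetric_functions"
    unfolding G_def by (intro symmetric_sum symmetric_scale schur_symmetric) auto
  \<comment> \<open>With c the Schur coefficients of h, both sides equal the sum of c_nu times
    \<open>d_coeff nu lam\<close> over \<open>?down\<close>.\<close>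
  have adjoint: "scalar_product G h = scalar_product (schur lam) (D k h)" if h: "h \<in> symmetric_functions" for h :: "'a power_series"
  proof -
    obtain c where c: "h = (\<Sum>nu\<in>keys c. scale (lookup c nu) (schur nu))" "keys c \<subseteq> Collect is_partition"
      using symmetric_in_schur_span[OF h] by (auto simp: part_span_def lin_comb_def)
    have hc: "schur_coeff mu h = lookup c mu" if "is_partition mu" for mu
      unfolding c(1) by (subst schur_coeff_sum_schur) (use c(2) that in \<open>auto simp: in_keys_iff\<close>)
    have Dh: "D k h = (\<Sum>nu\<in>keys c. scale (lookup c nu) (D k (schur nu)))"
      unfolding c(1) by (simp add: D_sum D_scale)
    have Dsym: "D k (schur nu :: 'a power_series) \<in> symmetric_functions" if "is_partition nu" for nu
      unfolding D[OF that] by (intro symmetric_sum symmetric_scale schur_symmetric) auto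
    have "D k h \<in> symmetric_functions"
      unfolding Dh using c(2) by (intro symmetric_sum symmetric_scale Dsym) auto
    then have "scalar_product (schur lam) (D k h) = schur_coeff lam (D k h)"
      by (rule scalar_product_schur[OF lam])
    also have "\<dots> = (\<Sum>nu\<in>keys c. lookup c nu * (if lam \<in> ?up nu then of_int (d_coeff nu lam) else 0))"
      unfolding Dh schur_coeff_sum schur_coeff_scale
    proof (rule sum.cong[OF refl])
      fix nu assume "nu \<in> keys c"
      then have nu: "is_partition nu" using c(2) by auto
      have "schur_coeff lam (D k (schur nu :: 'a power_series)) = (if lam \<in> ?up nu then of_int (d_coeff nu lam) else 0)"
        unfolding D[OF nu] by (rule schur_coeff_sum_schur) (use fin_up[OF nu] lam in auto)
      then show "lookup c nu * schur_coeff lam (D k (schur nu)) =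
          lookup c nu * (if lam \<in> ?up nu then of_int (d_coeff nu lam) else 0)" by simp
    qed
    \<comment> \<open>For partitions, \<open>lam \<in> ?up nu\<close> and
      \<open>nu \<in> ?down\<close> are the same condition: the matrix is transposed.\<close>
    also have "\<dots> = (\<Sum>nu\<in>keys c \<inter> ?down. lookup c nu * of_int (d_coeff nu lam))"
      by (rule sum.mono_neutral_cong_right) (use c(2) lam in auto)
    also have "\<dots> = (\<Sum>nu\<in>?down. lookup c nu * of_int (d_coeff nu lam))"
      by (rule sum.mono_neutral_left) (use fin_down in \<open>auto simp: in_keys_iff\<close>)
    also have "\<dots> = (\<Sum>nu\<in>?down. of_int (d_coeff nu lam) * scalar_product (schur nu) h)"
      by (rule sum.cong) (auto simp: scalar_product_schur[OF _ h] hc mult.commute)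
    also have "\<dots> = scalar_product G h"
      unfolding G_def by (rule scalar_product_sum_left[symmetric]) (use h in \<open>auto intro: schur_symmetric\<close>)
    finally show ?thesis ..
  qed
  \<comment> \<open>\<open>adjoint\<close> shows that G satisfies the description, and nondegeneracy
    that nothing else does.\<close>
  have "D_perp k (schur lam) = G"
    unfolding D_perp_def
  proof (rule the_equality)
    fix g :: "'a power_series"
    assume g: "g \<in> symmetric_functions \<and> (\<forall>h\<in>symmetric_functions. scalar_product g h = scalar_product (schur lam) (D k h))"
    show "g = G"
      by (rule scalar_product_nondegenerate) (use g G adjoint in auto)
  qed (use G adjoint in auto)
  then show "D_perp k (schur lam :: 'a power_series) = (\<Sum>mu\<in>?down. scale (of_int (d_coeff mu lam)) (schur mu))"
    by (simp add: G_def)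
qed

end
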